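(* Assume that $p=2$ or $p=3$, and let $X$ and $Y$ be anisotropic quasilinear $p$-hypersurfaces of the same dimension over $F$. Suppose that there exist rational morphisms $X \dashrightarrow Y$ and $Y \dashrightarrow X$. Then $X$ and $Y$ are birational over $F$.
   Context: $p$ is a prime and $F$ is a non-perfect field of characteristic $p$. Rational morphisms are over the base field and need not be dominant. A quasilinear $p$-form over $F$ is a map $\varphi\colon V_\varphi \to F$ on a finite-dimensional $F$-vector space $V_\varphi$ with $\varphi(\lambda v)=\lambda^p\varphi(v)$ and $\varphi(v+w)=\varphi(v)+\varphi(w)$ for all $\lambda\in F$, $v,w\in V_\varphi$ (in coordinates, $a_1x_1^p+\dots+a_nx_n^p$). It is isotropic if $\varphi(v)=0$ for some $v\ne 0$, and anisotropic otherwise. For a quasilinear $p$-form $\varphi$ over $F$ with $\dim V_\varphi=d+2\ge 2$, $X_\varphi=\{\varphi=0\}\subset\mathbb{P}(V_\varphi)$ is the associated projective hypersurface, of dimension $d$; schemes of this type are called quasilinear $p$-hypersurfaces. $X_\varphi$ is called anisotropic if $\varphi$ is; in that case it is integral. *)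

theory Defs
  imports Complex_Main "HOL-Library.Poly_Mapping"
begin

section \<open>Quasilinear forms\<close>

definition quasilinear_form ::
  "nat \<Rightarrow> ('a::field \<Rightarrow> 'v::ab_group_add \<Rightarrow> 'v) \<Rightarrow> ('v \<Rightarrow> 'a) \<Rightarrow> bool"
  where
  "quasilinear_form p scale \<phi> \<longleftrightarrow>
     (\<forall>c v. \<phi> (scale c v) = c ^ p * \<phi> v) \<and> (\<forall>v w. \<phi> (v + w) = \<phi> v + \<phi> w)"

definition isotropic :: "('v::zero \<Rightarrow> 'a::zero) \<Rightarrow> bool"
  where "isotropic \<phi> \<longleftrightarrow> (\<exists>v. v \<noteq> 0 \<and> \<phi> v = 0)"

abbreviation anisotropic :: "('v::zero \<Rightarrow> 'a::zero) \<Rightarrow> bool"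
  where "anisotropic \<phi> \<equiv> \<not> isotropic \<phi>"


section \<open>Polynomials and forms in several variables\<close>

type_synonym ('x, 'a) mpoly = "('x \<Rightarrow>\<^sub>0 nat) \<Rightarrow>\<^sub>0 'a"

definition mconst :: "'a \<Rightarrow> ('x, 'a::zero) mpoly"
  where "mconst c = Poly_Mapping.single 0 c"

definition mvar :: "'x \<Rightarrow> ('x, 'a::zero_neq_one) mpoly"
  where "mvar x = Poly_Mapping.single (Poly_Mapping.single x 1) 1"

definition msubst ::
  "('y \<Rightarrow> ('x, 'a) mpoly) \<Rightarrow> ('y, 'a::comm_semiring_1) mpoly \<Rightarrow> ('x, 'a) mpoly"
  where
  "msubst f g = (\<Sum>m\<in>Poly_Mapping.keys g. mconst (Poly_Mapping.lookup g m) *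
     (\<Prod>y\<in>Poly_Mapping.keys m. f y ^ Poly_Mapping.lookup m y))"

text \<open>Forms of degree \<open>k\<close> in the variables from \<open>B\<close>, the zero polynomial included.\<close>

definition homogeneous :: "'x set \<Rightarrow> nat \<Rightarrow> ('x, 'a::zero) mpoly \<Rightarrow> bool"
  where
  "homogeneous B k f \<longleftrightarrow>
     (\<forall>m\<in>Poly_Mapping.keys f. Poly_Mapping.keys m \<subseteq> B \<and>
        (\<Sum>x\<in>Poly_Mapping.keys m. Poly_Mapping.lookup m x) = k)"


section \<open>Quasilinear hypersurfaces and rational morphisms\<close>

text \<open>
  Once a basis \<open>B\<close> of \<open>V\<close> is chosen, the homogeneous coordinate ring \<open>Sym V\<^sup>*\<close> of
  \<open>P(V)\<close> is the polynomial ring \<open>F[x\<^sub>b | b \<in> B]\<close>, where \<open>x\<^sub>b\<close> is the coordinate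
  function of \<open>b\<close>; the variables are indexed by the basis vectors themselves.
  The quasilinear form \<open>\<phi>\<close> is the element \<open>\<Sum>b\<in>B. \<phi>(b) x\<^sub>b\<^sup>p\<close> of this ring, and
  \<open>X = {\<phi> = 0}\<close> is \<open>Proj\<close> of the quotient by the ideal it generates.
\<close>

definition form_poly :: "nat \<Rightarrow> 'v set \<Rightarrow> ('v \<Rightarrow> 'a::comm_semiring_1) \<Rightarrow> ('v, 'a) mpoly"
  where "form_poly p B \<phi> = (\<Sum>b\<in>B. mconst (\<phi> b) * mvar b ^ p)"

text \<open>
  Divisibility in the ring of polynomials in all variables of type \<open>'v\<close> restricts to
  divisibility in \<open>F[x\<^sub>b | b \<in> B]\<close> (set the other variables to zero), so for a
  polynomial in the variables from \<open>B\<close> this says that it is zero in the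
  homogeneous coordinate ring of \<open>X\<close>.
\<close>

definition zero_on :: "nat \<Rightarrow> 'v set \<Rightarrow> ('v \<Rightarrow> 'a::comm_ring_1) \<Rightarrow> ('v, 'a) mpoly \<Rightarrow> bool"
  where "zero_on p B \<phi> h \<longleftrightarrow> form_poly p B \<phi> dvd h"

text \<open>
  Let \<open>X\<close> and \<open>Y\<close> be the hypersurfaces of \<open>\<phi>\<close> (basis \<open>B\<close>) and \<open>\<psi>\<close> (basis \<open>C\<close>), with
  \<open>X\<close> integral. A rational morphism from \<open>X\<close> to \<open>Y\<close> over \<open>F\<close> is given by forms
  \<open>f\<^sub>c\<close> (\<open>c \<in> C\<close>) of one common degree over \<open>F\<close>, not all zero on \<open>X\<close>, that satisfy the
  equation of \<open>Y\<close> on \<open>X\<close>: they define a morphism to \<open>Y\<close> on the dense open subscheme of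
  \<open>X\<close> where the \<open>f\<^sub>c\<close> do not all vanish. Two such families agree on a dense open
  subscheme if and only if they are proportional on \<open>X\<close>, and a rational morphism is
  a class of families under this relation. Points cannot be used in place of
  the coordinate ring: \<open>X\<close> has no rational point when \<open>\<phi>\<close> is anisotropic, and it is not
  geometrically reduced. Dominance is not required. The values \<open>f\<^sub>c\<close> for \<open>c \<notin> C\<close> are
  irrelevant.
\<close>

definition represents_rational ::
  "nat \<Rightarrow> 'v set \<Rightarrow> ('v \<Rightarrow> 'a::comm_ring_1) \<Rightarrow> 'w set \<Rightarrow> ('w \<Rightarrow> 'a)
    \<Rightarrow> ('w \<Rightarrow> ('v, 'a) mpoly) \<Rightarrow> bool"
  where
  "represents_rational p B \<phi> C \<psi> f \<longleftrightarrow>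
     (\<exists>k. \<forall>c\<in>C. homogeneous B k (f c)) \<and>
     (\<exists>c\<in>C. \<not> zero_on p B \<phi> (f c)) \<and>
     zero_on p B \<phi> (msubst f (form_poly p C \<psi>))"

definition rational_rel ::
  "nat \<Rightarrow> 'v set \<Rightarrow> ('v \<Rightarrow> 'a::comm_ring_1) \<Rightarrow> 'w set \<Rightarrow> ('w \<Rightarrow> 'a)
    \<Rightarrow> (('w \<Rightarrow> ('v, 'a) mpoly) \<times> ('w \<Rightarrow> ('v, 'a) mpoly)) set"
  where
  "rational_rel p B \<phi> C \<psi> =
     {(f, g). represents_rational p B \<phi> C \<psi> f \<and> represents_rational p B \<phi> C \<psi> g \<and>
        (\<forall>c\<in>C. \<forall>c'\<in>C. zero_on p B \<phi> (f c * g c' - f c' * g c))}"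

definition rational_morphisms ::
  "nat \<Rightarrow> 'v set \<Rightarrow> ('v \<Rightarrow> 'a::comm_ring_1) \<Rightarrow> 'w set \<Rightarrow> ('w \<Rightarrow> 'a)
    \<Rightarrow> ('w \<Rightarrow> ('v, 'a) mpoly) set set"
  where
  "rational_morphisms p B \<phi> C \<psi> =
     Collect (represents_rational p B \<phi> C \<psi>) // rational_rel p B \<phi> C \<psi>"

definition rational_id ::
  "nat \<Rightarrow> 'v set \<Rightarrow> ('v \<Rightarrow> 'a::comm_ring_1) \<Rightarrow> ('v \<Rightarrow> ('v, 'a) mpoly) set"
  where "rational_id p B \<phi> = rational_rel p B \<phi> B \<phi> `` {mvar}"

text \<open>
  For rational morphisms \<open>\<alpha>\<close> from \<open>X\<close> to \<open>Y\<close>, \<open>\<beta>\<close> from \<open>Y\<close> to \<open>Z\<close> and \<open>\<gamma>\<close> from \<open>X\<close> to \<open>Z\<close>: the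
  composite \<open>\<beta> \<circ> \<alpha>\<close> is defined and equals \<open>\<gamma>\<close>. The composite is defined when \<open>\<alpha>\<close> maps
  the generic point of \<open>X\<close> into the domain of \<open>\<beta>\<close>, that is, when substituting \<open>\<alpha>\<close>
  into some representative of \<open>\<beta>\<close> does not give zero throughout; the latter holds
  for the family below because members of a class \<open>\<gamma>\<close> are not zero throughout.
\<close>

definition rational_composite ::
  "('w \<Rightarrow> ('v, 'a::comm_ring_1) mpoly) set \<Rightarrow> ('z \<Rightarrow> ('w, 'a) mpoly) set
    \<Rightarrow> ('z \<Rightarrow> ('v, 'a) mpoly) set \<Rightarrow> bool"
  where
  "rational_composite \<alpha> \<beta> \<gamma> \<longleftrightarrow> (\<exists>f\<in>\<alpha>. \<exists>g\<in>\<beta>. (\<lambda>z. msubst f (g z)) \<in> \<gamma>)"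

definition birational ::
  "nat \<Rightarrow> 'v set \<Rightarrow> ('v \<Rightarrow> 'a::comm_ring_1) \<Rightarrow> 'w set \<Rightarrow> ('w \<Rightarrow> 'a) \<Rightarrow> bool"
  where
  "birational p B \<phi> C \<psi> \<longleftrightarrow>
     (\<exists>\<alpha>\<in>rational_morphisms p B \<phi> C \<psi>. \<exists>\<beta>\<in>rational_morphisms p C \<psi> B \<phi>.
        rational_composite \<alpha> \<beta> (rational_id p B \<phi>) \<and>
        rational_composite \<beta> \<alpha> (rational_id p C \<psi>))"

end

theory Submission
  imports Defs "HOL-Computational_Algebra.Computational_Algebra"
begin

text \<open>
  Let \<open>\<alpha>\<close> be the generic value of \<open>\<phi>\<close>, a linear form over \<open>F\<close> in variables that are \<open>p\<close>-th powers. A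
  rational morphism from \<open>X\<close> to \<open>Y\<close> is a value of \<open>\<psi>\<close> at polynomials that is divisible by \<open>\<alpha>\<close> but not
  coordinatewise by \<open>\<alpha>\<^sup>p\<close>; differentiation lowers the order of divisibility to exactly 1, which
  means that the image is a regular point of \<open>Y\<close>. At such a point any isotropic vector of a
  third form over \<open>F(Y)\<close> can be specialised: reduce it to degree less than \<open>p\<close> in one
  variable and expand it at the point; if no Taylor coefficient were isotropic, the coefficients would have
  valuations divisible by \<open>p\<close>, which is incompatible with a root of valuation 1.
  Hence isotropy over function fields is transitive, and the specialised vector is defined over the
  field of the image point.

  Let the isotropic subspace of \<open>\<phi>\<close> over \<open>F(X)\<close> have dimension \<open>r\<close>, not larger than that
  of \<open>\<psi>\<close> over \<open>F(Y)\<close>. Sending \<open>x\<close> to the isotropic vector \<open>y\<close> of \<open>\<psi>\<close> over \<open>F(X)\<close> that has the same \<open>r\<close>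
  coordinates, up to scalars that make \<open>y\<close> regular, one recovers \<open>x\<close> rationally from \<open>y\<close> by specialising
  isotropic vectors of \<open>\<phi>\<close> from \<open>F(Y)\<close> to \<open>y\<close>. Since the dimensions of \<open>X\<close> and \<open>Y\<close> agree, \<open>y\<close> is generic in \<open>Y\<close>, so
  both maps are birational.
\<close>

text \<open>The given rational maps need not be dominant, so they cannot simply be inverted. They
  enter only through isotropy: \<psi> is isotropic over F(X) and \<phi> over F(Y). The two
  birational maps are built afresh from isotropic vectors. Because the forms are additive, the
  isotropic vectors over a field are a subspace. If the form is anisotropic off a coordinate set I,
  and I is of least size, this subspace projects isomorphically onto the I-coordinates. This is why
  r coordinates determine a vector and why isotropic vectors may be added freely. Differentiation
  reaches order 1 because the order of a value of \<psi> along \<alpha> is less than p: divisibility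
  by \<alpha>^p would make all coordinates vanish on X. Each derivative then brings down an exponent
  that is invertible mod p. Genericity of y is not derived from transcendence degrees but by
  counting: an algebraic relation between the n-1 independent coordinates of y leaves too few
  monomials in y of bounded degree to express all monomials in x.\<close>

section \<open>Ring homomorphisms\<close>

definition rhom :: "('r::comm_ring_1 \<Rightarrow> 's::comm_ring_1) \<Rightarrow> bool"
  where "rhom h \<longleftrightarrow> h 1 = 1 \<and> (\<forall>x y. h (x + y) = h x + h y) \<and> (\<forall>x y. h (x * y) = h x * h y)"

lemma rhomI:
  assumes "h 1 = 1" "\<And>x y. h (x + y) = h x + h y" "\<And>x y. h (x * y) = h x * h y"
  shows "rhom h"
  using assms by (simp add: rhom_def)

context
  fixes h :: "'r::comm_ring_1 \<Rightarrow> 's::comm_ring_1"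
  assumes h: "rhom h"
begin

lemma rhom_1: "h 1 = 1" and rhom_add: "h (x + y) = h x + h y" and rhom_mult: "h (x * y) = h x * h y"
  using h by (auto simp: rhom_def)

lemma rhom_0: "h 0 = 0"
  using rhom_add[of 0 0] by simp

lemma rhom_minus: "h (- x) = - h x"
  using rhom_add[of x "- x"] by (simp add: rhom_0 eq_neg_iff_add_eq_0 add.commute)

lemma rhom_diff: "h (x - y) = h x - h y"
  using rhom_add[of x "- y"] by (simp add: rhom_minus)

lemma rhom_sum: "h (sum f A) = (\<Sum>i\<in>A. h (f i))"
  by (induction A rule: infinite_finite_induct) (auto simp: rhom_0 rhom_add)

lemma rhom_prod: "h (prod f A) = (\<Prod>i\<in>A. h (f i))"
  by (induction A rule: infinite_finite_induct) (auto simp: rhom_1 rhom_mult)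

lemma rhom_power: "h (x ^ n) = h x ^ n"
  by (induction n) (auto simp: rhom_1 rhom_mult)

lemma rhom_of_nat: "h (of_nat n) = of_nat n"
  by (induction n) (auto simp: rhom_0 rhom_1 rhom_add)

lemma rhom_dvd: "x dvd y \<Longrightarrow> h x dvd h y"
  by (auto simp: dvd_def rhom_mult)

lemmas rhom_simps = rhom_0 rhom_1 rhom_add rhom_mult rhom_minus rhom_diff rhom_sum rhom_prod
  rhom_power rhom_of_nat

end

lemma rhom_id: "rhom (\<lambda>x. x)"
  by (simp add: rhom_def)

lemma rhom_comp: "rhom h \<Longrightarrow> rhom h' \<Longrightarrow> rhom (\<lambda>x. h' (h x))"
  by (simp add: rhom_def)

lemma rhom_poly: "rhom (\<lambda>q. poly q x)"
  by (simp add: rhom_def)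

lemma rhom_pconst: "rhom (\<lambda>c. [:c:])"
  by (simp add: rhom_def one_pCons)

lemma rhom_map_poly: "rhom h \<Longrightarrow> rhom (map_poly h)"
proof (rule rhomI)
  assume h: "rhom h"
  show "map_poly h 1 = 1"
    by (simp add: rhom_1[OF h] rhom_0[OF h] map_poly_1)
  show "map_poly h (x + y) = map_poly h x + map_poly h y" for x y
    by (rule poly_eqI) (simp add: coeff_map_poly rhom_simps[OF h])
  show "map_poly h (x * y) = map_poly h x * map_poly h y" for x y
    by (rule poly_eqI) (simp add: coeff_map_poly rhom_simps[OF h] coeff_mult)
qed

lemma rhom_frobenius:
  assumes "prime CHAR('r::comm_ring_1)"
  shows "rhom (\<lambda>x::'r. x ^ CHAR('r))"
  by (simp add: rhom_def power_mult_distrib freshmans_dream[OF assms])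

abbreviation coef :: "('x, 'a::zero) mpoly \<Rightarrow> ('x \<Rightarrow>\<^sub>0 nat) \<Rightarrow> 'a"
  where "coef \<equiv> Poly_Mapping.lookup"

abbreviation expts :: "('x, 'a::zero) mpoly \<Rightarrow> ('x \<Rightarrow>\<^sub>0 nat) set"
  where "expts \<equiv> Poly_Mapping.keys"

lemma rhom_mconst: "rhom (mconst :: 'a::comm_ring_1 \<Rightarrow> ('x, 'a) mpoly)"
  by (simp add: rhom_def mconst_def single_add mult_single)

lemma coef_mconst_mult: "coef (mconst c * g) m = c * coef g m"
  unfolding mconst_def
  by (subst mult_map_scale_conv_mult[symmetric]) (simp add: Poly_Mapping.map.rep_eq when_def)

lemma CHAR_mpoly: "CHAR(('x, 'a::comm_ring_1) mpoly) = CHAR('a)"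
  by (rule CHAR_eqI)
    (auto simp: of_nat_single of_nat_eq_0_iff_char_dvd single_zero simp del: single_of_nat
      simp flip: lookup_not_eq_zero_eq_in_keys keys_eq_empty split: if_splits
      intro: of_nat_CHAR)

subsection \<open>Evaluation homomorphisms\<close>

definition mono_val :: "('x \<Rightarrow> 's::comm_semiring_1) \<Rightarrow> ('x \<Rightarrow>\<^sub>0 nat) \<Rightarrow> 's"
  where "mono_val s m = (\<Prod>y\<in>Poly_Mapping.keys m. s y ^ Poly_Mapping.lookup m y)"

definition ev :: "('a::comm_ring_1 \<Rightarrow> 's::comm_ring_1) \<Rightarrow> ('x \<Rightarrow> 's) \<Rightarrow> ('x, 'a) mpoly \<Rightarrow> 's"
  where "ev h s g = (\<Sum>m\<in>expts g. h (coef g m) * mono_val s m)"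

lemma msubst_eq_ev: "msubst f g = ev mconst f g"
  by (simp add: msubst_def ev_def mono_val_def)

lemma mono_val_superset:
  assumes "finite A" "Poly_Mapping.keys m \<subseteq> A"
  shows "mono_val s m = (\<Prod>y\<in>A. s y ^ Poly_Mapping.lookup m y)"
  unfolding mono_val_def using assms
  by (intro prod.mono_neutral_left) (auto simp: in_keys_iff)

lemma mono_val_0 [simp]: "mono_val s 0 = 1"
  by (simp add: mono_val_def)

lemma mono_val_add: "mono_val s (m + n) = mono_val s m * mono_val s n"
proof -
  let ?A = "Poly_Mapping.keys m \<union> Poly_Mapping.keys n"
  have "mono_val s (m + n) = (\<Prod>y\<in>?A. s y ^ Poly_Mapping.lookup (m + n) y)"
    by (rule mono_val_superset) (auto simp: keys_add)
  also have "\<dots> = (\<Prod>y\<in>?A. s y ^ Poly_Mapping.lookup m y) * (\<Prod>y\<in>?A. s y ^ Poly_Mapping.lookup n y)"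
    by (simp add: lookup_add power_add prod.distrib)
  also have "\<dots> = mono_val s m * mono_val s n"
    by (simp add: mono_val_superset[of ?A])
  finally show ?thesis .
qed

lemma mono_val_single [simp]: "mono_val s (Poly_Mapping.single x k) = s x ^ k"
  by (auto simp: mono_val_def)

lemma poly_mapping_plus_induct [case_names single add]:
  assumes s: "\<And>m c. P (Poly_Mapping.single m c)"
    and a: "\<And>f g. P f \<Longrightarrow> P g \<Longrightarrow> P (f + g)"
  shows "P (f :: 'x \<Rightarrow>\<^sub>0 'b::comm_monoid_add)"
proof (induction f rule: update_induct)
  case const
  show ?case using s[of undefined 0] by simp
next
  case (update f a b)
  have "Poly_Mapping.update a b f = f + Poly_Mapping.single a b"
    using update(1) by (intro poly_mapping_eqI)
      (auto simp: lookup_update lookup_add lookup_single when_def in_keys_iff)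
  then show ?case using update a s by metis
qed

lemma single_eq_mono_val:
  "(Poly_Mapping.single m c :: ('x, 'a::comm_ring_1) mpoly) = mconst c * mono_val mvar m"
proof -
  have "mono_val mvar m = (Poly_Mapping.single m 1 :: ('x, 'a) mpoly)"
  proof (induction m rule: poly_mapping_plus_induct)
    case (single x k)
    show ?case
      by (induction k) (auto simp: mvar_def mult_single single_add simp flip: single_add)
  next
    case (add f g)
    then show ?case by (simp add: mono_val_add mult_single)
  qed
  then show ?thesis by (simp add: mconst_def mult_single)
qed

lemma mpoly_induct [case_names const var add mult]:
  assumes c: "\<And>c. P (mconst c)" and v: "\<And>x. P (mvar x)"
    and a: "\<And>f g. P f \<Longrightarrow> P g \<Longrightarrow> P (f + g)" and m: "\<And>f g. P f \<Longrightarrow> P g \<Longrightarrow> P (f * g)"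
  shows "P (g :: ('x, 'a::comm_ring_1) mpoly)"
proof (induction g rule: poly_mapping_plus_induct)
  case (single k e)
  have one: "P 1" using c[of 1] by (simp add: mconst_def)
  have pow: "P (mvar x ^ n)" for x n
    by (induction n) (auto simp: one intro: m v)
  have "P (\<Prod>y\<in>A. mvar y ^ Poly_Mapping.lookup k y)" if "finite A" for A
    using that by (induction A) (auto simp: one intro: m pow)
  then have "P (mono_val mvar k)" by (simp add: mono_val_def)
  then show ?case by (simp add: single_eq_mono_val c m)
qed (rule a)

text \<open>Constants and variables generate the polynomial ring. Identities between composites of
  substitutions, Frobenius twists and expansions are reduced by this lemma to a check on
  generators.\<close>

lemma rhom_mpoly_eqI:
  fixes h h' :: "('x, 'a::comm_ring_1) mpoly \<Rightarrow> 's::comm_ring_1"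
  assumes "rhom h" "rhom h'" "\<And>c. h (mconst c) = h' (mconst c)" "\<And>x. h (mvar x) = h' (mvar x)"
  shows "h g = h' g"
  by (induction g rule: mpoly_induct) (simp_all add: assms rhom_simps[OF assms(1)] rhom_simps[OF assms(2)])

context
  fixes h :: "'a::comm_ring_1 \<Rightarrow> 's::comm_ring_1"
  assumes h: "rhom h"
begin

lemma ev_single: "ev h s (Poly_Mapping.single m c) = h c * mono_val s m"
  by (simp add: ev_def rhom_0[OF h])

lemma ev_add: "ev h s (f + g) = ev h s f + ev h s g"
  unfolding ev_def
  by (rule setsum_keys_plus_distrib[where f = "\<lambda>m c. h c * mono_val s m"])
    (simp_all add: rhom_simps[OF h] distrib_right)

lemma ev_mult: "ev h s (f * g) = ev h s f * ev h s g"
proof (induction f rule: poly_mapping_plus_induct)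
  case (single m c)
  show ?case
  proof (induction g rule: poly_mapping_plus_induct)
    case (single n d)
    show ?case by (simp add: mult_single ev_single rhom_mult[OF h] mono_val_add mult_ac)
  qed (simp add: distrib_left ev_add)
qed (simp add: distrib_right ev_add)

lemma ev_mconst [simp]: "ev h s (mconst c) = h c"
  by (simp add: mconst_def ev_single)

lemma ev_mvar [simp]: "ev h s (mvar x) = s x"
  by (simp add: mvar_def ev_single rhom_1[OF h])

lemma rhom_ev: "rhom (ev h s)"
  using ev_mconst[of s 1] by (intro rhomI ev_add ev_mult) (simp add: mconst_def rhom_1[OF h])

end

lemma ev_id: "ev mconst mvar g = g"
  by (rule rhom_mpoly_eqI[where h' = "\<lambda>g. g"])
    (simp_all add: rhom_ev rhom_mconst rhom_id ev_mconst ev_mvar)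

section \<open>Elements of degree less than p over the field of p-th powers\<close>

text \<open>The minimal polynomial of \<theta> over the subfield of p-th powers divides T^p -
  \<theta>^p = (T - \<theta>)^p, so it is (T - \<theta>)^J up to a constant, with J < p. Its
  coefficient at T^(J-1) is a multiple of J \<theta>, and J is invertible; hence \<theta> itself is
  a p-th power.\<close>

lemma pth_power_of_relation:
  fixes \<theta> :: "'k::field" and g :: "'k poly"
  assumes pr: "prime CHAR('k)" and g: "g \<noteq> 0" "degree g < CHAR('k)"
    and root: "poly (map_poly (\<lambda>c. c ^ CHAR('k)) g) \<theta> = 0"
  shows "\<exists>e. \<theta> = e ^ CHAR('k)"
proof -
  let ?p = "CHAR('k)"
  define fr :: "'k poly \<Rightarrow> 'k poly" where "fr = map_poly (\<lambda>c. c ^ ?p)"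
  have p0: "?p > 0" using pr prime_gt_0_nat by blast
  have fr: "rhom fr"
    unfolding fr_def by (intro rhom_map_poly rhom_frobenius pr)
  note frs = rhom_simps[OF fr]
  have coeff_fr: "coeff (fr q) i = coeff q i ^ ?p" for q i
    using p0 by (simp add: fr_def coeff_map_poly)
  have fr_const: "fr [:c:] = [:c ^ ?p:]" for c
    by (rule poly_eqI) (auto simp: coeff_fr coeff_pCons p0 split: nat.splits)
  \<comment> \<open>A polynomial over the subfield of p-th powers is represented as
    \<open>fr q\<close>. A \<open>q\<close> of least degree in \<open>Q\<close> therefore plays the
    role of the minimal polynomial, and Euclidean division can be carried out on
    \<open>q\<close>.\<close>
  define Q where "Q = (\<lambda>q. q \<noteq> 0 \<and> poly (fr q) \<theta> = 0)"
  have "Q g" using g root by (simp add: Q_def fr_def)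
  then obtain g0 where Qg0: "Q g0" and min: "\<And>q. Q q \<Longrightarrow> degree g0 \<le> degree q"
    using exists_least_lemma ex_has_least_nat[of Q g degree] by blast
  define J where "J = degree g0"
  have Jp: "J < ?p" using min[OF \<open>Q g\<close>] g by (simp add: J_def)
  have lc: "coeff g0 J \<noteq> 0" using Qg0 by (simp add: Q_def J_def)
  have J0: "J > 0"
  proof (rule ccontr)
    assume "\<not> J > 0"
    then obtain c where "g0 = [:c:]" by (metis degree_eq_zeroE J_def gr0I)
    then show False using Qg0 p0 by (simp add: Q_def fr_const)
  qed
  let ?L = "[:- \<theta>, 1:]"
  define P where "P = monom 1 ?p - [:\<theta>:]"
  have frP: "fr P = ?L ^ ?p"
  proof -
    have "?L = [:- \<theta>:] + [:0, 1:]" by simp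
    then have "?L ^ ?p = [:- \<theta>:] ^ ?p + [:0, 1:] ^ ?p"
      using pr by (metis freshmans_dream semiring_char_poly)
    also have "[:- \<theta>:] ^ ?p = - [:\<theta> ^ ?p:]"
      using rhom_minus[OF rhom_frobenius[OF pr], of \<theta>]
      by (simp add: rhom_power[OF rhom_pconst, symmetric])
    also have "[:0, 1:] ^ ?p = (monom 1 ?p :: 'k poly)"
      by (simp add: monom_altdef)
    also have "(monom 1 ?p :: 'k poly) = fr (monom 1 ?p)"
      by (rule poly_eqI) (simp add: coeff_fr p0)
    finally show ?thesis by (simp add: P_def frs fr_const)
  qed
  have dvdP: "g0 dvd P"
  proof (rule ccontr)
    assume "\<not> g0 dvd P"
    then have nz: "P mod g0 \<noteq> 0" by (simp add: dvd_eq_mod_eq_0)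
    have "fr P = fr g0 * fr (P div g0) + fr (P mod g0)"
      by (metis frs(3,4) mult.commute div_mult_mod_eq)
    then have "poly (fr P) \<theta> = poly (fr (P mod g0)) \<theta>"
      using Qg0 by (simp add: Q_def)
    then have "poly (fr (P mod g0)) \<theta> = 0" using p0 by (simp add: frP power_0_left)
    then have "Q (P mod g0)" using nz by (simp add: Q_def)
    then show False
      using min degree_mod_less[of g0 P] nz Qg0 by (fastforce simp: Q_def)
  qed
  have dv: "fr g0 dvd ?L ^ ?p"
    using rhom_dvd[OF fr dvdP] frP by simp
  have frnz: "fr g0 \<noteq> 0"
    using lc coeff_fr[of g0 J] by auto
  have dg: "degree (fr g0) = J"
    by (metis J_def antisym coeff_fr degree_le frnz le_degree lc leading_coeff_0_iff p0
        power_eq_0_iff coeff_eq_0)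
  obtain h where h: "fr g0 = ?L ^ order \<theta> (fr g0) * h" "\<not> ?L dvd h"
    using order_decomp[OF frnz] by blast
  obtain s where s: "?L ^ ?p = h * s" using dv h(1) by (metis dvd_mult_right dvdE)
  have hs: "h \<noteq> 0" "s \<noteq> 0" using s by (auto simp del: power_Suc)
  have "order \<theta> h = 0" using h(2) by (metis order_0I poly_eq_0_iff_dvd)
  then have "order \<theta> s = order \<theta> (h * s)" using hs by (simp add: order_mult)
  then have "order \<theta> s = ?p" by (simp flip: s add: order_power_n_n)
  then have "?p \<le> degree s" using order_degree[OF hs(2), of \<theta>] by simp
  moreover have "?p = degree h + degree s"
    using degree_mult_eq[OF hs] by (simp flip: s add: degree_linear_power)
  ultimately have "degree h = 0" by simp
  then obtain u where u: "h = [:u:]" by (metis degree_eq_zeroE)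
  then have u0: "u \<noteq> 0" using hs by auto
  have ordJ: "order \<theta> (fr g0) = J"
    using dg h(1) u u0 by (metis degree_linear_power degree_smult_eq mult.commute mult_pCons_left
        mult_zero_left pCons_0_0 add.right_neutral)
  have eq: "fr g0 = smult u (?L ^ J)" using h(1) ordJ u by (simp add: mult.commute)
  have c1: "coeff g0 J ^ ?p = u"
    using coeff_fr[of g0 J] eq by (simp add: coeff_linear_power)
  have chJ: "J choose (J - 1) = J" using binomial_symmetric[of 1 J] J0 by simp
  have c2: "coeff g0 (J - 1) ^ ?p = u * (of_nat J * - \<theta>)"
    using coeff_fr[of g0 "J - 1"] eq J0
    by (simp add: coeff_linear_poly_power chJ flip: One_nat_def)
  have J': "(of_nat J :: 'k) \<noteq> 0"
    using J0 Jp by (auto simp: of_nat_eq_0_iff_char_dvd dest: dvd_imp_le)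
  have J'': "(of_nat J :: 'k) ^ ?p = of_nat J"
    by (rule rhom_of_nat[OF rhom_frobenius[OF pr]])
  have "(- coeff g0 (J - 1)) ^ ?p = u * of_nat J * \<theta>"
    using rhom_minus[OF rhom_frobenius[OF pr], of "coeff g0 (J - 1)"] c2 by (simp add: mult.assoc)
  then have "((- coeff g0 (J - 1)) / (coeff g0 J * of_nat J)) ^ ?p = \<theta>"
    unfolding power_divide power_mult_distrib c1 J'' using J' u0 by simp
  then show ?thesis by metis
qed

lemma CHAR_fract: "CHAR('a::idom fract) = CHAR('a)"
proof (rule CHAR_eqI)
  have *: "(of_nat n :: 'a fract) = to_fract (of_nat n)" for n
    by (induction n) auto
  show "of_nat CHAR('a) = (0 :: 'a fract)" by (simp add: *)
  show "CHAR('a) dvd n" if "of_nat n = (0 :: 'a fract)" for n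
    using that by (simp add: * of_nat_eq_0_iff_char_dvd)
qed

text \<open>The field version is applied in the fraction field; writing the p-th root as e/d gives
  the form free of denominators.\<close>

lemma pth_power_of_relation_idom:
  fixes \<theta> :: "'d::idom" and g :: "'d poly"
  assumes pr: "prime CHAR('d)" and g: "g \<noteq> 0" "degree g < CHAR('d)"
    and root: "(\<Sum>j<CHAR('d). coeff g j ^ CHAR('d) * \<theta> ^ j) = 0"
  shows "\<exists>d e. d \<noteq> 0 \<and> \<theta> * d ^ CHAR('d) = e ^ CHAR('d)"
proof -
  let ?p = "CHAR('d)"
  have p0: "?p > 0" using pr prime_gt_0_nat by blast
  have tf: "rhom (to_fract :: 'd \<Rightarrow> 'd fract)" by (simp add: rhom_def)
  note tfs = rhom_simps[OF tf]
  define G where "G = map_poly to_fract g"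
  have cG: "coeff G j = to_fract (coeff g j)" for j by (simp add: G_def coeff_map_poly)
  have G0: "G \<noteq> 0" using g(1) by (metis cG coeff_0 leading_coeff_0_iff to_fract_eq_0_iff)
  have dG: "degree G < ?p" using g(2) by (simp add: G_def degree_map_poly)
  have d2: "degree (map_poly (\<lambda>c. c ^ ?p) G) < ?p"
    using dG p0 G0 by (simp add: degree_map_poly)
  have "poly (map_poly (\<lambda>c. c ^ ?p) G) (to_fract \<theta>)
      = (\<Sum>j<?p. coeff (map_poly (\<lambda>c. c ^ ?p) G) j * to_fract \<theta> ^ j)"
    using d2 unfolding poly_altdef
    by (intro sum.mono_neutral_left) (auto simp: coeff_eq_0)
  also have "\<dots> = to_fract (\<Sum>j<?p. coeff g j ^ ?p * \<theta> ^ j)"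
    using p0 by (simp add: coeff_map_poly cG tfs)
  finally have "poly (map_poly (\<lambda>c. c ^ ?p) G) (to_fract \<theta>) = 0" using root by simp
  then obtain x where x: "to_fract \<theta> = x ^ ?p"
    using pth_power_of_relation[of G "to_fract \<theta>"] pr G0 dG by (auto simp: CHAR_fract)
  obtain e d where ed: "x = Fract e d" "d \<noteq> 0" by (cases x) auto
  then have "x * to_fract d = to_fract e"
    by (simp add: to_fract_def eq_fract)
  then have "to_fract \<theta> * to_fract d ^ ?p = to_fract e ^ ?p"
    unfolding x by (simp flip: power_mult_distrib)
  then have "to_fract (\<theta> * d ^ ?p) = to_fract (e ^ ?p)" by (simp add: tfs)
  then have "\<theta> * d ^ ?p = e ^ ?p" by (simp only: to_fract_eq_iff)
  then show ?thesis using ed by blast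
qed

section \<open>Substitution and divisibility by constants\<close>

lemma rhom_msubst: "rhom (msubst (s :: 'x \<Rightarrow> ('y, 'a::comm_ring_1) mpoly))"
  unfolding msubst_eq_ev[abs_def] by (rule rhom_ev[OF rhom_mconst])

lemmas msubst_simps = rhom_simps[OF rhom_msubst]

lemma msubst_mconst [simp]: "msubst (s :: 'x \<Rightarrow> ('y, 'a::comm_ring_1) mpoly) (mconst c) = mconst c"
  by (simp add: msubst_eq_ev ev_mconst rhom_mconst)

lemma msubst_mvar [simp]: "msubst (s :: 'x \<Rightarrow> ('y, 'a::comm_ring_1) mpoly) (mvar x) = s x"
  by (simp add: msubst_eq_ev ev_mvar rhom_mconst)

lemma msubst_msubst:
  "msubst (s :: 'y \<Rightarrow> ('z, 'a::comm_ring_1) mpoly) (msubst t g) = msubst (\<lambda>x. msubst s (t x)) g"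
  by (rule rhom_mpoly_eqI[where h = "\<lambda>g. msubst s (msubst t g)"])
    (simp_all add: rhom_comp rhom_msubst)

lemma msubst_cong_mod:
  fixes s s' :: "'x \<Rightarrow> ('y, 'a::comm_ring_1) mpoly"
  assumes "\<And>x. q dvd s x - s' x"
  shows "q dvd msubst s g - msubst s' g"
proof (induction g rule: mpoly_induct)
  case (add f g)
  have "msubst s (f + g) - msubst s' (f + g) = (msubst s f - msubst s' f) + (msubst s g - msubst s' g)"
    by (simp add: msubst_simps)
  then show ?case using add by simp
next
  case (mult f g)
  have "msubst s (f * g) - msubst s' (f * g)
    = (msubst s f - msubst s' f) * msubst s g + msubst s' f * (msubst s g - msubst s' g)"
    by (simp add: msubst_simps algebra_simps)
  then show ?case using mult by simp
qed (simp_all add: assms)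

lemma coef_mconst: "coef (mconst c) m = (if m = 0 then c else 0)"
  by (simp add: mconst_def lookup_single when_def)

lemma mconst_0 [simp]: "mconst 0 = 0"
  by (simp add: mconst_def)

lemma mconst_1 [simp]: "mconst 1 = 1"
  by (simp add: mconst_def)

lemma mconst_eq_0_iff [simp]: "mconst c = 0 \<longleftrightarrow> c = 0"
  by (metis coef_mconst lookup_zero mconst_0)

lemmas mconst_simps = rhom_simps[OF rhom_mconst]

lemmas mconst_mult = rhom_mult[OF rhom_mconst, symmetric]

lemma single_1_eq_iff: "Poly_Mapping.single x (Suc 0) = Poly_Mapping.single y (Suc 0) \<longleftrightarrow> x = y"
  by (metis lookup_single_eq lookup_single_not_eq nat.distinct(1))

lemma coef_mvar: "coef (mvar x) m = (if m = Poly_Mapping.single x 1 then 1 else 0)"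
  by (auto simp: mvar_def lookup_single when_def)

lemma coef_ev_mconst:
  assumes h: "rhom h"
  shows "coef (ev (\<lambda>c. mconst (h c)) mvar g) m = h (coef g m)"
proof (induction g rule: poly_mapping_plus_induct)
  case (single k c)
  have "ev (\<lambda>c. mconst (h c)) mvar (Poly_Mapping.single k c) = Poly_Mapping.single k (h c)"
    unfolding ev_single[OF rhom_comp[OF h rhom_mconst]] by (rule single_eq_mono_val[symmetric])
  then show ?case by (simp add: lookup_single when_def rhom_0[OF h])
next
  case (add f g)
  then show ?case by (simp add: ev_add[OF rhom_comp[OF h rhom_mconst]] lookup_add rhom_add[OF h])
qed

lemma mconst_dvd_iff: "mconst c dvd g \<longleftrightarrow> (\<forall>m. c dvd coef g m)"
proof
  assume "mconst c dvd g"
  then show "\<forall>m. c dvd coef g m" by (auto simp: coef_mconst_mult)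
next
  assume *: "\<forall>m. c dvd coef g m"
  have "mconst c dvd Poly_Mapping.single m (coef g m)" for m
  proof -
    obtain d where "coef g m = c * d" using * by blast
    then have "Poly_Mapping.single m (coef g m) = mconst c * Poly_Mapping.single m d"
      by (simp add: mconst_def mult_single)
    then show ?thesis by simp
  qed
  then have "mconst c dvd (\<Sum>m\<in>expts g. Poly_Mapping.single m (coef g m))" by (intro dvd_sum) auto
  also have "(\<Sum>m\<in>expts g. Poly_Mapping.single m (coef g m)) = g"
    by (rule poly_mapping_eqI) (auto simp: lookup_sum lookup_single when_def in_keys_iff sum.delta')
  finally show "mconst c dvd g" .
qed

subsection \<open>The Frobenius twist\<close>

text \<open>
  Identify \<open>F[x]\<close> with the polynomials over \<open>F\<^sup>p\<close> in the variables \<open>t = x\<^sup>p\<close>. This turns a quasilinear form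
  \<open>\<phi>\<close> into the \<open>p\<close>-th power of the linear form \<open>\<alpha> = \<Sum> a\<^sub>i t\<^sub>i\<close> over \<open>F\<close>, and the value of a second form at a vector of
  polynomials into a linear combination, over \<open>F\<close>, of polynomials over \<open>F\<^sup>p\<close> (\<open>twisted\<close> below). The
  gain is that valuations with respect to \<open>\<alpha>\<close>, and not only with respect to \<open>\<phi>\<close>, are available.
\<close>

definition frob :: "('x, 'a::comm_ring_1) mpoly \<Rightarrow> ('x, 'a) mpoly"
  where "frob = ev (\<lambda>c. mconst (c ^ CHAR('a))) mvar"

definition lin_form :: "nat \<Rightarrow> (nat \<Rightarrow> 'a) \<Rightarrow> (nat, 'a::comm_ring_1) mpoly"
  where "lin_form n a = (\<Sum>i<n. mconst (a i) * mvar i)"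

definition diag_form :: "nat \<Rightarrow> (nat \<Rightarrow> 'a) \<Rightarrow> (nat, 'a::comm_ring_1) mpoly"
  where "diag_form n a = (\<Sum>i<n. mconst (a i) * mvar i ^ CHAR('a))"

definition twisted :: "nat \<Rightarrow> (nat \<Rightarrow> 'a) \<Rightarrow> (nat \<Rightarrow> ('x, 'a) mpoly) \<Rightarrow> ('x, 'a::comm_ring_1) mpoly"
  where "twisted n b f = (\<Sum>c<n. mconst (b c) * frob (f c))"

definition aniso :: "nat \<Rightarrow> (nat \<Rightarrow> 'a::comm_ring_1) \<Rightarrow> bool"
  where "aniso n a \<longleftrightarrow> (\<forall>c. (\<Sum>i<n. a i * c i ^ CHAR('a)) = 0 \<longrightarrow> (\<forall>i<n. c i = 0))"

section \<open>Reduction modulo a linear form\<close>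

text \<open>The equation \<open>lin_form n a = 0\<close> is solved for variable 0. This realises the
  quotient by the linear form inside the polynomial ring itself, so divisibility becomes an equation
  and primality follows from the absence of zero divisors.\<close>

definition elim0 :: "nat \<Rightarrow> (nat \<Rightarrow> 'a) \<Rightarrow> (nat, 'a::field) mpoly \<Rightarrow> (nat, 'a) mpoly"
  where "elim0 n a = msubst (\<lambda>i. if i = 0 then - (\<Sum>c=1..<n. mconst (a c / a 0) * mvar c) else mvar i)"

lemma rhom_elim0: "rhom (elim0 n a)"
  unfolding elim0_def by (rule rhom_msubst)

lemmas elim0_simps = rhom_simps[OF rhom_elim0]

lemma elim0_mconst [simp]: "elim0 n a (mconst c) = mconst c"
  by (simp add: elim0_def)

lemma elim0_mvar: "i \<noteq> 0 \<Longrightarrow> elim0 n a (mvar i) = mvar i"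
  by (simp add: elim0_def)

lemma sum_lessThan_split0:
  "0 < n \<Longrightarrow> (\<Sum>i<n. f i) = f 0 + (\<Sum>i=1..<n. f i :: 'b::comm_monoid_add)" for n :: nat
  by (simp add: sum.atLeast_Suc_lessThan lessThan_atLeast0)

context
  fixes a :: "nat \<Rightarrow> 'a::field" and n :: nat
  assumes a0: "a 0 \<noteq> 0" and n0: "n > 0"
begin

lemma elim0_lin: "elim0 n a (lin_form n a) = 0"
proof -
  have "elim0 n a (lin_form n a) = mconst (a 0) * (- (\<Sum>c=1..<n. mconst (a c / a 0) * mvar c))
      + (\<Sum>i=1..<n. mconst (a i) * mvar i)"
    using n0 by (simp add: lin_form_def sum_lessThan_split0 elim0_simps elim0_mvar)
      (simp add: elim0_def)
  also have "mconst (a 0) * (- (\<Sum>c=1..<n. mconst (a c / a 0) * mvar c)) = - (\<Sum>i=1..<n. mconst (a i) * mvar i)"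
    using a0 by (simp add: sum_distrib_left mconst_mult flip: mult.assoc)
  finally show ?thesis by simp
qed

lemma lin_dvd_elim: "lin_form n a dvd g - elim0 n a g"
proof -
  have "msubst mvar g = g" by (simp add: msubst_eq_ev ev_id)
  moreover have "lin_form n a dvd msubst mvar g - elim0 n a g"
    unfolding elim0_def
  proof (rule msubst_cong_mod)
    fix x
    have "mvar 0 + (\<Sum>c=1..<n. mconst (a c / a 0) * mvar c) = mconst (1 / a 0) * lin_form n a"
      using a0 n0 by (simp add: lin_form_def sum_lessThan_split0 distrib_left sum_distrib_left mconst_mult flip: mult.assoc)
    then show "lin_form n a dvd mvar x - (if x = 0 then - (\<Sum>c = 1..<n. mconst (a c / a 0) * mvar c) else mvar x)"
      by simp
  qed
  ultimately show ?thesis by simp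
qed

lemma lin_dvd_iff: "lin_form n a dvd g \<longleftrightarrow> elim0 n a g = 0"
proof
  assume "lin_form n a dvd g"
  then show "elim0 n a g = 0" using rhom_dvd[OF rhom_elim0] elim0_lin by (metis dvd_0_left)
next
  assume "elim0 n a g = 0"
  then show "lin_form n a dvd g" using lin_dvd_elim[of g] by simp
qed

lemma lin_nz: "lin_form n a \<noteq> 0"
proof
  assume "lin_form n a = 0"
  then have "coef (lin_form n a) (Poly_Mapping.single 0 1) = 0" by simp
  moreover have "coef (lin_form n a) (Poly_Mapping.single 0 1) = (\<Sum>i<n. if i = 0 then a i else 0)"
    unfolding lin_form_def lookup_sum
    by (intro sum.cong) (auto simp: coef_mconst_mult coef_mvar single_1_eq_iff)
  ultimately show False using a0 n0 by simp
qed

lemma lin_dvd_mult_iff: "lin_form n a dvd x * y \<longleftrightarrow> lin_form n a dvd x \<or> lin_form n a dvd y"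
  by (simp add: lin_dvd_iff elim0_simps)

lemma lin_not_dvd_1: "\<not> lin_form n a dvd 1"
  by (simp add: lin_dvd_iff elim0_simps)

end

subsection \<open>Division by a quasilinear form\<close>

definition low_degree :: "nat \<Rightarrow> (nat, 'a::zero) mpoly \<Rightarrow> bool"
  where "low_degree k g \<longleftrightarrow> (\<forall>m\<in>expts g. Poly_Mapping.lookup m 0 < k)"

text \<open>Common to \<open>upoly0\<close> and \<open>taylor\<close>: both send variable 0 to a
  polynomial of degree at most 1 and the other variables to constants.\<close>

lemma degree_ev_low:
  fixes h :: "'a::comm_ring_1 \<Rightarrow> 's::idom"
  assumes "low_degree k g" "k > 0" "\<And>i. i \<noteq> 0 \<Longrightarrow> degree (s i) = 0" "degree (s 0) \<le> 1"
  shows "degree (ev (\<lambda>c. [:h c:]) s g) < k"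
proof -
  have mono: "degree (mono_val s m) \<le> Poly_Mapping.lookup m 0" for m
  proof -
    let ?A = "insert 0 (Poly_Mapping.keys m)"
    have "degree (mono_val s m) \<le> (\<Sum>y\<in>?A. degree (s y ^ Poly_Mapping.lookup m y))"
      by (subst mono_val_superset[of ?A]) (auto intro!: degree_prod_sum_le[THEN order_trans])
    also have "\<dots> \<le> (\<Sum>y\<in>?A. if y = 0 then Poly_Mapping.lookup m 0 else 0)"
    proof (rule sum_mono)
      fix y
      show "degree (s y ^ Poly_Mapping.lookup m y) \<le> (if y = 0 then Poly_Mapping.lookup m 0 else 0)"
      proof (cases "y = 0")
        case True
        have "degree (s 0 ^ Poly_Mapping.lookup m 0) \<le> degree (s 0) * Poly_Mapping.lookup m 0"
          by (rule degree_power_le)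
        also have "\<dots> \<le> 1 * Poly_Mapping.lookup m 0" by (rule mult_le_mono1[OF assms(4)])
        finally show ?thesis using True by simp
      next
        case False
        then show ?thesis using degree_power_le[of "s y" "Poly_Mapping.lookup m y"] assms(3) by simp
      qed
    qed
    also have "\<dots> = Poly_Mapping.lookup m 0" by (simp add: sum.delta)
    finally show ?thesis .
  qed
  have "degree ([:h (coef g m):] * mono_val s m) \<le> k - 1" if "m \<in> expts g" for m
  proof -
    have "degree ([:h (coef g m):] * mono_val s m) \<le> degree (mono_val s m)"
      by simp
    then show ?thesis using mono[of m] that assms(1) by (fastforce simp: low_degree_def)
  qed
  then have "degree (ev (\<lambda>c. [:h c:]) s g) \<le> k - 1"
    unfolding ev_def by (intro degree_sum_le) auto
  then show ?thesis using assms(2) by linarith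
qed

text \<open>The polynomial seen as univariate in variable 0. The coefficient type still contains
  variable 0, although no coefficient involves it; evaluation at \<open>mvar 0\<close> then recovers
  the polynomial.\<close>

definition upoly0 :: "(nat, 'a::comm_ring_1) mpoly \<Rightarrow> (nat, 'a) mpoly poly"
  where "upoly0 = ev (\<lambda>c. [:mconst c:]) (\<lambda>i. if i = 0 then [:0, 1:] else [:mvar i:])"

lemma rhom_yc: "rhom (\<lambda>c. [:mconst c :: ('x, 'a::comm_ring_1) mpoly:])"
  using rhom_comp[OF rhom_mconst rhom_pconst] .

lemma rhom_upoly0: "rhom upoly0"
  unfolding upoly0_def by (rule rhom_ev[OF rhom_yc])

lemmas upoly0_simps = rhom_simps[OF rhom_upoly0]

lemma upoly0_mconst [simp]: "upoly0 (mconst c) = [:mconst c:]"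
  by (simp add: upoly0_def ev_mconst[OF rhom_yc])

lemma upoly0_mvar [simp]: "upoly0 (mvar i) = (if i = 0 then [:0, 1:] else [:mvar i:])"
  by (simp add: upoly0_def ev_mvar[OF rhom_yc])

lemma poly_upoly0: "poly (upoly0 g) (mvar 0) = g"
  by (rule rhom_mpoly_eqI[where h = "\<lambda>g. poly (upoly0 g) (mvar 0)"])
    (simp_all add: rhom_comp[OF rhom_upoly0 rhom_poly] rhom_id)

lemma upoly0_eq_0_iff: "upoly0 g = 0 \<longleftrightarrow> g = 0"
  by (metis poly_0 poly_upoly0 upoly0_simps(1))

lemma degree_upoly0_low: "low_degree k g \<Longrightarrow> k > 0 \<Longrightarrow> degree (upoly0 (g :: (nat, 'a::idom) mpoly)) < k"
  unfolding upoly0_def by (rule degree_ev_low) auto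

lemma low_degree_add: "low_degree k f \<Longrightarrow> low_degree k g \<Longrightarrow> low_degree k (f + g)"
  unfolding low_degree_def using keys_add[of f g] by blast

section \<open>Calculus of the twist in characteristic p\<close>

locale prime_char_field =
  fixes F :: "'a::field itself"
  assumes prime_char: "prime CHAR('a)"
begin

lemma p_pos: "CHAR('a) > 0"
  using prime_char prime_gt_0_nat by blast

lemma p_ge2: "CHAR('a) \<ge> 2"
  using prime_char prime_ge_2_nat by blast

lemma rhom_frob_coeff: "rhom (\<lambda>c::'a. mconst (c ^ CHAR('a)) :: ('x, 'a) mpoly)"
  by (rule rhom_comp[OF rhom_frobenius[OF prime_char] rhom_mconst])

lemma rhom_frob: "rhom (frob :: ('x, 'a) mpoly \<Rightarrow> _)"
  unfolding frob_def by (rule rhom_ev[OF rhom_frob_coeff])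

lemmas frob_simps = rhom_simps[OF rhom_frob]

lemma frob_mconst [simp]: "frob (mconst (c::'a)) = mconst (c ^ CHAR('a))"
  by (simp add: frob_def ev_mconst[OF rhom_frob_coeff])

lemma frob_mvar [simp]: "frob (mvar i :: ('x, 'a) mpoly) = mvar i"
  by (simp add: frob_def ev_mvar[OF rhom_frob_coeff])

lemma coef_frob: "coef (frob (g :: ('x, 'a) mpoly)) m = coef g m ^ CHAR('a)"
  unfolding frob_def by (rule coef_ev_mconst[OF rhom_frobenius[OF prime_char]])

lemma frob_eq_0_iff: "frob (g :: ('x, 'a) mpoly) = 0 \<longleftrightarrow> g = 0"
proof
  assume "frob g = 0"
  then have "coef g m = 0" for m using coef_frob[of g m] p_pos by simp
  then show "g = 0" by (intro poly_mapping_eqI) simp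
qed (simp add: frob_simps)

lemma expts_frob: "expts (frob (g :: ('x, 'a) mpoly)) = expts g"
  using p_pos by (auto simp: in_keys_iff coef_frob)

lemma frob_msubst: "frob (msubst s (g :: ('x, 'a) mpoly)) = msubst (\<lambda>i. frob (s i)) (frob g)"
  by (rule rhom_mpoly_eqI[where h = "\<lambda>g. frob (msubst s g)"])
    (simp_all add: rhom_comp rhom_frob rhom_msubst)

lemma rhom_pow: "rhom (\<lambda>g :: ('x, 'a) mpoly. g ^ CHAR('a))"
  using rhom_frobenius[where 'r = "('x, 'a) mpoly"] prime_char by (simp add: CHAR_mpoly)

lemmas pow_simps = rhom_simps[OF rhom_pow]

lemma frob_qf: "frob (diag_form n (a :: nat \<Rightarrow> 'a)) = lin_form n a ^ CHAR('a)"
  by (simp add: diag_form_def lin_form_def frob_simps pow_simps power_mult_distrib mconst_simps)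

lemma frob_qf_alt: "frob (diag_form n (a :: nat \<Rightarrow> 'a)) = diag_form n (\<lambda>i. a i ^ CHAR('a))"
  by (simp add: diag_form_def frob_simps)

lemma tw_add: "twisted n b (\<lambda>c. f c + g c) = twisted n b f + twisted n (b :: nat \<Rightarrow> 'a) g"
  by (simp add: twisted_def frob_simps distrib_left sum.distrib)

lemma tw_mult: "twisted n b (\<lambda>c. g * f c) = frob g * twisted n (b :: nat \<Rightarrow> 'a) f"
  by (simp add: twisted_def frob_simps sum_distrib_left mult_ac)

lemma tw_sum: "twisted n b (\<lambda>c. \<Sum>i\<in>A. f i c) = (\<Sum>i\<in>A. twisted n (b :: nat \<Rightarrow> 'a) (f i))"
  unfolding twisted_def frob_simps sum_distrib_left by (rule sum.swap)

lemma aniso_nz: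
  assumes "aniso n (a :: nat \<Rightarrow> 'a)" "i < n"
  shows "a i \<noteq> 0"
proof
  assume 0: "a i = 0"
  have "(\<Sum>j<n. a j * (if j = i then 1 else 0) ^ CHAR('a)) = 0"
    using 0 p_pos by (intro sum.neutral) (auto simp: power_0_left)
  then show False using assms by (fastforce simp: aniso_def)
qed

text \<open>Each coefficient of \<open>twisted n b f\<close> is the value of the form at the
  corresponding coefficients of \<open>f\<close>, so anisotropy over the base field carries over to
  polynomial vectors.\<close>

lemma tw_eq_0:
  assumes "aniso n (b :: nat \<Rightarrow> 'a)" "twisted n b f = 0" "c < n"
  shows "f c = 0"
proof (rule poly_mapping_eqI)
  fix m
  have "(\<Sum>c<n. b c * coef (f c) m ^ CHAR('a)) = coef (twisted n b f) m"
    by (simp add: twisted_def lookup_sum coef_mconst_mult coef_frob)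
  then show "coef (f c) m = coef 0 m"
    using assms by (auto simp: aniso_def)
qed

lemma low_tw: "(\<And>c. low_degree k (f c)) \<Longrightarrow> low_degree k (twisted n (b :: nat \<Rightarrow> 'a) f)"
  unfolding low_degree_def
proof
  fix m assume f: "\<And>c. \<forall>m\<in>expts (f c). Poly_Mapping.lookup m 0 < k" and "m \<in> expts (twisted n b f)"
  then have "(\<Sum>c<n. b c * coef (f c) m ^ CHAR('a)) \<noteq> 0"
    by (simp add: in_keys_iff twisted_def lookup_sum coef_mconst_mult coef_frob)
  then obtain c where "b c * coef (f c) m ^ CHAR('a) \<noteq> 0" by (rule sum.not_neutral_contains_not_neutral)
  then show "Poly_Mapping.lookup m 0 < k" using f[of c] p_pos by (auto simp: in_keys_iff)
qed

context
  fixes a :: "nat \<Rightarrow> 'a" and n :: nat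
  assumes a0: "a 0 \<noteq> 0" and n0: "n > 0"
begin

lemma upoly0_qf: "upoly0 (diag_form n a) = [:\<Sum>i=1..<n. mconst (a i) * mvar i ^ CHAR('a):] + monom (mconst (a 0)) CHAR('a)"
proof -
  have "[:f:] * [:g:] ^ k = [:f * g ^ k:]" for f g :: "(nat, 'a) mpoly" and k
    by (simp add: rhom_power[OF rhom_pconst, symmetric])
  then have "(\<Sum>i=1..<n. [:mconst (a i):] * upoly0 (mvar i) ^ CHAR('a)) = [:\<Sum>i=1..<n. mconst (a i) * mvar i ^ CHAR('a):]"
    unfolding rhom_sum[OF rhom_pconst] by (intro sum.cong) auto
  moreover have "[:mconst (a 0):] * [:0, 1:] ^ CHAR('a) = monom (mconst (a 0)) CHAR('a)"
    by (simp add: monom_altdef)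
  ultimately show ?thesis
    using n0 by (simp add: diag_form_def sum_lessThan_split0 upoly0_simps add.commute)
qed

lemma degree_upoly0_qf: "degree (upoly0 (diag_form n a)) = CHAR('a)"
  using p_pos a0 unfolding upoly0_qf by (subst degree_add_eq_right) (auto simp: degree_monom_eq)

lemma qf_dvd_low:
  assumes "diag_form n a dvd r" "low_degree CHAR('a) r"
  shows "r = 0"
proof (rule ccontr)
  assume r: "r \<noteq> 0"
  obtain q where q: "r = diag_form n a * q" using assms(1) by blast
  then have "degree (upoly0 r) = CHAR('a) + degree (upoly0 q)"
    using r by (simp add: upoly0_simps degree_mult_eq upoly0_eq_0_iff degree_upoly0_qf)
  then show False using degree_upoly0_low[OF assms(2) p_pos] by simp
qed

text \<open>As \<open>a 0\<close> is invertible, the p-th power of variable 0 can be rewritten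
  modulo the form by the p-th powers of the others, which lowers the exponent of variable 0.\<close>

lemma reduction: "\<exists>q r. g = diag_form n a * q + r \<and> low_degree CHAR('a) r"
proof -
  define P where "P g \<longleftrightarrow> (\<exists>q r. g = diag_form n a * q + r \<and> low_degree CHAR('a) r)" for g
  have P_add: "P (f + g)" if fg: "P f" "P g" for f g
  proof -
    obtain q r q' r' where "f = diag_form n a * q + r" "low_degree CHAR('a) r" "g = diag_form n a * q' + r'" "low_degree CHAR('a) r'"
      using fg unfolding P_def by blast
    then have "f + g = diag_form n a * (q + q') + (r + r')" "low_degree CHAR('a) (r + r')"
      by (simp_all add: distrib_left low_degree_add)
    then show ?thesis unfolding P_def by blast
  qed
  have P0: "P 0" unfolding P_def by (intro exI[of _ 0]) (simp add: low_degree_def)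
  have P_sum: "P (sum f A)" if "\<And>i. i \<in> A \<Longrightarrow> P (f i)" for f and A :: "nat set"
    using that by (induction A rule: infinite_finite_induct) (auto simp: P0 P_add)
  have P_qf: "P (diag_form n a * q)" for q
    unfolding P_def by (intro exI[of _ q] exI[of _ 0]) (simp add: low_degree_def)
  have "P (Poly_Mapping.single m c)" for m c
  proof (induction "Poly_Mapping.lookup m 0" arbitrary: m c rule: less_induct)
    case less
    show ?case
    proof (cases "Poly_Mapping.lookup m 0 < CHAR('a)")
      case True
      then have "low_degree CHAR('a) (Poly_Mapping.single m c)" by (simp add: low_degree_def)
      then show ?thesis unfolding P_def by (intro exI[of _ 0] exI[of _ "Poly_Mapping.single m c"]) simp
    next
      case False
      define m' where "m' = m - Poly_Mapping.single 0 CHAR('a)"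
      have m: "m = m' + Poly_Mapping.single 0 CHAR('a)"
        using False unfolding m'_def
        by (intro poly_mapping_eqI) (auto simp: lookup_add lookup_minus lookup_single when_def)
      have m0: "Poly_Mapping.lookup m 0 = Poly_Mapping.lookup m' 0 + CHAR('a)"
        by (subst m) (simp add: lookup_add)
      define S where "S = Poly_Mapping.single m' (c / a 0)"
      have vp: "mvar i ^ CHAR('a) = Poly_Mapping.single (Poly_Mapping.single i CHAR('a)) (1::'a)" for i
        using single_eq_mono_val[of "Poly_Mapping.single i CHAR('a)" "1::'a"] by simp
      have "S * (mconst (a 0) * mvar 0 ^ CHAR('a)) = Poly_Mapping.single m c"
        using a0 by (simp add: S_def m vp mconst_def mult_single)
      then have eq: "Poly_Mapping.single m c = diag_form n a * S + (\<Sum>i=1..<n. - (S * (mconst (a i) * mvar i ^ CHAR('a))))"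
        using n0 by (simp add: diag_form_def sum_lessThan_split0 algebra_simps sum_distrib_left sum_negf)
      have "P (- (S * (mconst (a i) * mvar i ^ CHAR('a))))" if "i \<in> {1..<n}" for i
      proof -
        have "- (S * (mconst (a i) * mvar i ^ CHAR('a)))
            = Poly_Mapping.single (m' + Poly_Mapping.single i CHAR('a)) (- (c / a 0 * a i))"
          by (simp add: S_def vp mconst_def mult_single single_uminus)
        moreover have "Poly_Mapping.lookup (m' + Poly_Mapping.single i CHAR('a)) 0 < Poly_Mapping.lookup m 0"
          using that p_pos by (simp add: m0 lookup_add lookup_single)
        ultimately show ?thesis using less by metis
      qed
      then show ?thesis unfolding eq by (intro P_add P_qf P_sum)
    qed
  qed
  then have "P g" by (induction g rule: poly_mapping_plus_induct) (auto intro: P_add)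
  then show ?thesis unfolding P_def .
qed

end

text \<open>After reduction modulo the form, the remainders give a twisted value of degree less than
  p in variable 0, while \<alpha>^p has degree p there; so this value is 0 and the remainders vanish
  by anisotropy. It is this lemma that keeps the order along \<alpha> below p for a vector that is
  nonzero on X.\<close>

lemma lin_power_dvd_tw:
  assumes a: "a 0 \<noteq> 0" "n > 0" and b: "aniso k (b :: nat \<Rightarrow> 'a)"
    and dv: "lin_form n a ^ CHAR('a) dvd twisted k b f" and c: "c < k"
  shows "diag_form n a dvd f c"
proof -
  have "\<forall>c. \<exists>x. f c = diag_form n a * fst x + snd x \<and> low_degree CHAR('a) (snd x)"
    using reduction[where a = a, OF a] by (metis fst_conv snd_conv)
  then obtain x where x: "\<And>c. f c = diag_form n a * fst (x c) + snd (x c)" "\<And>c. low_degree CHAR('a) (snd (x c))"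
    by metis
  define q r where "q c = fst (x c)" and "r c = snd (x c)" for c
  note qr = x[folded q_def r_def]
  have "twisted k b f = lin_form n a ^ CHAR('a) * twisted k b q + twisted k b r"
    unfolding qr(1)[abs_def] by (simp add: tw_add tw_mult frob_qf)
  with dv have "lin_form n a ^ CHAR('a) dvd twisted k b r" by (metis dvd_add_right_iff dvd_triv_left)
  then have "diag_form n (\<lambda>i. a i ^ CHAR('a)) dvd twisted k b r" by (simp add: frob_qf_alt flip: frob_qf)
  then have "twisted k b r = 0"
    using qf_dvd_low[of "\<lambda>i. a i ^ CHAR('a)" n] a low_tw[of "CHAR('a)" r] qr(2) by simp
  from tw_eq_0[OF b this c] show ?thesis by (simp add: qr(1))
qed

lemma qf_dvd_imp: "diag_form n (a :: nat \<Rightarrow> 'a) dvd g \<Longrightarrow> lin_form n a ^ CHAR('a) dvd frob g"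
  using rhom_dvd[OF rhom_frob] frob_qf by metis

text \<open>The core of the primality of the form. If \<open>r\<close> were not 0, the value taken
  by the p-th power of variable 0 modulo the form would have degree less than p over p-th powers,
  hence would be a p-th power up to a denominator, and this yields an isotropic vector over
  polynomials.\<close>

lemma lin_dvd_frob_low:
  assumes a: "aniso n (a :: nat \<Rightarrow> 'a)" and n: "n \<ge> 2" and dv: "lin_form n a dvd frob r" and r: "low_degree CHAR('a) r"
  shows "r = 0"
proof (rule ccontr)
  assume r0: "r \<noteq> 0"
  have a0: "a 0 \<noteq> 0" and n0: "n > 0" using aniso_nz[OF a] n by auto
  \<comment> \<open>\<open>pw\<close> undoes the renaming t = x^p: it takes \<open>frob r\<close>
    back to the p-th power of \<open>r\<close> and \<alpha> back to the form.\<close>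
  define pw where "pw = msubst (\<lambda>i. mvar i ^ CHAR('a) :: (nat, 'a) mpoly)"
  have "pw (frob r) = r ^ CHAR('a)"
    unfolding pw_def
    by (rule rhom_mpoly_eqI[where h = "\<lambda>r. msubst _ (frob r)"])
      (simp_all add: rhom_comp[OF rhom_frob rhom_msubst] rhom_pow mconst_simps msubst_simps)
  moreover have "pw (lin_form n a) = diag_form n a"
    by (simp add: pw_def lin_form_def diag_form_def msubst_simps)
  ultimately have "diag_form n a dvd r ^ CHAR('a)"
    using rhom_dvd[OF rhom_msubst dv] unfolding pw_def by metis
  then have dv: "upoly0 (diag_form n a) dvd upoly0 r ^ CHAR('a)" using rhom_dvd[OF rhom_upoly0] by (metis upoly0_simps(9))
  define R where "R = upoly0 r"
  have R: "R \<noteq> 0" "degree R < CHAR('a)" using r0 degree_upoly0_low[OF r p_pos] by (simp_all add: R_def upoly0_eq_0_iff)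
  define \<theta> where "\<theta> = (\<Sum>i=1..<n. mconst (a i) * mvar i ^ CHAR('a))"
  define \<rho> where "\<rho> = - (mconst (1 / a 0) * \<theta>)"
  have yq: "upoly0 (diag_form n a) = [:mconst (a 0):] * (monom 1 CHAR('a) - [:\<rho>:])"
    using a0 unfolding upoly0_qf[where a = a, OF a0 n0] \<theta>_def[symmetric] \<rho>_def
    by (simp add: smult_diff_right smult_monom mconst_mult flip: mult.assoc)
  have A: "mconst (a 0) * mconst (1 / a 0) = (1 :: (nat, 'a) mpoly)"
    using a0 by (simp add: mconst_mult)
  have scale: "[:mconst (a 0):] * X dvd Z" if XZ: "X dvd Z" for X Z :: "(nat, 'a) mpoly poly"
  proof -
    obtain k where "Z = X * k" using XZ by blast
    moreover have "[:mconst (a 0):] * [:mconst (1 / a 0):] = (1 :: (nat, 'a) mpoly poly)"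
      using a0 by (simp add: mconst_mult one_pCons)
    moreover have "([:mconst (a 0):] * X) * ([:mconst (1 / a 0):] * k)
        = ([:mconst (a 0):] * [:mconst (1 / a 0):]) * (X * k)"
      by (simp only: mult_ac)
    ultimately have "Z = ([:mconst (a 0):] * X) * ([:mconst (1 / a 0):] * k)"
      by (simp only: mult_1_left)
    then show ?thesis by (rule dvdI)
  qed
  \<comment> \<open>Modulo the form, the p-th power of variable 0 is \<open>\<rho>\<close>.
    Replacing it throughout the p-th power of \<open>R\<close> leaves \<open>C\<close>, constant in
    variable 0, which a polynomial of degree p in that variable divides only if
    \<open>C = 0\<close>.\<close>
  have ydv: "upoly0 (diag_form n a) dvd monom c (CHAR('a) * j) - [:c * \<rho> ^ j:]" for c j
  proof -
    have "monom 1 CHAR('a) - [:\<rho>:] dvd monom 1 CHAR('a) ^ j - [:\<rho>:] ^ j"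
      by (subst power_diff_sumr2) (rule dvd_triv_left)
    then have "monom 1 CHAR('a) - [:\<rho>:] dvd smult c (monom 1 CHAR('a) ^ j - [:\<rho>:] ^ j)" by (rule dvd_smult)
    also have "smult c (monom 1 CHAR('a) ^ j - [:\<rho>:] ^ j) = monom c (CHAR('a) * j) - [:c * \<rho> ^ j:]"
      by (simp add: smult_diff_right monom_power smult_monom rhom_power[OF rhom_pconst, of \<rho> j, symmetric])
    finally show ?thesis unfolding yq by (rule scale)
  qed
  have Rsum: "R = (\<Sum>j<CHAR('a). monom (coeff R j) j)"
    using R(2) by (intro poly_eqI) (auto simp: coeff_sum coeff_eq_0)
  have "R ^ CHAR('a) = (\<Sum>j<CHAR('a). monom (coeff R j) j) ^ CHAR('a)"
    by (rule arg_cong[OF Rsum])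
  also have "\<dots> = (\<Sum>j<CHAR('a). monom (coeff R j) j ^ CHAR('a))"
    by (rule freshmans_dream_sum) (simp_all add: CHAR_mpoly prime_char)
  also have "\<dots> = (\<Sum>j<CHAR('a). monom (coeff R j ^ CHAR('a)) (CHAR('a) * j))"
    by (simp add: monom_power mult.commute)
  finally have Rp: "R ^ CHAR('a) = (\<Sum>j<CHAR('a). monom (coeff R j ^ CHAR('a)) (CHAR('a) * j))" .
  define C where "C = (\<Sum>j<CHAR('a). coeff R j ^ CHAR('a) * \<rho> ^ j)"
  have "R ^ CHAR('a) - [:C:] = (\<Sum>j<CHAR('a). monom (coeff R j ^ CHAR('a)) (CHAR('a) * j) - [:coeff R j ^ CHAR('a) * \<rho> ^ j:])"
    by (simp add: Rp C_def sum_subtractf rhom_sum[OF rhom_pconst])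
  then have "upoly0 (diag_form n a) dvd R ^ CHAR('a) - [:C:]" using ydv by (simp add: dvd_sum)
  from dvd_diff[OF dv[folded R_def] this] have "upoly0 (diag_form n a) dvd [:C:]" by simp
  then have "C = 0"
    using degree_upoly0_qf[where a = a, OF a0 n0] p_pos by (metis dvd_imp_degree_le degree_pCons_0 not_le pCons_eq_0_iff)
  then obtain d e where de: "d \<noteq> 0" "\<rho> * d ^ CHAR('a) = e ^ CHAR('a)"
    using pth_power_of_relation_idom[of R \<rho>] R prime_char by (auto simp: CHAR_mpoly C_def)
  \<comment> \<open>The vector (e/d, x_1, x_2, ...) with its denominator cleared; its coordinate of
    index 1 is visibly nonzero.\<close>
  define h where "h i = (if i = 0 then e else mvar i * d)" for i
  have "mconst (a 0) * (\<rho> * d ^ CHAR('a)) + \<theta> * d ^ CHAR('a) = 0"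
    using a0 by (simp add: \<rho>_def mconst_mult flip: mult.assoc)
  then have "mconst (a 0) * e ^ CHAR('a) + \<theta> * d ^ CHAR('a) = 0" by (simp add: de)
  then have "(\<Sum>i<n. mconst (a i) * h i ^ CHAR('a)) = 0"
    using n0 by (simp add: sum_lessThan_split0 h_def \<theta>_def sum_distrib_left sum_distrib_right power_mult_distrib mult_ac)
  then have "frob (\<Sum>i<n. mconst (a i) * h i ^ CHAR('a)) = 0" by (simp add: frob_simps)
  then have "twisted n a h ^ CHAR('a) = 0"
    by (simp add: twisted_def frob_simps pow_simps power_mult_distrib mconst_simps)
  then have "twisted n a h = 0" by simp
  from tw_eq_0[OF a this, of 1] have "mvar 1 * d = 0" using n by (simp add: h_def)
  moreover have "(mvar 1 :: (nat, 'a) mpoly) \<noteq> 0"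
    by (metis coef_mvar lookup_zero zero_neq_one)
  ultimately show False using de by simp
qed

text \<open>Division with remainder reduces the converse to \<open>lin_dvd_frob_low\<close>.
  Vanishing on X thereby becomes divisibility by \<alpha>, and the form inherits primality from
  \<alpha>.\<close>

lemma qf_dvd_iff:
  assumes a: "aniso n (a :: nat \<Rightarrow> 'a)" and n: "n \<ge> 2"
  shows "diag_form n a dvd g \<longleftrightarrow> lin_form n a dvd frob g"
proof
  assume "diag_form n a dvd g"
  then have "lin_form n a ^ CHAR('a) dvd frob g" by (rule qf_dvd_imp)
  then show "lin_form n a dvd frob g" using p_pos by (meson dvd_power dvd_trans)
next
  assume dv: "lin_form n a dvd frob g"
  have a0: "a 0 \<noteq> 0" and n0: "n > 0" using aniso_nz[OF a] n by auto
  obtain q r where g: "g = diag_form n a * q + r" and r: "low_degree CHAR('a) r" using reduction[where a = a, OF a0 n0] by blast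
  have "lin_form n a dvd lin_form n a ^ CHAR('a)" using p_pos by (simp add: dvd_power)
  then have "lin_form n a dvd frob r" using dv g
    by (metis frob_simps(3,4) frob_qf dvd_add_right_iff dvd_mult2)
  then have "r = 0" using lin_dvd_frob_low[OF a n _ r] by blast
  then show "diag_form n a dvd g" using g by simp
qed

end

subsection \<open>Homogeneous components\<close>

definition mdeg :: "('x \<Rightarrow>\<^sub>0 nat) \<Rightarrow> nat"
  where "mdeg m = (\<Sum>x\<in>Poly_Mapping.keys m. Poly_Mapping.lookup m x)"

text \<open>The substitution of T x_i for x_i. The coefficient of T^d is the homogeneous component
  of degree d in the variables from \<open>A\<close>, the others being set to 0; as a ring
  homomorphism it makes components compatible with products for free.\<close>

definition grading :: "'x set \<Rightarrow> ('x, 'r::comm_ring_1) mpoly \<Rightarrow> ('x, 'r) mpoly poly"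
  where "grading A = ev (\<lambda>c. [:mconst c:]) (\<lambda>i. if i \<in> A then [:0, mvar i:] else 0)"

lemma rhom_grading: "rhom (grading A)"
  unfolding grading_def by (rule rhom_ev[OF rhom_yc])

lemmas grading_simps = rhom_simps[OF rhom_grading]

lemma grading_mconst [simp]: "grading A (mconst c) = [:mconst c:]"
  by (simp add: grading_def ev_mconst[OF rhom_yc])

lemma grading_mvar [simp]: "grading A (mvar i) = (if i \<in> A then [:0, mvar i:] else 0)"
  by (simp add: grading_def ev_mvar[OF rhom_yc])

lemma prod_monom: "(\<Prod>i\<in>A. monom (f i) (k i)) = monom (prod f A) (sum k A)"
  by (induction A rule: infinite_finite_induct) (auto simp: mult_monom)

lemma grading_single:
  fixes c :: "'r::comm_ring_1" and m :: "'x \<Rightarrow>\<^sub>0 nat"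
  shows "grading A (Poly_Mapping.single m c)
    = (if Poly_Mapping.keys m \<subseteq> A then monom (Poly_Mapping.single m c) (mdeg m) else 0)"
proof (cases "Poly_Mapping.keys m \<subseteq> A")
  case True
  have "mono_val (\<lambda>i. if i \<in> A then [:0, mvar i :: ('x, 'r) mpoly:] else 0) m
      = (\<Prod>y\<in>Poly_Mapping.keys m. monom (mvar y ^ Poly_Mapping.lookup m y) (Poly_Mapping.lookup m y))"
    unfolding mono_val_def
  proof (rule prod.cong)
    fix y assume "y \<in> Poly_Mapping.keys m"
    moreover have "[:0, mvar y :: ('x, 'r) mpoly:] = monom (mvar y) 1" by (simp add: monom_Suc monom_0)
    ultimately show "(if y \<in> A then [:0, mvar y :: ('x, 'r) mpoly:] else 0) ^ Poly_Mapping.lookup m y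
        = monom (mvar y ^ Poly_Mapping.lookup m y) (Poly_Mapping.lookup m y)"
      using True by (auto simp: monom_power)
  qed simp
  also have "\<dots> = monom (mono_val mvar m) (mdeg m)"
    by (simp add: prod_monom mono_val_def mdeg_def)
  finally have "grading A (Poly_Mapping.single m c) = [:mconst c:] * monom (mono_val mvar m) (mdeg m)"
    unfolding grading_def ev_single[OF rhom_yc] by simp
  also have "\<dots> = monom (Poly_Mapping.single m c) (mdeg m)"
    by (simp add: smult_monom single_eq_mono_val)
  finally show ?thesis using True by simp
next
  case False
  then obtain x where x: "x \<in> Poly_Mapping.keys m" "x \<notin> A" by blast
  then have "mono_val (\<lambda>i. if i \<in> A then [:0, mvar i :: ('x, 'r) mpoly:] else 0) m = 0"
    unfolding mono_val_def by (intro prod_zero) (auto simp: in_keys_iff power_0_left intro!: bexI[of _ x])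
  then show ?thesis using False unfolding grading_def ev_single[OF rhom_yc] by simp
qed

lemma coef_grading:
  "coef (coeff (grading A g) d) m = (if Poly_Mapping.keys m \<subseteq> A \<and> mdeg m = d then coef g m else 0)"
proof (induction g rule: poly_mapping_plus_induct)
  case (single k c)
  then show ?case by (auto simp: grading_single lookup_single when_def)
next
  case (add f g)
  then show ?case by (simp add: grading_simps lookup_add)
qed

lemma homogeneous_iff_coef:
  "homogeneous A k g \<longleftrightarrow> (\<forall>m. coef g m \<noteq> 0 \<longrightarrow> Poly_Mapping.keys m \<subseteq> A \<and> mdeg m = k)"
  by (auto simp: homogeneous_def mdeg_def in_keys_iff)

text \<open>Homogeneity becomes an equation between images of a ring homomorphism, so the closure
  properties below are mere computations with \<open>monom\<close>.\<close>

lemma homogeneous_iff_grading: "homogeneous A k g \<longleftrightarrow> grading A g = monom g k"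
proof
  assume h: "homogeneous A k g"
  show "grading A g = monom g k"
  proof (intro poly_eqI poly_mapping_eqI)
    fix d m
    show "coef (coeff (grading A g) d) m = coef (coeff (monom g k) d) m"
      using h by (auto simp: coef_grading homogeneous_iff_coef)
  qed
next
  assume "grading A g = monom g k"
  then have "coef (coeff (grading A g) k) m = coef g m" for m by simp
  then show "homogeneous A k g"
    unfolding homogeneous_iff_coef coef_grading by (metis (full_types))
qed

lemma homogeneous_0 [simp]: "homogeneous A k 0"
  by (simp add: homogeneous_def)

lemma homogeneous_mconst [simp]: "homogeneous A 0 (mconst c :: ('x, 'r::comm_ring_1) mpoly)"
  by (simp add: homogeneous_iff_grading monom_0)

lemma homogeneous_1 [simp]: "homogeneous A 0 (1 :: ('x, 'r::comm_ring_1) mpoly)"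
  using homogeneous_mconst[of A "1::'r"] by simp

lemma homogeneous_mvar: "i \<in> A \<Longrightarrow> homogeneous A 1 (mvar i :: ('x, 'r::comm_ring_1) mpoly)"
  by (simp add: homogeneous_iff_grading monom_Suc monom_0)

lemma homogeneous_add:
  "homogeneous A k f \<Longrightarrow> homogeneous A k g \<Longrightarrow> homogeneous A k (f + g :: ('x, 'r::comm_ring_1) mpoly)"
  by (simp add: homogeneous_iff_grading grading_simps add_monom)

lemma homogeneous_diff:
  "homogeneous A k f \<Longrightarrow> homogeneous A k g \<Longrightarrow> homogeneous A k (f - g :: ('x, 'r::comm_ring_1) mpoly)"
  by (simp add: homogeneous_iff_grading grading_simps diff_monom)

lemma homogeneous_mult:
  "homogeneous A k f \<Longrightarrow> homogeneous A l g \<Longrightarrow> homogeneous A (k + l) (f * g :: ('x, 'r::comm_ring_1) mpoly)"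
  by (simp add: homogeneous_iff_grading grading_simps mult_monom)

lemma homogeneous_sum:
  "(\<And>i. i \<in> I \<Longrightarrow> homogeneous A k (f i)) \<Longrightarrow> homogeneous A k (\<Sum>i\<in>I. f i :: ('x, 'r::comm_ring_1) mpoly)"
  by (induction I rule: infinite_finite_induct) (auto intro: homogeneous_add)

lemma homogeneous_prod:
  "(\<And>i. i \<in> I \<Longrightarrow> homogeneous A (k i) (f i))
    \<Longrightarrow> homogeneous A (\<Sum>i\<in>I. k i) (\<Prod>i\<in>I. f i :: ('x, 'r::comm_ring_1) mpoly)"
  by (induction I rule: infinite_finite_induct) (auto intro: homogeneous_mult)

lemma homogeneous_power:
  "homogeneous A k f \<Longrightarrow> homogeneous A (k * j) (f ^ j :: ('x, 'r::comm_ring_1) mpoly)"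
  by (simp add: homogeneous_iff_grading grading_simps monom_power)

lemma homogeneous_const_mult:
  "homogeneous A k f \<Longrightarrow> homogeneous A k (mconst c * f :: ('x, 'r::comm_ring_1) mpoly)"
  using homogeneous_mult[OF homogeneous_mconst] by fastforce

lemma homogeneous_msubst:
  fixes f :: "'y \<Rightarrow> ('x, 'r::comm_ring_1) mpoly"
  assumes g: "homogeneous C l g" and f: "\<And>c. c \<in> C \<Longrightarrow> homogeneous A k (f c)"
  shows "homogeneous A (k * l) (msubst f g)"
  unfolding msubst_def
proof (intro homogeneous_sum homogeneous_const_mult)
  fix m assume m: "m \<in> expts g"
  have "homogeneous A (\<Sum>y\<in>Poly_Mapping.keys m. k * Poly_Mapping.lookup m y)
      (\<Prod>y\<in>Poly_Mapping.keys m. f y ^ Poly_Mapping.lookup m y)"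
    using g m by (intro homogeneous_prod homogeneous_power f) (auto simp: homogeneous_def)
  also have "(\<Sum>y\<in>Poly_Mapping.keys m. k * Poly_Mapping.lookup m y) = k * l"
    using g m by (simp add: homogeneous_def flip: sum_distrib_left)
  finally show "homogeneous A (k * l) (\<Prod>y\<in>Poly_Mapping.keys m. f y ^ Poly_Mapping.lookup m y)" .
qed

lemma homogeneous_coeff_grading: "homogeneous A d (coeff (grading A g) d)"
  by (auto simp: homogeneous_iff_coef coef_grading)

definition restrict_vars :: "'x set \<Rightarrow> ('x, 'r::comm_ring_1) mpoly \<Rightarrow> ('x, 'r) mpoly"
  where "restrict_vars A = msubst (\<lambda>i. if i \<in> A then mvar i else 0)"

lemma rhom_restrict_vars: "rhom (restrict_vars A)"
  unfolding restrict_vars_def by (rule rhom_msubst)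

lemmas restrict_vars_simps = rhom_simps[OF rhom_restrict_vars]

lemma restrict_vars_mconst [simp]: "restrict_vars A (mconst c) = mconst c"
  and restrict_vars_mvar [simp]: "restrict_vars A (mvar i) = (if i \<in> A then mvar i else 0)"
  by (simp_all add: restrict_vars_def)

lemma poly_grading_1: "poly (grading A g) 1 = restrict_vars A g"
  by (rule rhom_mpoly_eqI[where h = "\<lambda>g. poly (grading A g) 1"])
    (simp_all add: rhom_comp[OF rhom_grading rhom_poly] rhom_restrict_vars)

lemma restrict_vars_eq_sum: "restrict_vars A g = (\<Sum>d\<le>degree (grading A g). coeff (grading A g) d)"
  by (simp add: poly_altdef flip: poly_grading_1)

lemma restrict_vars_homogeneous: "homogeneous A k g \<Longrightarrow> restrict_vars A g = g"
  by (simp add: homogeneous_iff_grading poly_monom flip: poly_grading_1)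

lemma msubst_restrict_vars:
  assumes "\<And>c. c \<notin> A \<Longrightarrow> f c = 0"
  shows "msubst f (restrict_vars A g) = msubst f g"
  unfolding restrict_vars_def msubst_msubst using assms
  by (intro arg_cong2[where f = msubst] ext) (auto simp: msubst_simps)

lemma restrict_vars_msubst:
  fixes f :: "'y \<Rightarrow> ('x, 'r::comm_ring_1) mpoly"
  assumes "\<And>c. restrict_vars A (f c) = f c"
  shows "restrict_vars A (msubst f g) = msubst f g"
  using assms unfolding restrict_vars_def msubst_msubst by simp

lemma dvd_coeff_grading:
  fixes q :: "('x, 'r::comm_ring_1) mpoly"
  assumes "homogeneous A k q" "q dvd g"
  shows "q dvd coeff (grading A g) d"
proof -
  obtain h where "g = q * h" using assms(2) by blast
  then have "coeff (grading A g) d = coeff (monom q k * grading A h) d"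
    using assms(1) by (simp add: homogeneous_iff_grading grading_simps)
  then show ?thesis by (simp add: coeff_monom_mult)
qed

lemma dvd_if_dvd_coeff_grading:
  assumes "restrict_vars A g = g" "\<And>d. q dvd coeff (grading A g) d"
  shows "q dvd g"
  using assms by (metis restrict_vars_eq_sum dvd_sum)

lemma homogeneous_lin: "homogeneous {..<n} 1 (lin_form n a)"
  unfolding lin_form_def by (intro homogeneous_sum homogeneous_const_mult homogeneous_mvar) auto

subsection \<open>The derivative with respect to the variable of index 0\<close>

definition deriv0 :: "(nat, 'r::idom) mpoly \<Rightarrow> (nat, 'r) mpoly"
  where "deriv0 g = poly (pderiv (upoly0 g)) (mvar 0)"

lemma deriv0_add: "deriv0 (f + g) = deriv0 f + deriv0 g"
  by (simp add: deriv0_def upoly0_simps pderiv_add)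

lemma deriv0_mult: "deriv0 (f * g) = deriv0 f * g + f * deriv0 g"
  by (simp add: deriv0_def upoly0_simps pderiv_mult poly_upoly0 algebra_simps)

lemma deriv0_mconst [simp]: "deriv0 (mconst c) = 0"
  by (simp add: deriv0_def pderiv_pCons)

lemma deriv0_0 [simp]: "deriv0 0 = 0"
  using deriv0_mconst[of 0] by simp

lemma deriv0_mvar: "deriv0 (mvar i) = (if i = 0 then 1 else 0)"
  by (simp add: deriv0_def pderiv_pCons)

lemma deriv0_sum: "deriv0 (sum f A) = (\<Sum>i\<in>A. deriv0 (f i))"
  by (induction A rule: infinite_finite_induct) (auto simp: deriv0_add)

lemma deriv0_power: "deriv0 (f ^ Suc k) = of_nat (Suc k) * f ^ k * deriv0 f"
proof (induction k)
  case (Suc k)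
  have "deriv0 (f ^ Suc (Suc k)) = deriv0 f * f ^ Suc k + f * deriv0 (f ^ Suc k)"
    by (simp add: deriv0_mult)
  then show ?case unfolding Suc by (simp add: algebra_simps)
qed simp

lemma deriv0_restrict_vars: "0 \<in> A \<Longrightarrow> deriv0 (restrict_vars A g) = restrict_vars A (deriv0 g)"
  by (induction g rule: mpoly_induct) (auto simp: restrict_vars_simps deriv0_add deriv0_mult deriv0_mvar)

lemma deriv0_lin: "n > 0 \<Longrightarrow> deriv0 (lin_form n a) = mconst (a 0)"
  by (simp add: lin_form_def sum_lessThan_split0 deriv0_add deriv0_sum deriv0_mult deriv0_mvar)

context prime_char_field
begin

text \<open>The integer factors created by differentiation are fixed by c \<mapsto> c^p.
  Consequently the derivative of a twisted value is again a twisted value, namely at the vector of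
  derivatives.\<close>

lemma deriv0_frob: "frob (deriv0 (g :: (nat, 'a) mpoly)) = deriv0 (frob g)"
  by (induction g rule: mpoly_induct) (auto simp: frob_simps deriv0_add deriv0_mult deriv0_mvar)

lemma deriv0_tw: "twisted k (b :: nat \<Rightarrow> 'a) (\<lambda>c. deriv0 (f c)) = deriv0 (twisted k b f)"
  by (simp add: twisted_def deriv0_sum deriv0_mult deriv0_frob)

lemma restrict_vars_frob: "restrict_vars A (frob (g :: ('x, 'a) mpoly)) = frob (restrict_vars A g)"
  by (rule rhom_mpoly_eqI[where h = "\<lambda>g. restrict_vars A (frob g)"])
    (simp_all add: rhom_comp rhom_frob rhom_restrict_vars frob_simps)

lemma restrict_vars_tw: "restrict_vars A (twisted k (b :: nat \<Rightarrow> 'a) f) = twisted k b (\<lambda>c. restrict_vars A (f c))"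
  by (simp add: twisted_def restrict_vars_simps restrict_vars_frob)

lemma coeff_grading_frob: "coeff (grading A (frob (g :: ('x, 'a) mpoly))) d = frob (coeff (grading A g) d)"
  using p_pos by (intro poly_mapping_eqI) (simp add: coef_grading coef_frob power_0_left)

lemma coeff_grading_tw:
  "coeff (grading A (twisted k (b :: nat \<Rightarrow> 'a) f)) d = twisted k b (\<lambda>c. coeff (grading A (f c)) d)"
  by (simp add: twisted_def grading_simps coeff_sum coeff_grading_frob)

text \<open>The derivative of \<alpha>^e u is \<alpha>^(e-1) (e a_0 u + \<alpha> u'), whose order is
  exactly e-1 when \<alpha> does not divide u and 0 < e < p. Zero coordinates remain zero, so the
  support of the vector is kept.\<close>

lemma exists_transversal:
  assumes a: "aniso n (a :: nat \<Rightarrow> 'a)" and n: "n \<ge> 2" and b: "aniso k (b :: nat \<Rightarrow> 'a)"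
    and dv: "lin_form n a dvd twisted k b f" and nz: "\<exists>c<k. \<not> diag_form n a dvd f c"
    and cut: "\<And>c. restrict_vars {..<n} (f c) = f c"
  shows "\<exists>f'. (\<forall>c. f c = 0 \<longrightarrow> f' c = 0) \<and> (\<forall>c. restrict_vars {..<n} (f' c) = f' c) \<and>
    lin_form n a dvd twisted k b f' \<and> \<not> (lin_form n a)\<^sup>2 dvd twisted k b f'"
proof -
  have a0: "a 0 \<noteq> 0" and n0: "n > 0" using aniso_nz[OF a] n by auto
  note lin_simps = lin_dvd_mult_iff[where a = a, OF a0 n0] lin_nz[where a = a, OF a0 n0]
  let ?l = "lin_form n a"
  have main: "\<exists>f'. (\<forall>c. f c = 0 \<longrightarrow> f' c = 0) \<and> (\<forall>c. restrict_vars {..<n} (f' c) = f' c) \<and>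
      ?l dvd twisted k b f' \<and> \<not> ?l\<^sup>2 dvd twisted k b f'"
    if "Suc e < CHAR('a)" "?l ^ Suc e dvd twisted k b f" "\<not> ?l ^ Suc (Suc e) dvd twisted k b f"
      "\<And>c. restrict_vars {..<n} (f c) = f c" for e f
    using that
  proof (induction e arbitrary: f)
    case 0
    then show ?case by (intro exI[of _ f]) (simp add: numeral_2_eq_2)
  next
    case (Suc e)
    obtain u where u: "twisted k b f = ?l ^ Suc (Suc e) * u" using Suc.prems(2) by blast
    have nu: "\<not> ?l dvd u"
      using Suc.prems(3) unfolding u by (metis mult.commute mult_dvd_mono dvd_refl power_Suc2)
    let ?f = "\<lambda>c. deriv0 (f c)"
    have twisted': "twisted k b ?f = ?l ^ Suc e * (of_nat (Suc (Suc e)) * mconst (a 0) * u + ?l * deriv0 u)"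
      unfolding deriv0_tw u deriv0_mult deriv0_power deriv0_lin[OF n0] by (simp add: algebra_simps)
    have nd: "\<not> ?l dvd of_nat (Suc (Suc e)) * mconst (a 0) * u"
    proof
      assume "?l dvd of_nat (Suc (Suc e)) * mconst (a 0) * u"
      moreover have "of_nat (Suc (Suc e)) * mconst (a 0) = mconst (of_nat (Suc (Suc e)) * a 0)"
        by (simp only: mconst_simps)
      ultimately have "?l dvd mconst (of_nat (Suc (Suc e)) * a 0)"
        using nu by (metis lin_simps(1))
      then have "mconst (of_nat (Suc (Suc e)) * a 0) = (0 :: (nat, 'a) mpoly)"
        by (simp only: lin_dvd_iff[where a = a, OF a0 n0] elim0_mconst)
      then have "(of_nat (Suc (Suc e)) :: 'a) = 0" using a0 by (simp del: of_nat_Suc)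
      then show False using Suc.prems(1) by (auto simp: of_nat_eq_0_iff_char_dvd simp del: of_nat_Suc dest: dvd_imp_le)
    qed
    have "?l ^ Suc e dvd twisted k b ?f" unfolding twisted' by simp
    moreover have "\<not> ?l ^ Suc (Suc e) dvd twisted k b ?f"
    proof
      assume "?l ^ Suc (Suc e) dvd twisted k b ?f"
      then have "?l ^ Suc e * ?l dvd ?l ^ Suc e * (of_nat (Suc (Suc e)) * mconst (a 0) * u + ?l * deriv0 u)"
        unfolding twisted' by (simp only: power_Suc2)
      then have "?l dvd of_nat (Suc (Suc e)) * mconst (a 0) * u + ?l * deriv0 u"
        using lin_simps(2) by (subst (asm) dvd_mult_cancel_left) auto
      then show False using nd by (metis dvd_add_left_iff dvd_triv_left)
    qed
    moreover have "restrict_vars {..<n} (?f c) = ?f c" for c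
      using deriv0_restrict_vars[of "{..<n}" "f c"] n0 Suc.prems(4)[of c] by simp
    moreover have "Suc e < CHAR('a)" using Suc.prems(1) by simp
    ultimately obtain f' where "\<forall>c. ?f c = 0 \<longrightarrow> f' c = 0" "\<forall>c. restrict_vars {..<n} (f' c) = f' c"
      "?l dvd twisted k b f'" "\<not> ?l\<^sup>2 dvd twisted k b f'"
      using Suc.IH[of ?f] by blast
    then show ?case by (intro exI[of _ f']) auto
  qed
  have np: "\<not> ?l ^ CHAR('a) dvd twisted k b f"
    using lin_power_dvd_tw[where a = a, OF a0 n0 b] nz by blast
  \<comment> \<open>\<open>E\<close> is one more than the order, and \<open>main\<close> is indexed
    by the order minus 1; hence the two successors in \<open>E = Suc (Suc e)\<close>.\<close>
  define E where "E = (LEAST e. \<not> ?l ^ e dvd twisted k b f)"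
  have E: "\<not> ?l ^ E dvd twisted k b f" "E \<le> CHAR('a)" "\<And>e. e < E \<Longrightarrow> ?l ^ e dvd twisted k b f"
    using LeastI[where P = "\<lambda>e. \<not> ?l ^ e dvd twisted k b f", OF np]
      Least_le[where P = "\<lambda>e. \<not> ?l ^ e dvd twisted k b f", OF np]
      not_less_Least[where P = "\<lambda>e. \<not> ?l ^ e dvd twisted k b f"]
    unfolding E_def by auto
  have "E \<noteq> 0" "E \<noteq> 1" using E(1) dv by (auto intro: ccontr)
  then obtain e where e: "E = Suc (Suc e)" by (metis One_nat_def not0_implies_Suc)
  show ?thesis
    using E(1,2) E(3)[of "Suc e"] cut unfolding e by (intro main[of e f]) simp_all
qed

end

subsection \<open>Taylor expansion and transitivity\<close>

text \<open>Three layers: the outer univariate variable is the displacement of variable 0, the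
  middle variables are the displacements of the others, and the base point lives in the innermost
  ring. Variable 0 is kept apart because it is the one in which degrees are bounded by p.\<close>

type_synonym ('x, 'a) tpoly = "(nat, ('x, 'a) mpoly) mpoly poly"

definition taylor :: "(nat \<Rightarrow> ('x, 'a) mpoly) \<Rightarrow> (nat, 'a::comm_ring_1) mpoly \<Rightarrow> ('x, 'a) tpoly"
  where "taylor s = ev (\<lambda>c. [:mconst (mconst c):])
    (\<lambda>i. if i = 0 then [:mconst (s 0), 1:] else [:mconst (s i) + mvar i:])"

lemma rhom_tc: "rhom (\<lambda>c. [:mconst (mconst c) :: ('y, ('x, 'a::comm_ring_1) mpoly) mpoly:])"
  using rhom_comp[OF rhom_comp[OF rhom_mconst rhom_mconst] rhom_pconst] .

lemma rhom_taylor: "rhom (taylor s)"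
  unfolding taylor_def by (rule rhom_ev[OF rhom_tc])

lemmas taylor_simps = rhom_simps[OF rhom_taylor]

lemma taylor_mconst [simp]: "taylor s (mconst c) = [:mconst (mconst c):]"
  by (simp add: taylor_def ev_mconst[OF rhom_tc])

lemma taylor_mvar [simp]:
  "taylor s (mvar i) = (if i = 0 then [:mconst (s 0), 1:] else [:mconst (s i) + mvar i:])"
  by (simp add: taylor_def ev_mvar[OF rhom_tc])

lemma degree_taylor_low:
  fixes s :: "nat \<Rightarrow> (nat, 'a::idom) mpoly"
  assumes "low_degree k g" "k > 0"
  shows "degree (taylor s g) < k"
  unfolding taylor_def
  by (rule degree_ev_low[where h = "\<lambda>c. mconst (mconst c)"]) (use assms in auto)

text \<open>Expansion at the generic point \<open>mvar\<close>: these are the Hasse derivatives of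
  \<open>r\<close>, again polynomials in the original variables.\<close>

definition taylor_coef :: "nat \<Rightarrow> (nat \<Rightarrow>\<^sub>0 nat) \<Rightarrow> (nat, 'a::comm_ring_1) mpoly \<Rightarrow> (nat, 'a) mpoly"
  where "taylor_coef j \<mu> r = coef (coeff (taylor mvar r) j) \<mu>"

lemma taylor_coef_0 [simp]: "taylor_coef j \<mu> 0 = 0"
  by (simp add: taylor_coef_def taylor_simps)

text \<open>Translating back by minus the base point recovers \<open>g\<close> from its expansion,
  so a common divisor of the Taylor coefficients divides all coefficients of
  \<open>g\<close>.\<close>

lemma dvd_coef_of_taylor:
  fixes s :: "nat \<Rightarrow> (nat, 'a::idom) mpoly"
  assumes "\<And>j \<mu>. q dvd coef (coeff (taylor s g) j) \<mu>"
  shows "q dvd mconst (coef g m)"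
proof -
  define \<sigma> where "\<sigma> i = mvar i - mconst (s i)" for i
  define \<kappa> where "\<kappa> P = poly (map_poly (msubst \<sigma>) P) (\<sigma> 0)" for P
  have \<kappa>: "rhom \<kappa>"
    unfolding \<kappa>_def using rhom_comp[OF rhom_map_poly[OF rhom_msubst] rhom_poly] .
  have map1: "map_poly (msubst \<sigma>) [:c:] = [:msubst \<sigma> c:]"
    and map2: "map_poly (msubst \<sigma>) [:c, d:] = [:msubst \<sigma> c, msubst \<sigma> d:]" for c d
    by (auto intro!: poly_eqI simp: coeff_map_poly msubst_simps coeff_pCons split: nat.splits)
  have \<kappa>1: "\<kappa> [:mconst c:] = mconst c" for c
    by (simp add: \<kappa>_def map1)
  have \<kappa>2: "\<kappa> (taylor s (mvar i)) = mvar i" for i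
    by (simp add: \<kappa>_def map1 map2 msubst_simps \<sigma>_def)
  note cc = rhom_comp[OF rhom_mconst rhom_mconst]
  have "\<kappa> (taylor s g) = ev (\<lambda>c. mconst (mconst c)) mvar g"
    by (rule rhom_mpoly_eqI[where h = "\<lambda>g. \<kappa> (taylor s g)"])
      (simp_all only: rhom_comp[OF rhom_taylor \<kappa>] rhom_ev[OF cc] ev_mconst[OF cc] ev_mvar[OF cc]
        \<kappa>1 \<kappa>2 taylor_mconst)
  moreover have "[:mconst q:] dvd taylor s g"
    unfolding const_poly_dvd_iff mconst_dvd_iff using assms by blast
  from rhom_dvd[OF \<kappa> this] have "mconst q dvd \<kappa> (taylor s g)" by (simp only: \<kappa>1)
  ultimately have "mconst q dvd ev (\<lambda>c. mconst (mconst c)) mvar g" by simp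
  then have "q dvd coef (ev (\<lambda>c. mconst (mconst c)) mvar g) m" by (simp only: mconst_dvd_iff)
  then show ?thesis by (simp only: coef_ev_mconst[OF rhom_mconst])
qed

context prime_char_field
begin

text \<open>Expansion commutes with the twist and with moving the base point. Hence the coefficients
  of an expanded twisted value are twisted values of Hasse derivatives evaluated at
  \<open>f\<close>.\<close>

lemma coef_taylor_frob:
  fixes f :: "nat \<Rightarrow> (nat, 'a) mpoly"
  shows "coef (coeff (taylor (\<lambda>i. frob (f i)) (frob r)) j) \<mu> = frob (msubst f (taylor_coef j \<mu> r))"
proof -
  define \<theta> where "\<theta> g = frob (msubst f g)" for g
  have \<theta>: "rhom \<theta>" unfolding \<theta>_def using rhom_comp[OF rhom_msubst rhom_frob] .
  define \<Theta> where "\<Theta> = ev (\<lambda>c. mconst (\<theta> c)) (mvar :: nat \<Rightarrow> _)"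
  have \<Theta>: "rhom \<Theta>" unfolding \<Theta>_def by (rule rhom_ev[OF rhom_comp[OF \<theta> rhom_mconst]])
  have \<Theta>s: "\<Theta> (mconst c) = mconst (\<theta> c)" "\<Theta> (mvar i) = mvar i" for c i
    by (simp_all add: \<Theta>_def ev_mconst ev_mvar rhom_comp[OF \<theta> rhom_mconst])
  have map1: "map_poly \<Theta> [:c:] = [:\<Theta> c:]" and map2: "map_poly \<Theta> [:c, d:] = [:\<Theta> c, \<Theta> d:]" for c d
    by (auto intro!: poly_eqI simp: coeff_map_poly rhom_simps[OF \<Theta>] coeff_pCons split: nat.splits)
  have "taylor (\<lambda>i. frob (f i)) (frob r) = map_poly \<Theta> (taylor mvar r)"
    by (rule rhom_mpoly_eqI[where h = "\<lambda>r. taylor _ (frob r)"])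
      (auto simp: rhom_comp[OF rhom_frob rhom_taylor] rhom_comp[OF rhom_taylor rhom_map_poly[OF \<Theta>]]
        map1 map2 \<Theta>s rhom_simps[OF \<Theta>] \<theta>_def)
  then have "coef (coeff (taylor (\<lambda>i. frob (f i)) (frob r)) j) \<mu> = \<theta> (taylor_coef j \<mu> r)"
    by (simp only: coeff_map_poly[where f = \<Theta>, OF rhom_0[OF \<Theta>]] taylor_coef_def)
      (simp only: \<Theta>_def coef_ev_mconst[OF \<theta>])
  then show ?thesis by (simp only: \<theta>_def)
qed

lemma taylor_lin:
  fixes s :: "nat \<Rightarrow> (nat, 'a) mpoly"
  assumes "n > 0"
  shows "taylor s (lin_form n b) = [:mconst (\<Sum>i<n. mconst (b i) * s i) + (\<Sum>i=1..<n. mconst (mconst (b i)) * mvar i),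
    mconst (mconst (b 0)):]"
proof -
  have t: "taylor s (mconst (b i) * mvar i) = [:mconst (mconst (b i)) * (mconst (s i) + mvar i):]"
    if "i \<in> {1..<n}" for i
    using that by (simp add: taylor_simps mult.commute)
  have "taylor s (lin_form n b) = taylor s (mconst (b 0) * mvar 0) + (\<Sum>i=1..<n. taylor s (mconst (b i) * mvar i))"
    using assms by (simp add: lin_form_def sum_lessThan_split0 rhom_add[OF rhom_taylor] rhom_sum[OF rhom_taylor])
  also have "(\<Sum>i=1..<n. taylor s (mconst (b i) * mvar i))
      = [:\<Sum>i=1..<n. mconst (mconst (b i)) * (mconst (s i) + mvar i):]"
    unfolding rhom_sum[OF rhom_pconst] by (rule sum.cong[OF refl t])
  finally show ?thesis
    using assms by (simp add: sum_lessThan_split0 taylor_simps mconst_simps distrib_left sum.distrib mult.commute)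
qed

lemma mconst_lin_dvd_mult_iff:
  fixes x y :: "(nat, (nat, 'a) mpoly) mpoly"
  assumes "a 0 \<noteq> 0" "n > 0"
  shows "mconst (lin_form n a) dvd x * y \<longleftrightarrow> mconst (lin_form n a) dvd x \<or> mconst (lin_form n a) dvd y"
proof -
  let ?E = "ev (\<lambda>c. mconst (elim0 n a c)) (mvar :: nat \<Rightarrow> _)"
  have E: "rhom ?E" by (rule rhom_ev[OF rhom_comp[OF rhom_elim0 rhom_mconst]])
  have "mconst (lin_form n a) dvd z \<longleftrightarrow> ?E z = 0" for z :: "(nat, (nat, 'a) mpoly) mpoly"
  proof -
    have "mconst (lin_form n a) dvd z \<longleftrightarrow> (\<forall>m. coef (?E z) m = 0)"
      by (simp add: mconst_dvd_iff lin_dvd_iff[where a = a, OF assms] coef_ev_mconst[OF rhom_elim0])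
    then show ?thesis by (metis lookup_zero poly_mapping_eqI)
  qed
  then show ?thesis by (simp add: rhom_mult[OF E])
qed

text \<open>
  A polynomial relation whose root has valuation 1 at a prime and whose degree is less than \<open>k\<close>
  has a coefficient whose valuation is not a multiple of \<open>k\<close>: otherwise the terms
  would have pairwise distinct valuations.
\<close>

lemma no_relation:
  fixes \<pi> w :: "'r::idom" and P :: "'r poly"
  assumes prime: "\<And>x y. \<pi> dvd x * y \<Longrightarrow> \<pi> dvd x \<or> \<pi> dvd y" and \<pi>0: "\<pi> \<noteq> 0" "\<not> \<pi> dvd 1"
    and gap: "\<And>j. j < k \<Longrightarrow> \<pi> dvd coeff (\<Gamma> j) i \<Longrightarrow> \<pi> ^ k dvd coeff (\<Gamma> j) i"
    and gap_lt: "\<And>i' j. j < k \<Longrightarrow> i' < i \<Longrightarrow> \<pi> ^ k dvd coeff (\<Gamma> j) i'"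
    and ex: "\<exists>j<k. \<not> \<pi> dvd coeff (\<Gamma> j) i"
    and P: "coeff P 0 = \<pi> * w" "\<not> \<pi> dvd w"
    and rel: "(\<Sum>j<k. \<Gamma> j * P ^ j) = 0"
  shows False
proof -
  \<comment> \<open>Modulo \<pi>^(J+1) only j = J survives in the coefficient at \<open>i\<close>:
    smaller j have coefficients divisible by \<pi>^k, larger j receive \<pi>^j from P^j, and
    coefficients of degree below \<open>i\<close> are divisible by \<pi>^k for every j.\<close>
  define J where "J = (LEAST j. j < k \<and> \<not> \<pi> dvd coeff (\<Gamma> j) i)"
  have J: "J < k" "\<not> \<pi> dvd coeff (\<Gamma> J) i"
    using LeastI_ex[OF ex] by (simp_all add: J_def)
  have lt: "\<pi> ^ k dvd coeff (\<Gamma> j) i" if "j < J" for j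
    using that J(1) gap[of j] not_less_Least[of j "\<lambda>j. j < k \<and> \<not> \<pi> dvd coeff (\<Gamma> j) i"]
    unfolding J_def[symmetric] by auto
  have Jk: "\<pi> ^ Suc J dvd \<pi> ^ k" using J(1) by (intro le_imp_power_dvd) simp
  have P0: "coeff (P ^ j) 0 = \<pi> ^ j * w ^ j" for j
    by (simp add: coeff_0_power P(1) power_mult_distrib)
  have other: "\<pi> ^ Suc J dvd coeff (\<Gamma> j * P ^ j) i" if j: "j < k" "j \<noteq> J" for j
    unfolding coeff_mult
  proof (rule dvd_sum)
    fix l assume l: "l \<in> {..i}"
    show "\<pi> ^ Suc J dvd coeff (\<Gamma> j) l * coeff (P ^ j) (i - l)"
    proof (cases "l < i")
      case True
      then show ?thesis using gap_lt[OF j(1)] Jk by (meson dvd_mult2 dvd_trans)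
    next
      case False
      then have l: "l = i" using l by simp
      show ?thesis
      proof (cases "j < J")
        case True
        then show ?thesis using lt Jk l by (meson dvd_mult2 dvd_trans)
      next
        case False
        then have "\<pi> ^ Suc J dvd \<pi> ^ j" using j by (intro le_imp_power_dvd) simp
        then show ?thesis unfolding l by (simp add: P0)
      qed
    qed
  qed
  have J_term: "\<pi> ^ Suc J dvd coeff (\<Gamma> J * P ^ J) i - coeff (\<Gamma> J) i * (\<pi> ^ J * w ^ J)"
  proof -
    have "coeff (\<Gamma> J * P ^ J) i - coeff (\<Gamma> J) i * (\<pi> ^ J * w ^ J)
        = (\<Sum>l<i. coeff (\<Gamma> J) l * coeff (P ^ J) (i - l))"
      by (simp add: coeff_mult P0 flip: lessThan_Suc_atMost)
    also have "\<pi> ^ Suc J dvd \<dots>"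
      using gap_lt[OF J(1)] Jk by (intro dvd_sum) (meson dvd_mult2 dvd_trans lessThan_iff)
    finally show ?thesis .
  qed
  have "(\<Sum>j<k. coeff (\<Gamma> j * P ^ j) i) = 0"
    using arg_cong[OF rel, of "\<lambda>q. coeff q i"] by (simp add: coeff_sum)
  then have "coeff (\<Gamma> J * P ^ J) i = - (\<Sum>j\<in>{..<k} - {J}. coeff (\<Gamma> j * P ^ j) i)"
    using J(1) by (simp add: sum.remove[of "{..<k}" J] eq_neg_iff_add_eq_0)
  moreover have "\<pi> ^ Suc J dvd (\<Sum>j\<in>{..<k} - {J}. coeff (\<Gamma> j * P ^ j) i)"
    using other by (intro dvd_sum) auto
  ultimately have "\<pi> ^ Suc J dvd coeff (\<Gamma> J * P ^ J) i" by simp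
  from dvd_diff[OF this J_term] have "\<pi> ^ J * \<pi> dvd \<pi> ^ J * (coeff (\<Gamma> J) i * w ^ J)"
    by (simp add: mult_ac)
  then have "\<pi> dvd coeff (\<Gamma> J) i * w ^ J" using \<pi>0 by (subst (asm) dvd_mult_cancel_left) auto
  then have "\<pi> dvd w ^ J" using prime J(2) by blast
  then have "\<pi> dvd w" using \<pi>0(2) by (induction J) (auto dest: prime)
  then show False using P(2) by simp
qed

text \<open>
  The Taylor coefficients at \<open>f\<close> of an isotropic vector over the function field of the middle
  hypersurface are polynomials in \<open>f\<close>, so the vector found here is defined over
  the field generated by the point \<open>f\<close>, not just over the function field of the first hypersurface.
\<close>

lemma transit:
  assumes a: "aniso n (a :: nat \<Rightarrow> 'a)" "n \<ge> 2" and b: "aniso k (b :: nat \<Rightarrow> 'a)" "k \<ge> 2"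
    and f: "lin_form n a dvd twisted k b f" "\<not> (lin_form n a)\<^sup>2 dvd twisted k b f"
    and g': "lin_form k b dvd twisted l e g'" "\<exists>c<l. \<not> diag_form k b dvd g' c"
  shows "\<exists>g. (\<forall>c. g' c = 0 \<longrightarrow> g c = 0) \<and> lin_form n a dvd twisted l (e :: nat \<Rightarrow> 'a) (\<lambda>c. msubst f (g c)) \<and>
    (\<exists>c<l. \<not> diag_form n a dvd msubst f (g c))"
proof (rule ccontr)
  assume contra: "\<not> ?thesis"
  have a0: "a 0 \<noteq> 0" and n0: "n > 0" using aniso_nz[OF a(1)] a(2) by auto
  have b0: "b 0 \<noteq> 0" and k0: "k > 0" using aniso_nz[OF b(1)] b(2) by auto
  let ?l = "lin_form n a" and ?p = "CHAR('a)"
  have "\<forall>c. \<exists>x. g' c = diag_form k b * fst x + snd x \<and> low_degree ?p (snd x)"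
    using reduction[where a = b, OF b0 k0] by (metis fst_conv snd_conv)
  then obtain x where x: "\<And>c. g' c = diag_form k b * fst (x c) + snd (x c)" "\<And>c. low_degree ?p (snd (x c))"
    by metis
  \<comment> \<open>Coordinates in which \<open>g'\<close> is zero are reduced to 0 explicitly, so
    that the support is preserved.\<close>
  define q r where "q c = (if g' c = 0 then 0 else fst (x c))"
    and "r c = (if g' c = 0 then 0 else snd (x c))" for c
  have qr: "g' c = diag_form k b * q c + r c" "low_degree ?p (r c)" for c
    using x[of c] by (auto simp: q_def r_def low_degree_def)
  have r0: "r c = 0" if "g' c = 0" for c using that by (simp add: r_def)
  have "twisted l e g' = lin_form k b ^ ?p * twisted l e q + twisted l e r"
    unfolding qr(1)[abs_def] by (simp add: tw_add tw_mult frob_qf)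
  moreover have "lin_form k b dvd lin_form k b ^ ?p * twisted l e q" using p_pos by (simp add: dvd_power)
  ultimately have ldvd: "lin_form k b dvd twisted l e r" using g'(1) by (metis dvd_add_right_iff)
  obtain c0 where c0: "c0 < l" "r c0 \<noteq> 0" using g'(2) qr(1) by (metis add.right_neutral dvd_triv_left)
  define T where "T = taylor (\<lambda>i. frob (f i))"
  have T: "rhom T" unfolding T_def by (rule rhom_taylor)
  define A where "A = T (twisted l e r)"
  have A_eq: "A = (\<Sum>c<l. [:mconst (mconst (e c)):] * T (frob (r c)))"
    unfolding A_def twisted_def by (simp add: rhom_simps[OF T]) (simp add: T_def)
  have degA: "degree A < ?p"
    unfolding A_def T_def using degree_taylor_low low_tw[of ?p r] qr(2) p_pos by blast
  have coefA: "coef (coeff A j) \<mu> = twisted l e (\<lambda>c. msubst f (taylor_coef j \<mu> (r c)))" for j \<mu>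
    unfolding A_eq twisted_def T_def
    by (simp add: coeff_sum lookup_sum coef_mconst_mult coef_taylor_frob)
  have contra': "diag_form n a dvd msubst f (taylor_coef j \<mu> (r c))"
    if "?l dvd coef (coeff A j) \<mu>" "c < l" for j \<mu> c
  proof (rule ccontr)
    assume "\<not> ?thesis"
    moreover have "\<forall>c. g' c = 0 \<longrightarrow> taylor_coef j \<mu> (r c) = 0" using r0 by simp
    ultimately show False
      using contra that unfolding coefA
      by (elim notE, intro exI[of _ "\<lambda>c. taylor_coef j \<mu> (r c)"]) auto
  qed
  \<comment> \<open>The gap in valuations: by the assumption for contradiction, a Taylor coefficient
    vector whose value is divisible by \<alpha> vanishes on the first hypersurface, and then its
    value is divisible by \<alpha>^p.\<close>
  have dich: "?l ^ ?p dvd coef (coeff A j) \<mu>"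
    if "?l dvd coef (coeff A j) \<mu>" for j \<mu>
  proof -
    show ?thesis
      using contra'[OF that] unfolding coefA twisted_def by (intro dvd_sum dvd_mult qf_dvd_imp) auto
  qed
  have ex: "\<exists>j \<mu>. \<not> ?l dvd coef (coeff A j) \<mu>"
  proof (rule ccontr)
    assume all: "\<not> ?thesis"
    have "?l dvd frob (msubst f (taylor_coef j \<mu> (r c0)))" for j \<mu>
    proof -
      have "?l dvd coef (coeff A j) \<mu>" using all by blast
      then have "diag_form n a dvd msubst f (taylor_coef j \<mu> (r c0))" by (rule contra'[OF _ c0(1)])
      then show ?thesis using qf_dvd_iff[OF a] by blast
    qed
    then have "?l dvd mconst (coef (frob (r c0)) m)" for m
      by (intro dvd_coef_of_taylor[where s = "\<lambda>i. frob (f i)"]) (simp add: coef_taylor_frob)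
    then have "coef (frob (r c0)) m = 0" for m
      by (simp add: lin_dvd_iff[where a = a, OF a0 n0])
    then have "frob (r c0) = 0" by (intro poly_mapping_eqI) simp
    then show False using c0(2) by (simp add: frob_eq_0_iff)
  qed
  define z where "z = (\<Sum>i=1..<k. mconst (mconst (b i)) * mvar i :: (nat, (nat, 'a) mpoly) mpoly)"
  define B where "B = (mconst (mconst (1 / b 0)) :: (nat, (nat, 'a) mpoly) mpoly)"
  \<comment> \<open>The root of the expanded linear form in the outer variable. Its part free of
    displacements is a unit times \<open>twisted k b f\<close>, that is, of order exactly 1 along
    \<alpha>.\<close>
  define \<rho> where "\<rho> = - (B * (mconst (twisted k b f) + z))"
  have Bb: "mconst (mconst (b 0)) * B = 1" using b0 by (simp add: B_def mconst_mult)
  have "T (lin_form k b) = [:mconst (twisted k b f) + z, mconst (mconst (b 0)):]"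
    unfolding T_def taylor_lin[OF k0] by (simp add: twisted_def z_def)
  then have "poly (T (lin_form k b)) \<rho> = mconst (twisted k b f) + z - (mconst (mconst (b 0)) * B) * (mconst (twisted k b f) + z)"
    by (simp add: \<rho>_def mult_ac)
  then have "poly (T (lin_form k b)) \<rho> = 0" by (simp add: Bb)
  moreover have "T (lin_form k b) dvd A" unfolding A_def by (rule rhom_dvd[OF T ldvd])
  ultimately have "poly A \<rho> = 0" by (auto simp: dvd_def)
  then have "(\<Sum>j<?p. coeff A j * \<rho> ^ j) = 0"
    using degA unfolding poly_altdef
    by (subst (asm) sum.mono_neutral_left[of "{..<?p}"]) (auto simp: coeff_eq_0)
  \<comment> \<open>Grading by the total degree in the remaining displacements separates the part of
    \<open>\<rho>\<close> of order 1 from \<open>z\<close>, whose coefficients need not be divisible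
    by \<alpha>.\<close>
  from arg_cong[OF this, of "grading UNIV"]
  have rel: "(\<Sum>j<?p. grading UNIV (coeff A j) * grading UNIV \<rho> ^ j) = 0"
    by (simp add: grading_simps)
  let ?\<pi> = "mconst ?l :: (nat, (nat, 'a) mpoly) mpoly"
  have dvdC: "?\<pi> ^ ?p dvd coeff (grading UNIV (coeff A j)) i" if "?\<pi> dvd coeff (grading UNIV (coeff A j)) i" for j i
  proof -
    have "?l ^ ?p dvd coef (coeff (grading UNIV (coeff A j)) i) \<mu>" for \<mu>
    proof -
      have "?l dvd coef (coeff (grading UNIV (coeff A j)) i) \<mu>"
        using that by (simp only: mconst_dvd_iff)
      then show ?thesis using dich[of j \<mu>] by (cases "mdeg \<mu> = i") (simp_all add: coef_grading)
    qed
    then have "mconst (?l ^ ?p) dvd coeff (grading UNIV (coeff A j)) i" by (simp only: mconst_dvd_iff) simp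
    then show ?thesis by (simp only: mconst_simps)
  qed
  obtain w where w: "twisted k b f = ?l * w" "\<not> ?l dvd w"
    using f by (auto simp: dvd_def power2_eq_square mult.assoc)
  have exC: "\<exists>i. \<exists>j<?p. \<not> ?\<pi> dvd coeff (grading UNIV (coeff A j)) i"
  proof -
    obtain j \<mu> where j\<mu>: "\<not> ?l dvd coef (coeff A j) \<mu>" using ex by blast
    then have "\<not> ?\<pi> dvd coeff (grading UNIV (coeff A j)) (mdeg \<mu>)"
      unfolding mconst_dvd_iff by (auto simp: coef_grading intro!: exI[of _ \<mu>])
    moreover have "j < ?p" using j\<mu> degA by (metis coeff_eq_0 dvd_0_right le_less_trans lookup_zero not_le)
    ultimately show ?thesis by blast
  qed
  \<comment> \<open>The lowest degree in the displacements at which some coefficient survives modulo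
    \<alpha>. Below it everything is divisible by \<alpha>^p, so products involving \<open>z\<close>
    do not disturb the comparison of orders.\<close>
  define i where "i = (LEAST i. \<exists>j<?p. \<not> ?\<pi> dvd coeff (grading UNIV (coeff A j)) i)"
  have i: "\<exists>j<?p. \<not> ?\<pi> dvd coeff (grading UNIV (coeff A j)) i"
    unfolding i_def by (rule LeastI_ex[OF exC])
  have i_lt: "?\<pi> dvd coeff (grading UNIV (coeff A j)) i'" if "j < ?p" "i' < i" for j i'
    using not_less_Least[OF that(2)[unfolded i_def]] that(1) by blast
  have grading_z: "coeff (grading UNIV z) 0 = 0"
    by (simp add: z_def grading_simps coeff_sum)
  have w': "\<not> ?\<pi> dvd - (B * mconst w)"
  proof
    assume "?\<pi> dvd - (B * mconst w)"
    then have "?\<pi> dvd mconst (mconst (b 0)) * (B * mconst w)" by simp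
    then have "?\<pi> dvd mconst w" by (simp add: Bb flip: mult.assoc)
    then have "?l dvd w" by (auto simp: mconst_dvd_iff coef_mconst dest: spec[of _ 0])
    then show False using w(2) by simp
  qed
  show False
  proof (rule no_relation[of ?\<pi> ?p "\<lambda>j. grading UNIV (coeff A j)" i "grading UNIV \<rho>"])
    show "?\<pi> \<noteq> 0" using lin_nz[where a = a, OF a0 n0] by simp
    show "\<not> ?\<pi> dvd 1"
      using lin_not_dvd_1[where a = a, OF a0 n0] by (auto simp: mconst_dvd_iff lookup_one intro!: exI[of _ 0])
    show "coeff (grading UNIV \<rho>) 0 = ?\<pi> * - (B * mconst w)"
      by (simp add: \<rho>_def B_def grading_simps w(1) mconst_simps grading_z mult_ac)
  qed (use mconst_lin_dvd_mult_iff[where a = a, OF a0 n0] dvdC i i_lt w' rel in auto)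
qed

end

subsection \<open>Counting monomials\<close>

lemma mdeg_superset:
  assumes "finite A" "Poly_Mapping.keys m \<subseteq> A"
  shows "mdeg m = (\<Sum>y\<in>A. Poly_Mapping.lookup m y)"
  unfolding mdeg_def using assms by (intro sum.mono_neutral_left) (auto simp: in_keys_iff)

lemma mdeg_add: "mdeg (m + n) = mdeg m + mdeg n"
proof -
  let ?A = "Poly_Mapping.keys m \<union> Poly_Mapping.keys n"
  have "mdeg (m + n) = (\<Sum>y\<in>?A. Poly_Mapping.lookup (m + n) y)"
    by (rule mdeg_superset) (auto simp: keys_add)
  also have "\<dots> = mdeg m + mdeg n"
    by (simp add: lookup_add sum.distrib mdeg_superset[of ?A])
  finally show ?thesis .
qed

lemma lookup_le_mdeg: "Poly_Mapping.lookup m i \<le> mdeg m"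
proof (cases "i \<in> Poly_Mapping.keys m")
  case True
  then show ?thesis unfolding mdeg_def by (intro member_le_sum) auto
next
  case False
  then show ?thesis by (simp add: in_keys_iff)
qed

lemma card_exponents:
  assumes I: "finite I" and X: "\<And>i. i \<in> I \<Longrightarrow> finite (X i)"
  shows "finite {m :: 'x \<Rightarrow>\<^sub>0 nat. Poly_Mapping.keys m \<subseteq> I \<and> (\<forall>i\<in>I. Poly_Mapping.lookup m i \<in> X i)}" (is "finite ?S")
    and "card {m :: 'x \<Rightarrow>\<^sub>0 nat. Poly_Mapping.keys m \<subseteq> I \<and> (\<forall>i\<in>I. Poly_Mapping.lookup m i \<in> X i)} = (\<Prod>i\<in>I. card (X i))"
proof -
  let ?f = "\<lambda>m :: 'x \<Rightarrow>\<^sub>0 nat. \<lambda>i\<in>I. Poly_Mapping.lookup m i"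
  have "bij_betw ?f ?S (PiE I X)"
  proof (rule bij_betw_imageI)
    show "inj_on ?f ?S"
    proof (rule inj_onI)
      fix m m' assume *: "m \<in> ?S" "m' \<in> ?S" "?f m = ?f m'"
      show "m = m'"
      proof (rule poly_mapping_eqI)
        fix i
        show "Poly_Mapping.lookup m i = Poly_Mapping.lookup m' i"
        proof (cases "i \<in> I")
          case True
          then show ?thesis using fun_cong[OF *(3), of i] by simp
        next
          case False
          then have "i \<notin> Poly_Mapping.keys m" "i \<notin> Poly_Mapping.keys m'" using * by auto
          then show ?thesis by (simp add: in_keys_iff)
        qed
      qed
    qed
    show "?f ` ?S = PiE I X"
    proof (intro equalityI subsetI)
      fix g assume g: "g \<in> PiE I X"
      define h where "h i = (if i \<in> I then g i else 0)" for i
      have fin: "finite {i. h i \<noteq> 0}" by (rule finite_subset[OF _ I]) (auto simp: h_def split: if_splits)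
      have lk: "Poly_Mapping.lookup (Abs_poly_mapping h) = h"
        using fin by simp
      have "Poly_Mapping.keys (Abs_poly_mapping h) \<subseteq> I"
      proof
        fix x assume "x \<in> Poly_Mapping.keys (Abs_poly_mapping h)"
        then have "h x \<noteq> 0" unfolding in_keys_iff lk .
        then show "x \<in> I" by (simp add: h_def split: if_splits)
      qed
      moreover have "?f (Abs_poly_mapping h) = g"
        using g unfolding lk by (auto simp: h_def PiE_def extensional_def)
      ultimately show "g \<in> ?f ` ?S"
        using g by (intro image_eqI[of _ _ "Abs_poly_mapping h"]) (auto simp: lk h_def)
    qed auto
  qed
  then show "finite ?S" "card ?S = (\<Prod>i\<in>I. card (X i))"
    using I X by (auto simp: bij_betw_finite finite_PiE card_PiE dest: bij_betw_same_card)
qed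

section \<open>Algebraic independence by counting\<close>

lemma msubst_scaled_homogeneous:
  fixes P :: "('x, 'a::comm_ring_1) mpoly"
  assumes "homogeneous A e P"
  shows "msubst (\<lambda>i. q * mvar i) P = q ^ e * P"
proof -
  have "mono_val (\<lambda>i. q * mvar i) m = q ^ mdeg m * mono_val mvar m" for m
    by (simp add: mono_val_def mdeg_def power_mult_distrib prod.distrib power_sum)
  then have "msubst (\<lambda>i. q * mvar i) P = (\<Sum>m\<in>expts P. q ^ e * (mconst (coef P m) * mono_val mvar m))"
    unfolding msubst_eq_ev ev_def using assms
    by (intro sum.cong) (auto simp: homogeneous_iff_coef in_keys_iff)
  also have "\<dots> = q ^ e * msubst mvar P"
    by (simp add: msubst_eq_ev ev_def sum_distrib_left)
  finally show ?thesis by (simp add: msubst_eq_ev ev_id)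
qed

text \<open>The component of degree e is multiplied by q^e and moves to degree (d + 1) e, so
  different components cannot cancel.\<close>

lemma msubst_scaled_inj:
  fixes P q :: "(nat, 'a::idom) mpoly"
  assumes q: "homogeneous A d q" "q \<noteq> 0" and P: "restrict_vars A P = P"
    and 0: "msubst (\<lambda>i. q * mvar i) P = 0"
  shows "P = 0"
proof -
  let ?c = "\<lambda>e. coeff (grading A P) e"
  let ?D = "degree (grading A P)"
  have "msubst (\<lambda>i. q * mvar i) P = (\<Sum>e\<le>?D. q ^ e * ?c e)"
    by (subst P[symmetric], unfold restrict_vars_eq_sum)
      (simp add: msubst_simps msubst_scaled_homogeneous[OF homogeneous_coeff_grading])
  moreover have "grading A (q ^ e * ?c e) = monom (q ^ e * ?c e) (d * e + e)" for e
    using homogeneous_mult[OF homogeneous_power[OF q(1)] homogeneous_coeff_grading]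
    by (simp add: homogeneous_iff_grading)
  ultimately have eq: "(\<Sum>e\<le>?D. monom (q ^ e * ?c e) (d * e + e)) = 0"
    using 0 by (metis (no_types, lifting) grading_simps(1,7) sum.cong)
  have "?c e = 0" if e: "e \<le> ?D" for e
  proof -
    have inj: "d * e' + e' = d * e + e \<longleftrightarrow> e' = e" for e'
      by (metis add.commute mult.commute mult_Suc mult_cancel2 nat.distinct(1))
    have "coeff (\<Sum>e\<le>?D. monom (q ^ e * ?c e) (d * e + e)) (d * e + e)
        = (\<Sum>e'\<le>?D. if e' = e then q ^ e' * ?c e' else 0)"
      unfolding coeff_sum by (intro sum.cong refl) (simp add: inj)
    also have "\<dots> = q ^ e * ?c e" using e by simp
    finally show ?thesis using eq q(2) by simp
  qed
  then have "restrict_vars A P = 0" unfolding restrict_vars_eq_sum by simp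
  then show ?thesis using P by simp
qed

lemma vector_space_mpoly: "vector_space (\<lambda>c (g :: ('x, 'a::field) mpoly). mconst c * g)"
  by standard (simp_all add: algebra_simps mconst_simps)

text \<open>Division by one relation: with \<open>a0\<close> the largest exponent of
  \<open>h\<close>, a monomial that is divisible by \<open>a0\<close> can be rewritten by smaller
  ones of the same degree. What remains are the monomials in which some exponent is below that of
  \<open>a0\<close>.\<close>

lemma monomials_span_reduced:
  fixes \<upsilon> :: "nat \<Rightarrow> (nat, 'a::field) mpoly"
  assumes I: "finite I" and h: "homogeneous I e h" "h \<noteq> 0" "msubst \<upsilon> h = 0"
  shows "\<exists>a0. Poly_Mapping.keys a0 \<subseteq> I \<and> mdeg a0 = e \<and> (\<forall>a. Poly_Mapping.keys a \<subseteq> I \<longrightarrow>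
    mono_val \<upsilon> a \<in> module.span (\<lambda>c g. mconst c * g) (mono_val \<upsilon> `
      {a'. Poly_Mapping.keys a' \<subseteq> I \<and> mdeg a' = mdeg a \<and> (\<exists>i\<in>I. Poly_Mapping.lookup a' i < Poly_Mapping.lookup a0 i)}))"
proof -
  interpret V: vector_space "\<lambda>c (g :: (nat, 'a) mpoly). mconst c * g" by (rule vector_space_mpoly)
  define a0 where "a0 = Max (expts h)"
  have ne: "expts h \<noteq> {}" using h(2) by simp
  have a0: "a0 \<in> expts h" unfolding a0_def using ne by simp
  have hk: "Poly_Mapping.keys m \<subseteq> I" "mdeg m = e" if "m \<in> expts h" for m
    using that h(1) by (auto simp: homogeneous_def mdeg_def)
  have c0: "coef h a0 \<noteq> 0" using a0 by (simp add: in_keys_iff)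
  define Red where "Red D = {a'. Poly_Mapping.keys a' \<subseteq> I \<and> mdeg a' = D \<and>
    (\<exists>i\<in>I. Poly_Mapping.lookup a' i < Poly_Mapping.lookup a0 i)}" for D
  have "mono_val \<upsilon> a \<in> V.span (mono_val \<upsilon> ` Red (mdeg a))" if a: "Poly_Mapping.keys a \<subseteq> I" for a
  proof (rule ccontr)
    assume na: "\<not> ?thesis"
    let ?D = "mdeg a"
    \<comment> \<open>Only finitely many exponents have a given degree, so a least bad one exists in
      the linear order on exponents; the order is compatible with addition, which makes the
      rewritten monomials smaller.\<close>
    define Bad where "Bad = {b. Poly_Mapping.keys b \<subseteq> I \<and> mdeg b = ?D \<and> mono_val \<upsilon> b \<notin> V.span (mono_val \<upsilon> ` Red ?D)}"
    have "Bad \<subseteq> {m. Poly_Mapping.keys m \<subseteq> I \<and> (\<forall>i\<in>I. Poly_Mapping.lookup m i \<in> {..?D})}"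
      unfolding Bad_def by auto (metis lookup_le_mdeg)
    then have fin: "finite Bad" using card_exponents(1)[OF I, of "\<lambda>_. {..?D}"] finite_subset by blast
    have "a \<in> Bad" using a na by (simp add: Bad_def)
    define b where "b = Min Bad"
    have b: "b \<in> Bad" unfolding b_def using fin \<open>a \<in> Bad\<close> by (intro Min_in) auto
    have b_min: "b' \<notin> Bad" if "b' < b" for b'
      using that fin unfolding b_def by (metis Min_le not_le)
    have "b \<notin> Red ?D" using b V.span_base by (auto simp: Bad_def)
    then have ge: "Poly_Mapping.lookup a0 i \<le> Poly_Mapping.lookup b i" for i
    proof (cases "i \<in> I")
      case True
      then show ?thesis using \<open>b \<notin> Red ?D\<close> b by (force simp: Red_def Bad_def)
    next
      case False
      then have "i \<notin> Poly_Mapping.keys a0" using hk(1)[OF a0] by blast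
      then show ?thesis by (simp add: in_keys_iff)
    qed
    define a1 where "a1 = b - a0"
    have ba: "b = a0 + a1"
      using ge by (intro poly_mapping_eqI) (simp add: a1_def lookup_add lookup_minus)
    have k1: "Poly_Mapping.keys a1 \<subseteq> I"
    proof
      fix i assume "i \<in> Poly_Mapping.keys a1"
      then have "i \<in> Poly_Mapping.keys b" by (simp add: in_keys_iff ba lookup_add)
      then show "i \<in> I" using b by (auto simp: Bad_def)
    qed
    have "(\<Sum>m\<in>expts h. mconst (coef h m) * mono_val \<upsilon> m) = 0"
      using h(3) by (simp add: msubst_eq_ev ev_def)
    then have "mconst (coef h a0) * mono_val \<upsilon> a0 = - (\<Sum>m\<in>expts h - {a0}. mconst (coef h m) * mono_val \<upsilon> m)"
      using a0 by (simp add: sum.remove[of _ a0] eq_neg_iff_add_eq_0)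
    then have "mconst (coef h a0) * mono_val \<upsilon> b = - (\<Sum>m\<in>expts h - {a0}. mconst (coef h m) * mono_val \<upsilon> m) * mono_val \<upsilon> a1"
      by (simp only: ba mono_val_add mult.assoc[symmetric])
    also have "\<dots> = (\<Sum>m\<in>expts h - {a0}. mconst (- coef h m) * mono_val \<upsilon> (m + a1))"
      by (simp add: mono_val_add sum_distrib_right mconst_simps sum_negf mult.assoc)
    also have "\<dots> \<in> V.span (mono_val \<upsilon> ` Red ?D)"
    proof (intro V.span_sum V.span_scale)
      fix m assume m: "m \<in> expts h - {a0}"
      have "m \<le> a0" unfolding a0_def using m by (intro Max_ge) auto
      then have "m < a0" using m by auto
      then have "m + a1 < b" unfolding ba by (rule add_strict_right_mono)
      then have "m + a1 \<notin> Bad" by (rule b_min)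
      moreover have "Poly_Mapping.keys (m + a1) \<subseteq> I" using keys_add[of m a1] k1 hk(1)[of m] m by auto
      moreover have "mdeg (m + a1) = ?D"
        using b hk(2)[of m] hk(2)[OF a0] m by (simp add: Bad_def ba mdeg_add)
      ultimately show "mono_val \<upsilon> (m + a1) \<in> V.span (mono_val \<upsilon> ` Red ?D)" by (simp add: Bad_def)
    qed
    finally have "mconst (1 / coef h a0) * (mconst (coef h a0) * mono_val \<upsilon> b) \<in> V.span (mono_val \<upsilon> ` Red ?D)"
      by (rule V.span_scale)
    moreover have "mconst (1 / coef h a0) * (mconst (coef h a0) * mono_val \<upsilon> b) = mono_val \<upsilon> b"
      using c0 by (simp add: mconst_mult flip: mult.assoc)
    ultimately have "mono_val \<upsilon> b \<in> V.span (mono_val \<upsilon> ` Red ?D)" by (simp only:)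
    then show False using b by (simp add: Bad_def)
  qed
  then show ?thesis using hk[OF a0] unfolding Red_def by blast
qed

text \<open>With N = \<open>card I\<close>, there are (M + 1)^N independent monomials in the
  elements q x_i with exponents at most M. Through \<open>G\<close> they lie in the span of reduced
  monomials in \<open>\<upsilon>\<close> of degree O(M), and those number only O(M^(N-1)).\<close>

lemma no_algebraic_relation:
  fixes \<upsilon> G :: "nat \<Rightarrow> (nat, 'a::field) mpoly"
  assumes I: "finite I" "I \<noteq> {}" and h: "homogeneous I e h" "h \<noteq> 0" "msubst \<upsilon> h = 0"
    and G: "\<And>i. i \<in> I \<Longrightarrow> homogeneous I l (G i)" "\<And>i. i \<in> I \<Longrightarrow> msubst \<upsilon> (G i) = q * mvar i"
    and q: "homogeneous I d q" "q \<noteq> 0"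
  shows False
proof -
  interpret V: vector_space "\<lambda>c (g :: (nat, 'a) mpoly). mconst c * g" by (rule vector_space_mpoly)
  obtain a0 where a0: "Poly_Mapping.keys a0 \<subseteq> I" "mdeg a0 = e"
    and span: "\<And>a. Poly_Mapping.keys a \<subseteq> I \<Longrightarrow> mono_val \<upsilon> a \<in> V.span (mono_val \<upsilon> `
      {a'. Poly_Mapping.keys a' \<subseteq> I \<and> mdeg a' = mdeg a \<and> (\<exists>i\<in>I. Poly_Mapping.lookup a' i < Poly_Mapping.lookup a0 i)})"
    using monomials_span_reduced[OF I(1) h] by blast
  define N where "N = card I"
  have N: "N > 0" using I by (simp add: N_def card_gt_0_iff)
  \<comment> \<open>\<open>M\<close> is the constant of the final estimate, so that the count of
    reduced monomials is at most M (M + 1)^(N-1). \<open>L\<close> bounds the degree in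
    \<open>\<upsilon>\<close> of a monomial whose N exponents are at most M and whose factors have
    degree l.\<close>
  define M where "M = N * e * (l * N + 1) ^ (N - 1)"
  define L where "L = l * (N * M)"
  define E where "E = {m. Poly_Mapping.keys m \<subseteq> I \<and> (\<forall>i\<in>I. Poly_Mapping.lookup m i \<in> {..M})}"
  have E: "finite E" "card E = (M + 1) ^ N"
    unfolding E_def using card_exponents[OF I(1), of "\<lambda>_. {..M}"] by (simp_all add: N_def)
  define s where "s i = q * mvar i" for i
  have inj: "(\<Sum>m\<in>E. mconst (c m) * mono_val s m) = 0 \<Longrightarrow> m \<in> E \<Longrightarrow> c m = 0" for c m
  proof -
    assume 0: "(\<Sum>m\<in>E. mconst (c m) * mono_val s m) = 0" and m: "m \<in> E"
    define P where "P = (\<Sum>m\<in>E. Poly_Mapping.single m (c m))"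
    have "msubst s P = 0"
      using 0 by (simp add: P_def msubst_simps) (simp add: msubst_eq_ev ev_single[OF rhom_mconst])
    moreover have "restrict_vars I P = P"
    proof -
      have "restrict_vars I (Poly_Mapping.single m (c m)) = Poly_Mapping.single m (c m)" if "m \<in> E" for m
        using that by (simp add: grading_single E_def poly_monom flip: poly_grading_1)
      then show ?thesis unfolding P_def rhom_sum[OF rhom_restrict_vars] by (intro sum.cong) auto
    qed
    ultimately have "P = 0" using msubst_scaled_inj[OF q] unfolding s_def by blast
    then have "coef P m = 0" by simp
    then show "c m = 0"
      using m E(1) by (simp add: P_def lookup_sum lookup_single when_def sum.delta)
  qed
  have inj_on: "inj_on (mono_val s) E"
  proof (rule inj_onI, rule ccontr)
    fix m m' assume m: "m \<in> E" "m' \<in> E" "mono_val s m = mono_val s m'" "m \<noteq> m'"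
    let ?c = "\<lambda>x. if x = m then 1 else if x = m' then - 1 else (0::'a)"
    have "(\<Sum>x\<in>E. mconst (?c x) * mono_val s x) = (\<Sum>x\<in>{m, m'}. mconst (?c x) * mono_val s x)"
      using E(1) m by (intro sum.mono_neutral_right) auto
    also have "\<dots> = 0" using m by (simp add: mconst_simps)
    finally have "?c m = 0" using inj[of ?c m] m by blast
    then show False by simp
  qed
  have indep: "V.independent (mono_val s ` E)"
  proof
    assume "V.dependent (mono_val s ` E)"
    then obtain u where u: "\<exists>v\<in>mono_val s ` E. u v \<noteq> 0" "(\<Sum>v\<in>mono_val s ` E. mconst (u v) * v) = 0"
      using V.dependent_finite[of "mono_val s ` E"] E(1) by auto
    then show False using inj[of "\<lambda>m. u (mono_val s m)"] by (auto simp: sum.reindex[OF inj_on])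
  qed
  \<comment> \<open>A superset of the reduced exponents, easy to count: one exponent is below
    \<open>e\<close>, which bounds every entry of \<open>a0\<close>, and the others are at most
    \<open>L\<close>.\<close>
  define R where "R i = {a'. Poly_Mapping.keys a' \<subseteq> I \<and>
    (\<forall>j\<in>I. Poly_Mapping.lookup a' j \<in> (if j = i then {..<e} else {..L}))}" for i :: nat
  have R: "finite (R i)" "card (R i) = e * (L + 1) ^ (N - 1)" if "i \<in> I" for i
  proof -
    have "(\<Prod>j\<in>I. card (if j = i then {..<e} else {..L})) = (\<Prod>j\<in>I. if j = i then e else L + 1)"
      by (intro prod.cong) auto
    also have "\<dots> = e * (\<Prod>j\<in>I - {i}. if j = i then e else L + 1)"
      using that I by (subst prod.remove[of I i]) auto
    also have "(\<Prod>j\<in>I - {i}. if j = i then e else L + 1) = (\<Prod>j\<in>I - {i}. L + 1)"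
      by (intro prod.cong) auto
    also have "\<dots> = (L + 1) ^ (N - 1)" using that I by (simp add: N_def)
    finally show "finite (R i)" "card (R i) = e * (L + 1) ^ (N - 1)"
      unfolding R_def using card_exponents[OF I(1), of "\<lambda>j. if j = i then {..<e} else {..L}"]
      by (auto simp del: prod_constant)
  qed
  let ?R = "\<Union>i\<in>I. R i"
  have finR: "finite ?R" using R I by blast
  have "card ?R \<le> (\<Sum>i\<in>I. card (R i))" by (rule card_UN_le[OF I(1)])
  also have "\<dots> = N * (e * (L + 1) ^ (N - 1))" using R by (simp add: N_def)
  finally have cardR: "card ?R \<le> N * (e * (L + 1) ^ (N - 1))" .
  have "mono_val s ` E \<subseteq> V.span (mono_val \<upsilon> ` ?R)"
  proof
    fix x assume "x \<in> mono_val s ` E"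
    then obtain m where m: "m \<in> E" "x = mono_val s m" by blast
    define P where "P = (\<Prod>i\<in>Poly_Mapping.keys m. G i ^ Poly_Mapping.lookup m i)"
    have km: "Poly_Mapping.keys m \<subseteq> I" using m by (simp add: E_def)
    have "mdeg m = (\<Sum>i\<in>I. Poly_Mapping.lookup m i)" by (rule mdeg_superset[OF I(1) km])
    also have "\<dots> \<le> (\<Sum>i\<in>I. M)" using m by (intro sum_mono) (auto simp: E_def)
    finally have Lm: "l * mdeg m \<le> L" by (simp add: L_def N_def)
    have "msubst \<upsilon> P = x"
      unfolding P_def m(2) mono_val_def s_def using G(2) km
      by (auto simp: msubst_simps intro!: prod.cong)
    moreover have "homogeneous I (\<Sum>i\<in>Poly_Mapping.keys m. l * Poly_Mapping.lookup m i) P"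
      unfolding P_def using G(1) km by (intro homogeneous_prod homogeneous_power) auto
    then have hP: "homogeneous I (l * mdeg m) P" by (simp add: mdeg_def sum_distrib_left)
    moreover have "msubst \<upsilon> P \<in> V.span (mono_val \<upsilon> ` ?R)"
      unfolding msubst_eq_ev ev_def
    proof (intro V.span_sum V.span_scale)
      fix a assume "a \<in> expts P"
      then have a: "Poly_Mapping.keys a \<subseteq> I" "mdeg a \<le> L"
        using hP Lm by (auto simp: homogeneous_def mdeg_def)
      have "{a'. Poly_Mapping.keys a' \<subseteq> I \<and> mdeg a' = mdeg a \<and>
          (\<exists>i\<in>I. Poly_Mapping.lookup a' i < Poly_Mapping.lookup a0 i)} \<subseteq> ?R"
      proof safe
        fix a' i assume *: "Poly_Mapping.keys a' \<subseteq> I" "mdeg a' = mdeg a" "i \<in> I"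
          "Poly_Mapping.lookup a' i < Poly_Mapping.lookup a0 i"
        have "Poly_Mapping.lookup a' j \<le> L" for j
          using lookup_le_mdeg[of a' j] *(2) a(2) by simp
        moreover have "Poly_Mapping.lookup a' i < e" using lookup_le_mdeg[of a0 i] a0(2) *(4) by simp
        ultimately have "a' \<in> R i" using *(1) by (simp add: R_def)
        then show "a' \<in> ?R" using *(3) by blast
      qed
      then show "mono_val \<upsilon> a \<in> V.span (mono_val \<upsilon> ` ?R)"
        using span[OF a(1)] V.span_mono[OF image_mono] by blast
    qed
    ultimately show "x \<in> V.span (mono_val \<upsilon> ` ?R)" by simp
  qed
  then have "card (mono_val s ` E) \<le> card (mono_val \<upsilon> ` ?R)"
    using V.independent_span_bound[OF _ indep] finR by blast
  also have "\<dots> \<le> card ?R" by (rule card_image_le[OF finR])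
  finally have "(M + 1) ^ N \<le> N * (e * (L + 1) ^ (N - 1))"
    using cardR by (simp add: card_image[OF inj_on] E)
  also have "\<dots> \<le> N * (e * ((l * N + 1) * (M + 1)) ^ (N - 1))"
    by (intro mult_le_mono2 power_mono) (simp_all add: L_def algebra_simps)
  also have "\<dots> = (N * e * (l * N + 1) ^ (N - 1)) * (M + 1) ^ (N - 1)"
    by (simp only: power_mult_distrib mult_ac)
  also have "\<dots> = M * (M + 1) ^ (N - 1)"
    by (simp only: M_def)
  finally have "(M + 1) * (M + 1) ^ (N - 1) \<le> M * (M + 1) ^ (N - 1)"
    using N by (simp flip: power_Suc)
  then show False by simp
qed

subsection \<open>Isotropy over function fields\<close>

lemma msubst_of_restrict_vars:
  "msubst s (restrict_vars A g) = msubst (\<lambda>x. if x \<in> A then s x else 0) g"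
  unfolding restrict_vars_def msubst_msubst
  by (intro arg_cong2[where f = msubst] ext) (auto simp: msubst_simps)

lemma msubst_cong_mod_on:
  fixes s s' :: "'x \<Rightarrow> ('y, 'a::comm_ring_1) mpoly"
  assumes "homogeneous A k g" "\<And>x. x \<in> A \<Longrightarrow> q dvd s x - s' x"
  shows "q dvd msubst s g - msubst s' g"
proof -
  have "q dvd msubst s (restrict_vars A g) - msubst s' (restrict_vars A g)"
    unfolding msubst_of_restrict_vars by (rule msubst_cong_mod) (simp add: assms(2))
  then show ?thesis by (simp add: restrict_vars_homogeneous[OF assms(1)])
qed

text \<open>The degrees k * d of the images of different components are distinct because k is
  positive.\<close>

lemma grading_msubst:
  fixes g :: "('y, 'r::comm_ring_1) mpoly"
  assumes f: "\<And>c. c \<in> C \<Longrightarrow> homogeneous A k (f c)" "\<And>c. c \<notin> C \<Longrightarrow> f c = 0" and k: "k > 0"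
  shows "coeff (grading A (msubst f g)) (k * d) = msubst f (coeff (grading C g) d)"
proof -
  let ?c = "\<lambda>e. coeff (grading C g) e"
  have "msubst f g = msubst f (restrict_vars C g)" using f(2) by (simp add: msubst_restrict_vars)
  then have "grading A (msubst f g) = (\<Sum>e\<le>degree (grading C g). grading A (msubst f (?c e)))"
    by (simp add: restrict_vars_eq_sum msubst_simps grading_simps)
  also have "\<dots> = (\<Sum>e\<le>degree (grading C g). monom (msubst f (?c e)) (k * e))"
    using homogeneous_msubst[where f = f and A = A and k = k, OF homogeneous_coeff_grading f(1)]
    by (simp add: homogeneous_iff_grading)
  finally have "coeff (grading A (msubst f g)) (k * d)
      = (\<Sum>e\<le>degree (grading C g). if e = d then msubst f (?c e) else 0)"
    using k by (simp add: coeff_sum)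
  also have "\<dots> = msubst f (?c d)"
    by (cases "d \<le> degree (grading C g)") (auto simp: coeff_eq_0 msubst_simps)
  finally show ?thesis .
qed

context prime_char_field
begin

text \<open>Isotropy, over the function field of the first form, of the second form restricted to
  the coordinates in \<open>A\<close>. Polynomial vectors suffice after clearing denominators;
  \<open>restrict_vars\<close> confines them to the n variables in use.\<close>

definition isotropic_over :: "nat \<Rightarrow> (nat \<Rightarrow> 'a) \<Rightarrow> nat \<Rightarrow> (nat \<Rightarrow> 'a) \<Rightarrow> nat set \<Rightarrow> bool"
  where "isotropic_over n a k b A \<longleftrightarrow> (\<exists>f. (\<forall>c. c \<notin> A \<longrightarrow> f c = 0) \<and> (\<forall>c. restrict_vars {..<n} (f c) = f c) \<and>
    lin_form n a dvd twisted k b f \<and> (\<exists>c<k. \<not> diag_form n a dvd f c))"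

lemma homogeneous_frob: "homogeneous A k (frob (g :: ('x, 'a) mpoly)) \<longleftrightarrow> homogeneous A k g"
  by (simp add: homogeneous_def expts_frob)

lemma lin_power_dvd_tw_if:
  assumes "\<And>c. c < k \<Longrightarrow> diag_form n (a :: nat \<Rightarrow> 'a) dvd f c"
  shows "lin_form n a ^ CHAR('a) dvd twisted k b f"
  unfolding twisted_def using assms by (intro dvd_sum dvd_mult qf_dvd_imp) auto

lemma lin_power2_dvd: "(lin_form n a)\<^sup>2 dvd lin_form n (a :: nat \<Rightarrow> 'a) ^ CHAR('a)"
  using p_ge2 by (rule le_imp_power_dvd)

context
  fixes n :: nat and a :: "nat \<Rightarrow> 'a"
  assumes an: "aniso n a" "n \<ge> 2"
begin

lemma first_coeff_nz: "a 0 \<noteq> 0" and dim_pos: "n > 0"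
  using aniso_nz[OF an(1)] an(2) by auto

lemmas lin_mult_iff = lin_dvd_mult_iff[where a = a, OF first_coeff_nz dim_pos]

lemma qf_mult_iff: "diag_form n a dvd x * y \<longleftrightarrow> diag_form n a dvd x \<or> diag_form n a dvd y"
  by (simp add: qf_dvd_iff[OF an] frob_simps lin_mult_iff)

lemma qf_not_dvd_mvar: "\<not> diag_form n a dvd mvar i"
proof
  assume "diag_form n a dvd mvar i"
  moreover have "low_degree CHAR('a) (mvar i :: (nat, 'a) mpoly)"
    using p_ge2 by (auto simp: low_degree_def mvar_def lookup_single when_def)
  ultimately have "(mvar i :: (nat, 'a) mpoly) = 0" by (rule qf_dvd_low[where a = a, OF first_coeff_nz dim_pos])
  then show False by (metis coef_mvar lookup_zero zero_neq_one)
qed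

lemma qf_not_dvd_1: "\<not> diag_form n a dvd 1"
  using qf_not_dvd_mvar[of 0] by (metis dvd_trans one_dvd)

lemma qf_dvd_prod: "finite A \<Longrightarrow> diag_form n a dvd prod f A \<longleftrightarrow> (\<exists>i\<in>A. diag_form n a dvd f i)"
  by (induction A rule: finite_induct) (auto simp: qf_not_dvd_1 qf_mult_iff)

lemma qf_dvd_power: "diag_form n a dvd x ^ k \<Longrightarrow> diag_form n a dvd x"
  by (induction k) (auto simp: qf_not_dvd_1 qf_mult_iff)

lemma qf_dvd_qf: "diag_form n a dvd msubst f (diag_form k (b :: nat \<Rightarrow> 'a)) \<longleftrightarrow> lin_form n a dvd twisted k b f"
proof -
  have "frob (msubst f (diag_form k b)) = twisted k b f ^ CHAR('a)"
    by (simp add: diag_form_def twisted_def msubst_simps frob_simps pow_simps power_mult_distrib mconst_simps)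
  moreover have "lin_form n a dvd x ^ Suc j \<longleftrightarrow> lin_form n a dvd x" for x j
    by (induction j) (auto simp: lin_mult_iff)
  then have "lin_form n a dvd x ^ CHAR('a) \<longleftrightarrow> lin_form n a dvd x" for x
    using p_pos by (metis Suc_pred)
  ultimately show ?thesis by (simp add: qf_dvd_iff[OF an])
qed

lemma isotropic_over_empty: "\<not> isotropic_over n a k b {}"
  by (auto simp: isotropic_over_def)

lemma isotropic_over_self: "isotropic_over n a n a {..<n}"
  unfolding isotropic_over_def
proof (intro exI[of _ "\<lambda>c. if c < n then mvar c else 0"] conjI allI impI)
  have "twisted n a (\<lambda>c. if c < n then mvar c else 0) = lin_form n a"
    by (simp add: twisted_def lin_form_def)
  then show "lin_form n a dvd twisted n a (\<lambda>c. if c < n then mvar c else 0)" by simp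
  show "\<exists>c<n. \<not> diag_form n a dvd (if c < n then mvar c else 0)"
    using qf_not_dvd_mvar dim_pos by (intro exI[of _ 0]) auto
qed (auto simp: restrict_vars_simps)

lemma not_isotropic_overD:
  assumes "\<not> isotropic_over n a k b A" "\<And>c. c \<notin> A \<Longrightarrow> f c = 0" "\<And>c. restrict_vars {..<n} (f c) = f c"
    "lin_form n a dvd twisted k b f" "c < k"
  shows "diag_form n a dvd f c"
proof (rule ccontr)
  assume "\<not> ?thesis"
  then have "isotropic_over n a k b A" unfolding isotropic_over_def using assms(2-5) by (intro exI[of _ f]) auto
  then show False using assms(1) by contradiction
qed

text \<open>Dropping a coordinate that vanishes on X changes the twisted value by a multiple of
  \<alpha> only, and the remaining vector is supported where the form is anisotropic. Used in
  contrapositive form to see that diagonal entries do not vanish on X.\<close>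

lemma not_isotropic_over_insertD:
  assumes A: "\<not> isotropic_over n a k b A" and f: "\<And>c. c \<notin> insert j A \<Longrightarrow> f c = 0"
    "\<And>c. restrict_vars {..<n} (f c) = f c" "lin_form n a dvd twisted k b f" "c < k" "diag_form n a dvd f j"
  shows "diag_form n a dvd f c"
proof -
  let ?g = "\<lambda>c. if c = j then f j else 0" and ?h = "\<lambda>c. if c = j then 0 else f c"
  have "twisted k b f = twisted k b (\<lambda>c. ?g c + ?h c)" by (intro arg_cong[where f = "twisted k b"] ext) auto
  also have "\<dots> = twisted k b ?g + twisted k b ?h" by (rule tw_add)
  finally have eq: "twisted k b f = twisted k b ?g + twisted k b ?h" .
  have "lin_form n a ^ CHAR('a) dvd twisted k b ?g" using f(5) by (intro lin_power_dvd_tw_if) auto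
  moreover have "lin_form n a dvd lin_form n a ^ CHAR('a)" using p_pos by (simp add: dvd_power)
  ultimately have "lin_form n a dvd twisted k b ?g" by (rule dvd_trans[rotated])
  from dvd_diff[OF f(3) this] have "lin_form n a dvd twisted k b ?h" by (simp add: eq)
  then have "diag_form n a dvd ?h c"
    using f by (intro not_isotropic_overD[OF A]) (auto simp: restrict_vars_simps)
  then show ?thesis using f(5) by (auto split: if_splits)
qed

text \<open>The components of a twisted value are the twisted values of the components. All stay
  divisible by \<alpha>, and not all can be divisible by \<alpha>^2, so some component is still of
  order exactly 1.\<close>

lemma isotropic_over_homogeneous:
  assumes b: "aniso k b" and isotropic_over: "isotropic_over n a k b A"
  shows "\<exists>f d. (\<forall>c. c \<notin> A \<longrightarrow> f c = 0) \<and> (\<forall>c. homogeneous {..<n} d (f c)) \<and>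
    lin_form n a dvd twisted k b f \<and> \<not> (lin_form n a)\<^sup>2 dvd twisted k b f"
proof -
  obtain f where f: "\<forall>c. c \<notin> A \<longrightarrow> f c = 0" "\<And>c. restrict_vars {..<n} (f c) = f c"
    "lin_form n a dvd twisted k b f" "\<exists>c<k. \<not> diag_form n a dvd f c"
    using isotropic_over unfolding isotropic_over_def by blast
  obtain f' where f': "\<forall>c. f c = 0 \<longrightarrow> f' c = 0" "\<forall>c. restrict_vars {..<n} (f' c) = f' c"
    "lin_form n a dvd twisted k b f'" "\<not> (lin_form n a)\<^sup>2 dvd twisted k b f'"
    using exists_transversal[OF an b f(3,4,2)] by blast
  have "restrict_vars {..<n} (twisted k b f') = twisted k b f'" using f'(2) by (simp add: restrict_vars_tw)
  then obtain d where "\<not> (lin_form n a)\<^sup>2 dvd coeff (grading {..<n} (twisted k b f')) d"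
    using f'(4) dvd_if_dvd_coeff_grading by blast
  moreover have "lin_form n a dvd coeff (grading {..<n} (twisted k b f')) d"
    by (rule dvd_coeff_grading[OF homogeneous_lin f'(3)])
  ultimately show ?thesis
    using f(1) f'(1)
    by (intro exI[of _ "\<lambda>c. coeff (grading {..<n} (f' c)) d"] exI[of _ d])
      (auto simp: coeff_grading_tw homogeneous_coeff_grading grading_simps)
qed

lemma isotropic_over_trans:
  assumes b: "aniso k b" "k \<ge> 2" and ab: "isotropic_over n a k b A" and be: "isotropic_over k b l e E"
  shows "isotropic_over n a l e E"
proof -
  obtain f d where f: "\<forall>c. homogeneous {..<n} d (f c)"
    "lin_form n a dvd twisted k b f" "\<not> (lin_form n a)\<^sup>2 dvd twisted k b f"
    using isotropic_over_homogeneous[OF b(1) ab] by blast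
  obtain g' where g': "\<forall>c. c \<notin> E \<longrightarrow> g' c = 0" "lin_form k b dvd twisted l e g'" "\<exists>c<l. \<not> diag_form k b dvd g' c"
    using be unfolding isotropic_over_def by blast
  obtain g where g: "\<forall>c. g' c = 0 \<longrightarrow> g c = 0" "lin_form n a dvd twisted l e (\<lambda>c. msubst f (g c))"
    "\<exists>c<l. \<not> diag_form n a dvd msubst f (g c)"
    using transit[OF an b f(2,3) g'(2,3)] by blast
  have "restrict_vars {..<n} (msubst f h) = msubst f h" for h
    using f(1) by (intro restrict_vars_msubst restrict_vars_homogeneous) auto
  then show ?thesis
    unfolding isotropic_over_def using g g'(1)
    by (intro exI[of _ "\<lambda>c. msubst f (g c)"]) (auto simp: msubst_simps)
qed

text \<open>As \<open>f\<close> is homogeneous of positive degree, the component of degree j of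
  \<open>g\<close> reappears after substitution as the component of degree d * j. One that survives
  on X can therefore be selected.\<close>

lemma transit_homogeneous:
  assumes b: "aniso k b" "k \<ge> 2"
    and f: "\<And>c. c < k \<Longrightarrow> homogeneous {..<n} d (f c)" "\<And>c. \<not> c < k \<Longrightarrow> f c = 0" "d > 0"
      "lin_form n a dvd twisted k b f" "\<not> (lin_form n a)\<^sup>2 dvd twisted k b f"
    and be: "isotropic_over k b l e E"
  shows "\<exists>g dg. (\<forall>c. c \<notin> E \<longrightarrow> g c = 0) \<and> (\<forall>c. homogeneous {..<k} dg (g c)) \<and>
    lin_form n a dvd twisted l e (\<lambda>c. msubst f (g c)) \<and> (\<exists>c<l. \<not> diag_form n a dvd msubst f (g c))"
proof -
  obtain g' where g': "\<forall>c. c \<notin> E \<longrightarrow> g' c = 0" "lin_form k b dvd twisted l e g'" "\<exists>c<l. \<not> diag_form k b dvd g' c"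
    using be unfolding isotropic_over_def by blast
  obtain g where g: "\<forall>c. g' c = 0 \<longrightarrow> g c = 0" "lin_form n a dvd twisted l e (\<lambda>c. msubst f (g c))"
    "\<exists>c<l. \<not> diag_form n a dvd msubst f (g c)"
    using transit[OF an b f(4,5) g'(2,3)] by blast
  have comp: "coeff (grading {..<n} (msubst f h)) (d * j) = msubst f (coeff (grading {..<k} h) j)" for h j
    using f by (intro grading_msubst) auto
  obtain c where c: "c < l" "\<not> diag_form n a dvd msubst f (g c)" using g(3) by blast
  have "msubst f (g c) = msubst f (restrict_vars {..<k} (g c))"
    using f(2) by (subst msubst_restrict_vars) auto
  also have "\<dots> = (\<Sum>j\<le>degree (grading {..<k} (g c)). msubst f (coeff (grading {..<k} (g c)) j))"
    by (simp add: restrict_vars_eq_sum msubst_simps)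
  finally obtain j where j: "\<not> diag_form n a dvd msubst f (coeff (grading {..<k} (g c)) j)"
    using c(2) by (metis dvd_sum)
  have "lin_form n a dvd coeff (grading {..<n} (twisted l e (\<lambda>c. msubst f (g c)))) (d * j)"
    by (rule dvd_coeff_grading[OF homogeneous_lin g(2)])
  then have "lin_form n a dvd twisted l e (\<lambda>c. msubst f (coeff (grading {..<k} (g c)) j))"
    by (simp add: coeff_grading_tw comp)
  then show ?thesis
    using c(1) j g(1) g'(1)
    by (intro exI[of _ "\<lambda>c. coeff (grading {..<k} (g c)) j"] exI[of _ j])
      (auto simp: homogeneous_coeff_grading grading_simps)
qed

text \<open>Anisotropy off I makes the projection of the isotropic subspace to the I-coordinates
  injective. Taking I of least size makes it surjective: each i in I has an isotropic vector whose
  only other coordinates lie off I. So \<open>card I\<close> is the dimension of the isotropic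
  subspace.\<close>

lemma exists_minimal_anisotropic:
  "\<exists>I\<subseteq>{..<n}. I \<noteq> {} \<and> \<not> isotropic_over n a n a ({..<n} - I) \<and> (\<forall>i\<in>I. isotropic_over n a n a (insert i ({..<n} - I)))"
proof -
  define P where "P I \<longleftrightarrow> I \<subseteq> {..<n} \<and> \<not> isotropic_over n a n a ({..<n} - I)" for I
  have "P {..<n}" by (simp add: P_def isotropic_over_empty)
  then obtain I where I: "P I" "\<And>I'. P I' \<Longrightarrow> card I \<le> card I'"
    using ex_has_least_nat[of P "{..<n}" card] by blast
  have fin: "finite I" using I(1) finite_subset by (auto simp: P_def)
  have "isotropic_over n a n a (insert i ({..<n} - I))" if i: "i \<in> I" for i
  proof (rule ccontr)
    assume "\<not> ?thesis"
    moreover have "insert i ({..<n} - I) = {..<n} - (I - {i})" using i I(1) by (auto simp: P_def)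
    ultimately have "P (I - {i})" using I(1) by (auto simp: P_def)
    then show False using I(2)[of "I - {i}"] fin i by (metis card_Diff1_less not_le)
  qed
  moreover have "I \<noteq> {}" using I(1) isotropic_over_self by (auto simp: P_def)
  ultimately show ?thesis using I(1) by (auto simp: P_def)
qed

end

end

subsection \<open>Birational equivalence\<close>

context prime_char_field
begin

definition rational_map :: "nat \<Rightarrow> (nat \<Rightarrow> 'a) \<Rightarrow> (nat \<Rightarrow> 'a) \<Rightarrow> (nat \<Rightarrow> (nat, 'a) mpoly) \<Rightarrow> bool"
  where "rational_map n a b f \<longleftrightarrow> (\<exists>K. \<forall>c. homogeneous {..<n} K (f c)) \<and> (\<exists>c<n. \<not> diag_form n a dvd f c) \<and>
    diag_form n a dvd msubst f (diag_form n b)"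

definition composes_to_id :: "nat \<Rightarrow> (nat \<Rightarrow> 'a) \<Rightarrow> (nat \<Rightarrow> (nat, 'a) mpoly) \<Rightarrow> (nat \<Rightarrow> (nat, 'a) mpoly) \<Rightarrow> bool"
  where "composes_to_id n a y G \<longleftrightarrow> rational_map n a a (\<lambda>c. msubst y (G c)) \<and>
    (\<forall>c<n. \<forall>c'<n. diag_form n a dvd mvar c * msubst y (G c') - mvar c' * msubst y (G c))"

lemma homogeneous_qf: "homogeneous {..<n} CHAR('a) (diag_form n (a :: nat \<Rightarrow> 'a))"
  unfolding diag_form_def
proof (intro homogeneous_sum homogeneous_const_mult)
  fix i assume "i \<in> {..<n}"
  then have "homogeneous {..<n} (1 * CHAR('a)) (mvar i ^ CHAR('a) :: (nat, 'a) mpoly)"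
    by (intro homogeneous_power homogeneous_mvar)
  then show "homogeneous {..<n} CHAR('a) (mvar i ^ CHAR('a) :: (nat, 'a) mpoly)" by simp
qed

lemma homogeneous_elim:
  assumes "homogeneous {..<n} k (g :: (nat, 'a) mpoly)"
  shows "homogeneous {1..<n} k (elim0 n a g)"
proof -
  have "homogeneous {1..<n} (1 * k) (elim0 n a g)"
    unfolding elim0_def
  proof (rule homogeneous_msubst[OF assms])
    fix c assume "c \<in> {..<n}"
    moreover have "homogeneous {1..<n} 1 (0 - (\<Sum>c=1..<n. mconst (a c / a 0) * mvar c))"
      by (intro homogeneous_diff homogeneous_0 homogeneous_sum homogeneous_const_mult homogeneous_mvar) auto
    ultimately show "homogeneous {1..<n} 1
        (if c = 0 then - (\<Sum>c = 1..<n. mconst (a c / a 0) * mvar c) else mvar c)"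
      by (auto intro: homogeneous_mvar[simplified])
  qed
  then show ?thesis by simp
qed

text \<open>
  If the coordinates of the generic point of \<open>X\<close> are rational functions of its image \<open>y\<close> in the
  hypersurface \<open>Y\<close> of the same dimension, then \<open>y\<close> is generic in \<open>Y\<close>.
\<close>

lemma dominant:
  assumes a: "aniso n (a :: nat \<Rightarrow> 'a)" "n \<ge> 2" and b: "aniso n (b :: nat \<Rightarrow> 'a)"
    and y: "lin_form n a dvd twisted n b y"
    and G: "\<And>c. homogeneous {..<n} D (G c)"
    and GQ: "\<And>c. c < n \<Longrightarrow> diag_form n a dvd msubst y (G c) - Q * mvar c"
    and Q: "homogeneous {..<n} d Q" "\<not> diag_form n a dvd Q"
    and h: "homogeneous {..<n} e h" "diag_form n a dvd msubst y h"
  shows "diag_form n b dvd h"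
proof (rule ccontr)
  assume nh: "\<not> diag_form n b dvd h"
  have a0: "a 0 \<noteq> 0" and n0: "n > 0" using aniso_nz[OF a(1)] a(2) by auto
  have b0: "b 0 \<noteq> 0" using aniso_nz[OF b] a(2) by auto
  define fy where "fy i = frob (y i)" for i
  define \<upsilon> where "\<upsilon> i = elim0 n a (fy i)" for i
  have \<upsilon>: "msubst \<upsilon> P = elim0 n a (msubst fy P)" for P
    unfolding \<upsilon>_def elim0_def msubst_msubst ..
  have "msubst fy (lin_form n b) = twisted n b y"
    by (simp add: lin_form_def twisted_def fy_def msubst_simps)
  then have el: "elim0 n a (msubst fy (lin_form n b)) = 0"
    using y by (simp add: lin_dvd_iff[where a = a, OF a0 n0])
  \<comment> \<open>The image point satisfies the equation of Y, so evaluation at it factors through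
    the elimination of variable 0 on Y. Both sides thus have n-1 free variables, as the counting
    argument requires.\<close>
  have \<upsilon>_elim: "msubst \<upsilon> (elim0 n b P) = elim0 n a (msubst fy P)" for P
  proof -
    obtain k where k: "P - elim0 n b P = lin_form n b * k"
      using lin_dvd_elim[where a = b, OF b0 n0, of P] by blast
    have "elim0 n a (msubst fy (P - elim0 n b P)) = 0"
      unfolding k by (simp add: msubst_simps elim0_simps el)
    then show ?thesis by (simp add: \<upsilon> msubst_simps elim0_simps)
  qed
  have \<upsilon>_frob: "msubst \<upsilon> (elim0 n b (frob P)) = elim0 n a (frob (msubst y P))" for P
    by (simp add: \<upsilon>_elim frob_msubst fy_def[abs_def])
  show False
  proof (rule no_algebraic_relation)
    show "finite {1..<n}" "{1..<n} \<noteq> {}" using a(2) by auto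
    show "homogeneous {1..<n} e (elim0 n b (frob h))"
      by (intro homogeneous_elim) (simp add: homogeneous_frob h)
    show "elim0 n b (frob h) \<noteq> 0"
      using nh by (simp add: qf_dvd_iff[OF b a(2)] lin_dvd_iff[where a = b, OF b0 n0])
    show "msubst \<upsilon> (elim0 n b (frob h)) = 0"
      using h(2) by (simp add: \<upsilon>_frob qf_dvd_iff[OF a] lin_dvd_iff[where a = a, OF a0 n0])
    show "homogeneous {1..<n} D (elim0 n b (frob (G i)))" for i
      by (intro homogeneous_elim) (simp add: homogeneous_frob G)
    show "msubst \<upsilon> (elim0 n b (frob (G i))) = elim0 n a (frob Q) * mvar i" if "i \<in> {1..<n}" for i
    proof -
      have "elim0 n a (frob (msubst y (G i) - Q * mvar i)) = 0"
        using GQ[of i] that by (simp add: qf_dvd_iff[OF a] lin_dvd_iff[where a = a, OF a0 n0])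
      then show ?thesis using that by (simp add: \<upsilon>_frob frob_simps elim0_simps elim0_mvar)
    qed
    show "homogeneous {1..<n} d (elim0 n a (frob Q))"
      by (intro homogeneous_elim) (simp add: homogeneous_frob Q)
    show "elim0 n a (frob Q) \<noteq> 0"
      using Q(2) by (simp add: qf_dvd_iff[OF a] lin_dvd_iff[where a = a, OF a0 n0])
  qed
qed

text \<open>By \<open>dominant\<close>, a form vanishes on Y as soon as its pullback along
  \<open>y\<close> vanishes on X. Every condition to be checked on Y is therefore pulled back to X,
  where \<open>G\<close> after \<open>y\<close> is multiplication by \<open>Q\<close>.\<close>

lemma birational_of_retraction:
  assumes a: "aniso n (a :: nat \<Rightarrow> 'a)" "n \<ge> 2" and b: "aniso n (b :: nat \<Rightarrow> 'a)"
    and y: "\<And>c. homogeneous {..<n} K (y c)" "lin_form n a dvd twisted n b y" "\<not> (lin_form n a)\<^sup>2 dvd twisted n b y"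
    and G: "\<And>c. homogeneous {..<n} D (G c)" "lin_form n a dvd twisted n a (\<lambda>c. msubst y (G c))"
    and GQ: "\<And>c. c < n \<Longrightarrow> diag_form n a dvd msubst y (G c) - Q * mvar c"
    and Q: "homogeneous {..<n} d Q" "\<not> diag_form n a dvd Q"
  shows "rational_map n a b y \<and> rational_map n b a G \<and> composes_to_id n a y G \<and> composes_to_id n b G y"
proof -
  note b' = b a(2)
  let ?q = "diag_form n a"
  note dom = dominant[OF a b y(2) G(1) GQ Q]
  note pr = qf_mult_iff[OF a]
  have Gy_nz: "\<not> ?q dvd msubst y (G c)" if "c < n" for c
  proof
    assume "?q dvd msubst y (G c)"
    from dvd_diff[OF this GQ[OF that]] have "?q dvd Q * mvar c" by simp
    then show False using Q(2) qf_not_dvd_mvar[OF a] pr by blast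
  qed
  have ypsi: "?q dvd msubst y (diag_form n b)" using y(2) by (simp add: qf_dvd_qf[OF a])
  have pull: "?q dvd msubst y h" if "diag_form n b dvd h" for h
    using rhom_dvd[OF rhom_msubst that] ypsi by (metis dvd_trans)
  have ynz: "\<exists>c<n. \<not> ?q dvd y c"
  proof (rule ccontr)
    assume "\<not> ?thesis"
    then have "lin_form n a ^ CHAR('a) dvd twisted n b y" by (intro lin_power_dvd_tw_if) auto
    then show False using y(3) lin_power2_dvd dvd_trans by blast
  qed
  have n0: "0 < n" using a(2) by simp
  have rat_ab: "rational_map n a b y" unfolding rational_map_def using y(1) ynz ypsi by blast
  have rat_ba: "rational_map n b a G"
    unfolding rational_map_def
  proof (intro conjI)
    show "\<exists>K. \<forall>c. homogeneous {..<n} K (G c)" using G(1) by blast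
    show "\<exists>c<n. \<not> diag_form n b dvd G c" using Gy_nz n0 pull by blast
    show "diag_form n b dvd msubst G ?q"
    proof (rule dom)
      show "homogeneous {..<n} (D * CHAR('a)) (msubst G ?q)"
        by (rule homogeneous_msubst[OF homogeneous_qf G(1)])
      show "?q dvd msubst y (msubst G ?q)"
        using G(2) by (simp add: msubst_msubst qf_dvd_qf[OF a])
    qed
  qed
  have retr_a: "composes_to_id n a y G"
    unfolding composes_to_id_def rational_map_def
  proof (intro conjI allI impI)
    show "\<exists>K. \<forall>c. homogeneous {..<n} K (msubst y (G c))"
      using homogeneous_msubst[where f = y and k = K, OF G(1) y(1)] by blast
    show "\<exists>c<n. \<not> ?q dvd msubst y (G c)" using Gy_nz n0 by blast
    show "?q dvd msubst (\<lambda>c. msubst y (G c)) ?q" using G(2) by (simp add: qf_dvd_qf[OF a])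
    fix c c' assume c: "c < n" "c' < n"
    have "mvar c * msubst y (G c') - mvar c' * msubst y (G c)
        = mvar c * (msubst y (G c') - Q * mvar c') - mvar c' * (msubst y (G c) - Q * mvar c)"
      by (simp add: algebra_simps)
    also have "?q dvd \<dots>" by (intro dvd_diff[OF dvd_mult dvd_mult] GQ c)
    finally show "?q dvd mvar c * msubst y (G c') - mvar c' * msubst y (G c)" .
  qed
  \<comment> \<open>Substituting Q x for x in \<open>y c\<close>, which is homogeneous of degree K,
    multiplies it by Q^K.\<close>
  have yGy: "?q dvd msubst y (msubst G (y c)) - Q ^ K * y c" for c
  proof -
    have "?q dvd msubst (\<lambda>i. msubst y (G i)) (y c) - msubst (\<lambda>i. Q * mvar i) (y c)"
      using GQ by (intro msubst_cong_mod_on[OF y(1)]) auto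
    then show ?thesis by (simp add: msubst_msubst msubst_scaled_homogeneous[OF y(1)])
  qed
  have retr_b: "composes_to_id n b G y"
    unfolding composes_to_id_def rational_map_def
  proof (intro conjI allI impI)
    have hom: "homogeneous {..<n} (D * K) (msubst G (y c))" for c
      by (rule homogeneous_msubst[OF y(1) G(1)])
    then show "\<exists>K. \<forall>c. homogeneous {..<n} K (msubst G (y c))" by blast
    show "\<exists>c<n. \<not> diag_form n b dvd msubst G (y c)"
    proof -
      obtain c where c: "c < n" "\<not> ?q dvd y c" using ynz by blast
      have "\<not> diag_form n b dvd msubst G (y c)"
      proof
        assume "diag_form n b dvd msubst G (y c)"
        then have "?q dvd msubst y (msubst G (y c))" by (rule pull)
        from dvd_diff[OF this yGy[of c]] have "?q dvd Q ^ K * y c" by simp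
        then have "?q dvd Q ^ K" using pr c by blast
        then show False using Q(2) qf_dvd_power[OF a] by blast
      qed
      then show ?thesis using c by blast
    qed
    show "diag_form n b dvd msubst (\<lambda>c. msubst G (y c)) (diag_form n b)"
    proof (rule dom)
      show "homogeneous {..<n} (D * K * CHAR('a)) (msubst (\<lambda>c. msubst G (y c)) (diag_form n b))"
        by (rule homogeneous_msubst[OF homogeneous_qf hom])
      have "lin_form n a dvd twisted n b (\<lambda>c. (msubst y (msubst G (y c)) - Q ^ K * y c) + Q ^ K * y c)"
        unfolding tw_add
      proof (intro dvd_add)
        show "lin_form n a dvd twisted n b (\<lambda>c. msubst y (msubst G (y c)) - Q ^ K * y c)"
          unfolding twisted_def using yGy by (intro dvd_sum dvd_mult) (simp add: qf_dvd_iff[OF a])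
        show "lin_form n a dvd twisted n b (\<lambda>c. Q ^ K * y c)"
          unfolding tw_mult using y(2) by simp
      qed
      then have "lin_form n a dvd twisted n b (\<lambda>c. msubst y (msubst G (y c)))" by simp
      then have "?q dvd msubst (\<lambda>c. msubst y (msubst G (y c))) (diag_form n b)" by (simp add: qf_dvd_qf[OF a])
      then show "?q dvd msubst y (msubst (\<lambda>c. msubst G (y c)) (diag_form n b))" by (simp add: msubst_msubst)
    qed
    fix c c' assume c: "c < n" "c' < n"
    show "diag_form n b dvd mvar c * msubst G (y c') - mvar c' * msubst G (y c)"
    proof (rule dom)
      show "homogeneous {..<n} (1 + D * K) (mvar c * msubst G (y c') - mvar c' * msubst G (y c))"
        using c by (intro homogeneous_diff homogeneous_mult homogeneous_mvar hom) auto
      have "msubst y (mvar c * msubst G (y c') - mvar c' * msubst G (y c))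
          = y c * (msubst y (msubst G (y c')) - Q ^ K * y c') - y c' * (msubst y (msubst G (y c)) - Q ^ K * y c)"
        by (simp add: msubst_simps algebra_simps)
      also have "?q dvd \<dots>" by (intro dvd_diff[OF dvd_mult dvd_mult] yGy)
      finally show "?q dvd msubst y (mvar c * msubst G (y c') - mvar c' * msubst G (y c))" .
    qed
  qed
  show ?thesis using rat_ab rat_ba retr_a retr_b by blast
qed

text \<open>
  \<open>I\<close> and \<open>J\<close> play the role of coordinates on the generic isotropic subspaces. The map sends \<open>x\<close> to
  the isotropic vector of the second form over the function field of the first one whose
  \<open>J\<close>-coordinates are (up to scalars) the \<open>I\<close>-coordinates of \<open>x\<close>; the scalars ensure that
  the image is a regular point.
\<close>

lemma exists_birational:
  assumes a: "aniso n (a :: nat \<Rightarrow> 'a)" "n \<ge> 2" and b: "aniso n (b :: nat \<Rightarrow> 'a)"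
    and t: "\<exists>t::'a. t \<noteq> 0 \<and> t \<noteq> 1"
    and ab: "isotropic_over n a n b {..<n}" and ba: "isotropic_over n b n a {..<n}"
    and I: "I \<subseteq> {..<n}" "I \<noteq> {}" "\<not> isotropic_over n a n a ({..<n} - I)" "\<And>i. i \<in> I \<Longrightarrow> isotropic_over n a n a (insert i ({..<n} - I))"
    and J: "J \<subseteq> {..<n}" "\<not> isotropic_over n b n b ({..<n} - J)" "\<And>j. j \<in> J \<Longrightarrow> isotropic_over n b n b (insert j ({..<n} - J))"
    and IJ: "card I \<le> card J"
  shows "\<exists>y G. rational_map n a b y \<and> rational_map n b a G \<and> composes_to_id n a y G \<and> composes_to_id n b G y"
proof -
  note b' = b a(2)
  have a0: "a 0 \<noteq> 0" and n0: "n > 0" using aniso_nz[OF a(1)] a(2) by auto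
  let ?q = "diag_form n a" and ?l = "lin_form n a"
  note pr = qf_mult_iff[OF a] and lpr = lin_dvd_mult_iff[where a = a, OF a0 n0]
  have finI: "finite I" and finJ: "finite J" using I(1) J(1) finite_subset by auto
  obtain \<sigma> where \<sigma>: "\<sigma> ` I \<subseteq> J" "inj_on \<sigma> I"
    using card_le_inj[OF finI finJ IJ] by blast
  \<comment> \<open>Otherwise transitivity along the isotropy of the first form over F(Y) would make
    the second form isotropic off J over F(Y).\<close>
  have nJ: "\<not> isotropic_over n a n b ({..<n} - J)" using isotropic_over_trans[OF b' a ba] J(2) by blast
  define Pm where "Pm j f d \<longleftrightarrow> (\<forall>c. c \<notin> insert j ({..<n} - J) \<longrightarrow> f c = 0) \<and> (\<forall>c. homogeneous {..<n} d (f c)) \<and>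
    ?l dvd twisted n b f \<and> \<not> ?l\<^sup>2 dvd twisted n b f" for j f d
  have "\<forall>j\<in>J. \<exists>f d. Pm j f d"
    unfolding Pm_def using isotropic_over_homogeneous[OF a b] isotropic_over_trans[OF a b' ab] J(3) by blast
  then obtain m where "\<forall>j\<in>J. \<exists>d. Pm j (m j) d"
    using bchoice[of J "\<lambda>j f. \<exists>d. Pm j f d"] by blast
  then obtain dm where "\<forall>j\<in>J. Pm j (m j) (dm j)"
    using bchoice[of J "\<lambda>j d. Pm j (m j) d"] by blast
  then have m: "\<And>j c. j \<in> J \<Longrightarrow> c \<notin> insert j ({..<n} - J) \<Longrightarrow> m j c = 0"
    "\<And>j c. j \<in> J \<Longrightarrow> homogeneous {..<n} (dm j) (m j c)"
    "\<And>j. j \<in> J \<Longrightarrow> ?l dvd twisted n b (m j)" "\<And>j. j \<in> J \<Longrightarrow> \<not> ?l\<^sup>2 dvd twisted n b (m j)"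
    unfolding Pm_def by blast+
  have mjj: "\<not> ?q dvd m j j" if j: "j \<in> J" for j
  proof
    assume dv: "?q dvd m j j"
    have "?q dvd m j c" if "c < n" for c
      by (rule not_isotropic_over_insertD[OF a nJ m(1)[OF j] restrict_vars_homogeneous[OF m(2)[OF j]] m(3)[OF j] that dv])
    then have "?l ^ CHAR('a) dvd twisted n b (m j)" by (intro lin_power_dvd_tw_if)
    then show False using m(4)[OF j] lin_power2_dvd dvd_trans by blast
  qed
  \<comment> \<open>The vectors \<open>m (\<sigma> i)\<close> cannot be scaled to have entry 1 at
    \<open>\<sigma> i\<close> without denominators. Multiplying each by the diagonal entries of the
    others gives them the common entry \<open>QA\<close> instead.\<close>
  define \<mu> where "\<mu> i = m (\<sigma> i) (\<sigma> i)" for i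
  define QI where "QI i = (\<Prod>i'\<in>I - {i}. \<mu> i')" for i
  define QA where "QA = (\<Prod>i\<in>I. \<mu> i)"
  have QI: "\<mu> i * QI i = QA" if "i \<in> I" for i
    using that finI by (simp add: QA_def QI_def prod.remove)
  have \<sigma>J: "\<sigma> i \<in> J" if "i \<in> I" for i using that \<sigma> by blast
  have \<mu>_nz: "\<not> ?q dvd \<mu> i" if "i \<in> I" for i using mjj \<sigma>J that by (simp add: \<mu>_def)
  have QA_nz: "\<not> ?q dvd QA" using \<mu>_nz finI by (simp add: QA_def qf_dvd_prod[OF a])
  have QI_nz: "\<not> ?q dvd QI i" for i using \<mu>_nz finI by (simp add: QI_def qf_dvd_prod[OF a])
  \<comment> \<open>The contribution of index i to the twisted value of \<open>y\<close> when all
    scalars are 1. Its order along \<alpha> is exactly 1, but a sum of such terms may have a higher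
    order.\<close>
  define U where "U i = mvar i * frob (QI i) * twisted n b (m (\<sigma> i))" for i
  have U1: "?l dvd U i" if "i \<in> I" for i using m(3)[OF \<sigma>J[OF that]] by (simp add: U_def)
  have U2: "\<not> ?l\<^sup>2 dvd U i" if i: "i \<in> I" for i
  proof
    assume dv: "?l\<^sup>2 dvd U i"
    obtain w where w: "twisted n b (m (\<sigma> i)) = ?l * w" using m(3)[OF \<sigma>J[OF i]] by blast
    have "\<not> ?l dvd w"
      using m(4)[OF \<sigma>J[OF i]] unfolding w power2_eq_square by (metis dvd_refl mult_dvd_mono)
    moreover have "?l * ?l dvd ?l * (mvar i * frob (QI i) * w)"
      using dv by (simp add: U_def w power2_eq_square mult_ac)
    then have "?l dvd mvar i * frob (QI i) * w"
      using lin_nz[where a = a, OF a0 n0] by (subst (asm) dvd_mult_cancel_left) auto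
    ultimately have "?l dvd frob (mvar i) \<or> ?l dvd frob (QI i)" by (simp add: lpr)
    then show False using QI_nz qf_not_dvd_mvar[OF a] unfolding qf_dvd_iff[OF a] by blast
  qed
  \<comment> \<open>Changing a single scalar from 1 to t changes the sum by (t^p - 1) U_i0, which is
    not divisible by \<alpha>^2 since t^p - 1 = (t - 1)^p is nonzero. So at least one of the two
    choices works.\<close>
  have "\<exists>\<gamma>. (\<forall>i. \<gamma> i \<noteq> 0) \<and> \<not> ?l\<^sup>2 dvd (\<Sum>i\<in>I. mconst (\<gamma> i ^ CHAR('a)) * U i)"
  proof (cases "?l\<^sup>2 dvd (\<Sum>i\<in>I. U i)")
    case False
    then show ?thesis by (intro exI[of _ "\<lambda>_. 1"]) simp
  next
    case True
    obtain i0 where i0: "i0 \<in> I" using I(2) by blast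
    obtain t :: 'a where t: "t \<noteq> 0" "t \<noteq> 1" using t by blast
    let ?\<gamma> = "\<lambda>i. if i = i0 then t else 1"
    have "(\<Sum>i\<in>I. mconst (?\<gamma> i ^ CHAR('a)) * U i) = (\<Sum>i\<in>I. U i + (if i = i0 then mconst (t ^ CHAR('a) - 1) * U i else 0))"
      by (intro sum.cong) (auto simp: mconst_simps algebra_simps)
    also have "\<dots> = (\<Sum>i\<in>I. U i) + mconst (t ^ CHAR('a) - 1) * U i0"
      using i0 finI by (simp add: sum.distrib)
    finally have eq: "(\<Sum>i\<in>I. mconst (?\<gamma> i ^ CHAR('a)) * U i) = (\<Sum>i\<in>I. U i) + mconst (t ^ CHAR('a) - 1) * U i0" .
    have "\<not> ?l\<^sup>2 dvd (\<Sum>i\<in>I. mconst (?\<gamma> i ^ CHAR('a)) * U i)"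
    proof
      assume "?l\<^sup>2 dvd (\<Sum>i\<in>I. mconst (?\<gamma> i ^ CHAR('a)) * U i)"
      from dvd_diff[OF this True] have "?l\<^sup>2 dvd mconst (t ^ CHAR('a) - 1) * U i0" by (simp add: eq)
      then have "?l\<^sup>2 dvd mconst (1 / (t ^ CHAR('a) - 1)) * (mconst (t ^ CHAR('a) - 1) * U i0)" by (rule dvd_mult)
      moreover have "t ^ CHAR('a) - 1 = (t - 1) ^ CHAR('a)"
        using rhom_diff[OF rhom_frobenius[OF prime_char], of t 1] by simp
      then have "t ^ CHAR('a) - 1 \<noteq> 0" using t(2) by (metis eq_iff_diff_eq_0 power_not_zero)
      ultimately have "?l\<^sup>2 dvd U i0" by (simp add: mconst_mult flip: mult.assoc)
      then show False using U2[OF i0] by contradiction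
    qed
    then show ?thesis using t(1) by (intro exI[of _ ?\<gamma>]) auto
  qed
  then obtain \<gamma> where \<gamma>: "\<And>i. \<gamma> i \<noteq> 0" "\<not> ?l\<^sup>2 dvd (\<Sum>i\<in>I. mconst (\<gamma> i ^ CHAR('a)) * U i)" by blast
  define y where "y c = (\<Sum>i\<in>I. (mconst (\<gamma> i) * mvar i * QI i) * m (\<sigma> i) c)" for c
  \<comment> \<open>The successor comes from the factor x_i; it also makes the degree positive, as
    \<open>transit_homogeneous\<close> requires.\<close>
  define K where "K = Suc (\<Sum>i\<in>I. dm (\<sigma> i))"
  have hom_\<mu>: "homogeneous {..<n} (dm (\<sigma> i)) (\<mu> i)" if "i \<in> I" for i
    using m(2) \<sigma>J that by (simp add: \<mu>_def)
  have hom_y: "homogeneous {..<n} K (y c)" for c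
    unfolding y_def
  proof (rule homogeneous_sum)
    fix i assume i: "i \<in> I"
    have "homogeneous {..<n} (0 + 1 + (\<Sum>i'\<in>I - {i}. dm (\<sigma> i')) + dm (\<sigma> i)) (mconst (\<gamma> i) * mvar i * QI i * m (\<sigma> i) c)"
      unfolding QI_def using i I(1) m(2) \<sigma>J hom_\<mu>
      by (intro homogeneous_mult homogeneous_mvar homogeneous_prod homogeneous_mconst) auto
    also have "0 + 1 + (\<Sum>i'\<in>I - {i}. dm (\<sigma> i')) + dm (\<sigma> i) = K"
      using i finI by (simp add: K_def sum.remove)
    finally show "homogeneous {..<n} K (mconst (\<gamma> i) * mvar i * QI i * m (\<sigma> i) c)" .
  qed
  have tw_y: "twisted n b y = (\<Sum>i\<in>I. mconst (\<gamma> i ^ CHAR('a)) * U i)"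
    unfolding y_def[abs_def] tw_sum tw_mult by (intro sum.cong) (auto simp: U_def frob_simps mult_ac)
  have y1: "?l dvd twisted n b y" unfolding tw_y by (intro dvd_sum dvd_mult U1)
  have y2: "\<not> ?l\<^sup>2 dvd twisted n b y" unfolding tw_y by (rule \<gamma>(2))
  have y_out: "y c = 0" if "\<not> c < n" for c
    unfolding y_def
  proof (intro sum.neutral ballI)
    fix i assume "i \<in> I"
    then have "m (\<sigma> i) c = 0" using that \<sigma>J J(1) by (intro m(1)) auto
    then show "mconst (\<gamma> i) * mvar i * QI i * m (\<sigma> i) c = 0" by simp
  qed
  \<comment> \<open>No cross terms arise: the vector for another index i' is zero at every place of
    J except \<open>\<sigma> i'\<close>, and \<open>\<sigma>\<close> is injective.\<close>
  have y\<sigma>: "y (\<sigma> i) = mconst (\<gamma> i) * mvar i * QA" if i: "i \<in> I" for i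
  proof -
    have "m (\<sigma> i') (\<sigma> i) = 0" if "i' \<in> I - {i}" for i'
      using that i \<sigma>J \<sigma>(2) by (intro m(1)) (auto dest: inj_onD)
    then have "y (\<sigma> i) = (mconst (\<gamma> i) * mvar i * QI i) * \<mu> i"
      unfolding y_def using i finI by (subst sum.remove[of I i]) (auto simp: \<mu>_def)
    then show ?thesis by (simp add: QI[OF i, symmetric] mult_ac)
  qed
  define Pg where "Pg i g dg \<longleftrightarrow> (\<forall>c. c \<notin> insert i ({..<n} - I) \<longrightarrow> g c = 0) \<and> (\<forall>c. homogeneous {..<n} dg (g c)) \<and>
    ?l dvd twisted n a (\<lambda>c. msubst y (g c)) \<and> (\<exists>c<n. \<not> ?q dvd msubst y (g c))" for i g dg
  have "\<exists>g dg. Pg i g dg" if i: "i \<in> I" for i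
  proof -
    have "isotropic_over n b n a (insert i ({..<n} - I))" by (rule isotropic_over_trans[OF b' a ba I(4)[OF i]])
    then show ?thesis
      unfolding Pg_def
      using hom_y y_out y1 y2 by (intro transit_homogeneous[OF a b', of K]) (auto simp: K_def)
  qed
  then have "\<forall>i\<in>I. \<exists>g dg. Pg i g dg" by blast
  then obtain g where "\<forall>i\<in>I. \<exists>dg. Pg i (g i) dg"
    using bchoice[of I "\<lambda>i g. \<exists>dg. Pg i g dg"] by blast
  then obtain dg where "\<forall>i\<in>I. Pg i (g i) (dg i)"
    using bchoice[of I "\<lambda>i dg. Pg i (g i) dg"] by blast
  then have g: "\<And>i c. i \<in> I \<Longrightarrow> c \<notin> insert i ({..<n} - I) \<Longrightarrow> g i c = 0"
    "\<And>i c. i \<in> I \<Longrightarrow> homogeneous {..<n} (dg i) (g i c)"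
    "\<And>i. i \<in> I \<Longrightarrow> ?l dvd twisted n a (\<lambda>c. msubst y (g i c))" "\<And>i. i \<in> I \<Longrightarrow> \<exists>c<n. \<not> ?q dvd msubst y (g i c)"
    unfolding Pg_def by blast+
  define \<nu> where "\<nu> i = msubst y (g i i)" for i
  have restr: "restrict_vars {..<n} (msubst y h) = msubst y h" for h
    using hom_y by (intro restrict_vars_msubst restrict_vars_homogeneous)
  have \<nu>_nz: "\<not> ?q dvd \<nu> i" if i: "i \<in> I" for i
  proof
    assume "?q dvd \<nu> i"
    then have dv: "?q dvd msubst y (g i i)" by (simp only: \<nu>_def)
    have out: "msubst y (g i c) = 0" if "c \<notin> insert i ({..<n} - I)" for c
      using g(1)[OF i that] by (simp add: msubst_simps)
    have "?q dvd msubst y (g i c)" if "c < n" for c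
      by (rule not_isotropic_over_insertD[OF a I(3), where f = "\<lambda>c. msubst y (g i c)", OF out restr g(3)[OF i] that dv])
    then show False using g(4)[OF i] by blast
  qed
  define R where "R i = (\<Prod>i'\<in>I - {i}. g i' i')" for i
  \<comment> \<open>The coordinates of \<open>y\<close> at \<open>\<sigma> i\<close>, divided by
    \<open>\<gamma> i\<close>, are x_i up to the common factor \<open>QA\<close>. They serve as
    coefficients of the vectors \<open>g i\<close>, with \<open>R i\<close> equalising the diagonal
    entries, so that \<open>G\<close> evaluated at \<open>y\<close> has the I-coordinates of Q
    x.\<close>
  define G where "G c = (\<Sum>i\<in>I. (mconst (1 / \<gamma> i) * mvar (\<sigma> i) * R i) * g i c)" for c
  define D where "D = Suc (\<Sum>i\<in>I. dg i)"
  have hom_G: "homogeneous {..<n} D (G c)" for c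
    unfolding G_def
  proof (rule homogeneous_sum)
    fix i assume i: "i \<in> I"
    have "homogeneous {..<n} (0 + 1 + (\<Sum>i'\<in>I - {i}. dg i') + dg i) (mconst (1 / \<gamma> i) * mvar (\<sigma> i) * R i * g i c)"
      unfolding R_def using i J(1) g(2) \<sigma>J
      by (intro homogeneous_mult homogeneous_mvar homogeneous_prod homogeneous_mconst) auto
    also have "0 + 1 + (\<Sum>i'\<in>I - {i}. dg i') + dg i = D"
      using i finI by (simp add: D_def sum.remove)
    finally show "homogeneous {..<n} D (mconst (1 / \<gamma> i) * mvar (\<sigma> i) * R i * g i c)" .
  qed
  define Q where "Q = QA * (\<Prod>i\<in>I. \<nu> i)"
  have Q_nz: "\<not> ?q dvd Q" using QA_nz \<nu>_nz finI by (simp add: Q_def pr qf_dvd_prod[OF a])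
  have hom_Q: "homogeneous {..<n} ((\<Sum>i\<in>I. dm (\<sigma> i)) + (\<Sum>i\<in>I. K * dg i)) Q"
    unfolding Q_def QA_def \<nu>_def using hom_\<mu> g(2) hom_y
    by (intro homogeneous_mult homogeneous_prod homogeneous_msubst) auto
  define S where "S i = mvar i * QA * (\<Prod>i'\<in>I - {i}. \<nu> i')" for i
  have Gy: "msubst y (G c) = (\<Sum>i\<in>I. S i * msubst y (g i c))" for c
    unfolding G_def msubst_simps
  proof (rule sum.cong)
    fix i assume i: "i \<in> I"
    have "mconst (1 / \<gamma> i) * mconst (\<gamma> i) = (1 :: (nat, 'a) mpoly)" using \<gamma>(1) by (simp add: mconst_mult)
    then have "mconst (1 / \<gamma> i) * (mconst (\<gamma> i) * mvar i * QA) = mvar i * QA"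
      by (simp add: mult.assoc[symmetric])
    then show "msubst y (mconst (1 / \<gamma> i)) * msubst y (mvar (\<sigma> i)) * msubst y (R i) * msubst y (g i c) = S i * msubst y (g i c)"
      by (simp add: y\<sigma>[OF i] R_def msubst_simps S_def \<nu>_def)
  qed simp
  have GyI: "msubst y (G i) = Q * mvar i" if i: "i \<in> I" for i
  proof -
    have "g i' i = 0" if "i' \<in> I - {i}" for i'
      using that i by (intro g(1)) auto
    then have "msubst y (G i) = S i * \<nu> i"
      unfolding Gy using i finI by (subst sum.remove[of I i]) (auto simp: \<nu>_def msubst_simps)
    also have "\<dots> = Q * mvar i"
      unfolding S_def Q_def using i finI by (subst prod.remove[of I i]) (auto simp: mult_ac)
    finally show ?thesis .
  qed
  have twG: "?l dvd twisted n a (\<lambda>c. msubst y (G c))"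
    unfolding Gy[abs_def] tw_sum tw_mult using g(3) by (intro dvd_sum dvd_mult) auto
  \<comment> \<open>Both G(y) and Q x are isotropic for the first form and they agree exactly on I.
    Their difference is isotropic and supported off I, where the form is anisotropic over
    F(X).\<close>
  have GQ: "?q dvd msubst y (G c) - Q * mvar c" if c: "c < n" for c
  proof -
    define z where "z c = (if c < n then msubst y (G c) - Q * mvar c else 0)" for c
    have "twisted n a (\<lambda>c. msubst y (G c)) = twisted n a (\<lambda>c. z c + Q * mvar c)"
      unfolding twisted_def by (intro sum.cong) (auto simp: z_def)
    also have "\<dots> = twisted n a z + frob Q * lin_form n a"
      unfolding tw_add tw_mult by (simp add: twisted_def lin_form_def)
    finally have "twisted n a (\<lambda>c. msubst y (G c)) = twisted n a z + frob Q * lin_form n a" .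
    then have "?l dvd twisted n a z"
      using dvd_diff[OF twG dvd_triv_right[of ?l "frob Q"]] by simp
    moreover have "z c = 0" if "c \<notin> {..<n} - I" for c
      using that GyI by (auto simp: z_def)
    moreover have "restrict_vars {..<n} (z c) = z c" for c
      using restr restrict_vars_homogeneous[OF hom_Q]
      by (auto simp: z_def restrict_vars_simps)
    ultimately have "?q dvd z c" using c by (intro not_isotropic_overD[OF a I(3)])
    then show ?thesis using c by (simp add: z_def)
  qed
  show ?thesis
    using birational_of_retraction[OF a b hom_y y1 y2 hom_G twG GQ hom_Q Q_nz] by blast
qed

theorem birational_nat:
  assumes a: "aniso n (a :: nat \<Rightarrow> 'a)" and b: "aniso n (b :: nat \<Rightarrow> 'a)" and n: "n \<ge> 2"
    and t: "\<exists>t::'a. t \<noteq> 0 \<and> t \<noteq> 1"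
    and ab: "rational_map n a b f" and ba: "rational_map n b a g"
  shows "\<exists>y G. rational_map n a b y \<and> rational_map n b a G \<and> composes_to_id n a y G \<and> composes_to_id n b G y"
proof -
  have isotropic_over: "isotropic_over n a n b {..<n}" if an: "aniso n a" and r: "rational_map n a b f" for a b :: "nat \<Rightarrow> 'a" and f
  proof -
    let ?f = "\<lambda>c. if c < n then f c else 0"
    obtain K where K: "\<And>c. homogeneous {..<n} K (f c)" using r by (auto simp: rational_map_def)
    have "lin_form n a dvd twisted n b f" using r by (simp add: rational_map_def qf_dvd_qf[OF an n])
    also have "twisted n b f = twisted n b ?f" unfolding twisted_def by (intro sum.cong) auto
    finally have "lin_form n a dvd twisted n b ?f" .
    moreover have "\<exists>c<n. \<not> diag_form n a dvd ?f c" using r by (auto simp: rational_map_def)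
    moreover have "restrict_vars {..<n} (?f c) = ?f c" for c
      using restrict_vars_homogeneous[OF K[of c]] by (auto simp: restrict_vars_simps)
    ultimately show ?thesis unfolding isotropic_over_def by (intro exI[of _ ?f]) auto
  qed
  obtain I where I: "I \<subseteq> {..<n}" "I \<noteq> {}" "\<not> isotropic_over n a n a ({..<n} - I)" "\<forall>i\<in>I. isotropic_over n a n a (insert i ({..<n} - I))"
    using exists_minimal_anisotropic[OF a n] by blast
  obtain J where J: "J \<subseteq> {..<n}" "J \<noteq> {}" "\<not> isotropic_over n b n b ({..<n} - J)" "\<forall>i\<in>J. isotropic_over n b n b (insert i ({..<n} - J))"
    using exists_minimal_anisotropic[OF b n] by blast
  note isos = isotropic_over[OF a ab] isotropic_over[OF b ba]
  show ?thesis
  proof (cases "card I \<le> card J")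
    case True
    then show ?thesis using exists_birational[OF a n b t isos I(1-3) _ J(1,3)] I(4) J(4) by blast
  next
    case False
    then have "\<exists>y G. rational_map n b a y \<and> rational_map n a b G \<and> composes_to_id n b y G \<and> composes_to_id n a G y"
      using exists_birational[OF b n a t isos(2,1) J(1-3) _ I(1,3)] I(4) J(4) by simp
    then show ?thesis by blast
  qed
qed

end

subsection \<open>Change of variables\<close>

text \<open>Renumbering the basis provides the distinguished variable 0 used for elimination,
  division and differentiation. Other variables are sent to 0, so this is inverse to
  \<open>of_idx\<close> only on polynomials in the basis variables.\<close>

definition to_idx :: "(nat \<Rightarrow> 'v) \<Rightarrow> nat \<Rightarrow> ('v, 'a::comm_ring_1) mpoly \<Rightarrow> (nat, 'a) mpoly"
  where "to_idx e n = msubst (\<lambda>v. if v \<in> e ` {..<n} then mvar (the_inv_into {..<n} e v) else 0)"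

definition of_idx :: "(nat \<Rightarrow> 'v) \<Rightarrow> nat \<Rightarrow> (nat, 'a::comm_ring_1) mpoly \<Rightarrow> ('v, 'a) mpoly"
  where "of_idx e n = msubst (\<lambda>i. if i < n then mvar (e i) else 0)"

lemma rhom_to_idx: "rhom (to_idx e n)" and rhom_of_idx: "rhom (of_idx e n)"
  by (simp_all add: to_idx_def of_idx_def rhom_msubst)

lemmas to_idx_simps = rhom_simps[OF rhom_to_idx]
lemmas of_idx_simps = rhom_simps[OF rhom_of_idx]

lemma to_idx_mconst [simp]: "to_idx e n (mconst c) = mconst c"
  and of_idx_mconst [simp]: "of_idx e n (mconst c) = mconst c"
  by (simp_all add: to_idx_def of_idx_def)

lemma of_idx_mvar: "i < n \<Longrightarrow> of_idx e n (mvar i) = mvar (e i)"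
  by (simp add: of_idx_def)

context
  fixes e :: "nat \<Rightarrow> 'v" and n :: nat and B :: "'v set"
  assumes e: "bij_betw e {..<n} B"
begin

lemma idx_e: "i < n \<Longrightarrow> the_inv_into {..<n} e (e i) = i"
  using e by (intro the_inv_into_f_f) (auto simp: bij_betw_def)

lemma e_idx: "v \<in> B \<Longrightarrow> e (the_inv_into {..<n} e v) = v"
  using e by (intro f_the_inv_into_f) (auto simp: bij_betw_def)

lemma idx_less: "v \<in> B \<Longrightarrow> the_inv_into {..<n} e v < n"
  using e by (auto simp: bij_betw_def idx_e)

lemma e_in: "i < n \<Longrightarrow> e i \<in> B"
  using e by (auto simp: bij_betw_def)

lemma to_idx_mvar: "i < n \<Longrightarrow> to_idx e n (mvar (e i)) = mvar i"
  by (simp add: to_idx_def idx_e)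

lemma of_idx_to_idx: "homogeneous B k g \<Longrightarrow> of_idx e n (to_idx e n g) = g"
proof -
  assume g: "homogeneous B k g"
  have "of_idx e n (to_idx e n g) = restrict_vars B g"
  proof (rule rhom_mpoly_eqI[where h = "\<lambda>g. of_idx e n (to_idx e n g)"])
    show "rhom (\<lambda>g. of_idx e n (to_idx e n g))" by (rule rhom_comp[OF rhom_to_idx rhom_of_idx])
    show "of_idx e n (to_idx e n (mvar v)) = restrict_vars B (mvar v)" for v
      using e by (auto simp: to_idx_def of_idx_mvar msubst_simps of_idx_simps idx_less e_idx bij_betw_def idx_e)
  qed (simp_all add: rhom_restrict_vars)
  then show ?thesis using restrict_vars_homogeneous[OF g] by simp
qed

lemma to_idx_of_idx: "homogeneous {..<n} k g \<Longrightarrow> to_idx e n (of_idx e n g) = g"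
proof -
  assume g: "homogeneous {..<n} k g"
  have "to_idx e n (of_idx e n g) = restrict_vars {..<n} g"
  proof (rule rhom_mpoly_eqI[where h = "\<lambda>g. to_idx e n (of_idx e n g)"])
    show "rhom (\<lambda>g. to_idx e n (of_idx e n g))" by (rule rhom_comp[OF rhom_of_idx rhom_to_idx])
    show "to_idx e n (of_idx e n (mvar i)) = restrict_vars {..<n} (mvar i)" for i
      by (auto simp: of_idx_def to_idx_mvar to_idx_simps)
  qed (simp_all add: rhom_restrict_vars)
  then show ?thesis using restrict_vars_homogeneous[OF g] by simp
qed

lemma homogeneous_to_idx: "homogeneous B k g \<Longrightarrow> homogeneous {..<n} k (to_idx e n g)"
  using homogeneous_msubst[of B k g "{..<n}" 1 "\<lambda>v. if v \<in> e ` {..<n} then mvar (the_inv_into {..<n} e v) else 0"]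
    homogeneous_mvar[of _ "{..<n}"] idx_less e
  by (auto simp: to_idx_def bij_betw_def)

lemma homogeneous_of_idx: "homogeneous {..<n} k g \<Longrightarrow> homogeneous B k (of_idx e n g)"
  using homogeneous_msubst[of "{..<n}" k g B 1 "\<lambda>i. if i < n then mvar (e i) else 0"]
    homogeneous_mvar[of _ B] e_in
  by (auto simp: of_idx_def)

lemma sum_over_B: "(\<Sum>v\<in>B. h v) = (\<Sum>i<n. h (e i))"
  using sum.reindex_bij_betw[OF e, of h] by simp

lemma form_poly_of_idx: "form_poly CHAR('a) B \<phi> = of_idx e n (diag_form n (\<lambda>i. \<phi> (e i)) :: (nat, 'a::comm_ring_1) mpoly)"
  by (simp add: form_poly_def diag_form_def sum_over_B of_idx_simps of_idx_mvar)

lemma form_poly_to_idx: "diag_form n (\<lambda>i. \<phi> (e i)) = to_idx e n (form_poly CHAR('a) B \<phi> :: ('v, 'a::comm_ring_1) mpoly)"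
  by (simp add: form_poly_def diag_form_def sum_over_B to_idx_simps to_idx_mvar)

lemma zero_on_of_idx:
  fixes \<phi> :: "'v \<Rightarrow> 'a::comm_ring_1"
  shows "diag_form n (\<lambda>i. \<phi> (e i)) dvd g \<Longrightarrow> zero_on CHAR('a) B \<phi> (of_idx e n g)"
  unfolding zero_on_def form_poly_of_idx by (rule rhom_dvd[OF rhom_of_idx])

lemma zero_on_to_idx:
  fixes \<phi> :: "'v \<Rightarrow> 'a::comm_ring_1"
  shows "zero_on CHAR('a) B \<phi> g \<Longrightarrow> diag_form n (\<lambda>i. \<phi> (e i)) dvd to_idx e n g"
  unfolding zero_on_def form_poly_to_idx by (rule rhom_dvd[OF rhom_to_idx])

end

context prime_char_field
begin

context
  fixes e :: "nat \<Rightarrow> 'v" and e' :: "nat \<Rightarrow> 'w" and n :: nat and B :: "'v set" and C :: "'w set"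
    and \<phi> :: "'v \<Rightarrow> 'a" and \<psi> :: "'w \<Rightarrow> 'a"
  assumes e: "bij_betw e {..<n} B" and e': "bij_betw e' {..<n} C"
begin

lemma rational_map_if_represents:
  assumes "represents_rational CHAR('a) B \<phi> C \<psi> f"
  shows "\<exists>f'. rational_map n (\<lambda>i. \<phi> (e i)) (\<lambda>i. \<psi> (e' i)) f'"
proof -
  obtain k where k: "\<And>c. c \<in> C \<Longrightarrow> homogeneous B k (f c)" and nz: "\<exists>c\<in>C. \<not> zero_on CHAR('a) B \<phi> (f c)"
    and z: "zero_on CHAR('a) B \<phi> (msubst f (form_poly CHAR('a) C \<psi>))"
    using assms unfolding represents_rational_def by blast
  let ?q = "diag_form n (\<lambda>i. \<phi> (e i))"
  define f' where "f' i = (if i < n then to_idx e n (f (e' i)) else 0)" for i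
  have "homogeneous {..<n} k (f' i)" for i
    using k e_in[OF e'] by (simp add: f'_def homogeneous_to_idx[OF e])
  moreover have "\<exists>i<n. \<not> ?q dvd f' i"
  proof -
    obtain c where c: "c \<in> C" "\<not> zero_on CHAR('a) B \<phi> (f c)" using nz by blast
    let ?i = "the_inv_into {..<n} e' c"
    have i: "?i < n" "e' ?i = c" using idx_less[OF e' c(1)] e_idx[OF e' c(1)] by auto
    have "\<not> ?q dvd to_idx e n (f c)"
      using zero_on_of_idx[OF e, of \<phi> "to_idx e n (f c)"] of_idx_to_idx[OF e k[OF c(1)]] c(2) by metis
    then show ?thesis using i by (intro exI[of _ ?i]) (simp add: f'_def)
  qed
  moreover have "?q dvd msubst f' (diag_form n (\<lambda>i. \<psi> (e' i)))"
  proof -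
    have "to_idx e n (msubst f (form_poly CHAR('a) C \<psi>)) = msubst f' (diag_form n (\<lambda>i. \<psi> (e' i)))"
      by (simp add: form_poly_def diag_form_def sum_over_B[OF e'] msubst_simps to_idx_simps f'_def)
    then show ?thesis using zero_on_to_idx[OF e z] by simp
  qed
  ultimately show ?thesis unfolding rational_map_def by blast
qed

definition lift :: "(nat \<Rightarrow> (nat, 'a) mpoly) \<Rightarrow> 'w \<Rightarrow> ('v, 'a) mpoly"
  where "lift y c = of_idx e n (y (the_inv_into {..<n} e' c))"

lemma represents_lift:
  assumes y: "rational_map n (\<lambda>i. \<phi> (e i)) (\<lambda>i. \<psi> (e' i)) y"
  shows "represents_rational CHAR('a) B \<phi> C \<psi> (lift y)"
proof -
  let ?q = "diag_form n (\<lambda>i. \<phi> (e i))"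
  obtain K where K: "\<And>c. homogeneous {..<n} K (y c)" using y by (auto simp: rational_map_def)
  have "homogeneous B K (lift y c)" for c
    unfolding lift_def by (rule homogeneous_of_idx[OF e K])
  moreover have "\<exists>c\<in>C. \<not> zero_on CHAR('a) B \<phi> (lift y c)"
  proof -
    obtain i where i: "i < n" "\<not> ?q dvd y i" using y by (auto simp: rational_map_def)
    have "\<not> zero_on CHAR('a) B \<phi> (of_idx e n (y i))"
      using zero_on_to_idx[OF e, of \<phi> "of_idx e n (y i)"] to_idx_of_idx[OF e K[of i]] i(2) by metis
    then show ?thesis using i(1) e_in[OF e'] by (intro bexI[of _ "e' i"]) (simp_all add: lift_def idx_e[OF e'])
  qed
  moreover have "zero_on CHAR('a) B \<phi> (msubst (lift y) (form_poly CHAR('a) C \<psi>))"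
  proof -
    have "msubst (lift y) (form_poly CHAR('a) C \<psi>) = of_idx e n (msubst y (diag_form n (\<lambda>i. \<psi> (e' i))))"
      by (simp add: form_poly_def diag_form_def sum_over_B[OF e'] msubst_simps of_idx_simps lift_def idx_e[OF e'])
    moreover have "?q dvd msubst y (diag_form n (\<lambda>i. \<psi> (e' i)))" using y by (simp add: rational_map_def)
    ultimately show ?thesis using zero_on_of_idx[OF e, of \<phi> "msubst y (diag_form n (\<lambda>i. \<psi> (e' i)))"] by simp
  qed
  ultimately show ?thesis unfolding represents_rational_def by blast
qed

lemma msubst_lift:
  assumes "homogeneous {..<n} k g"
  shows "msubst (lift y) (of_idx e' n g) = of_idx e n (msubst y g)"
proof -
  have "msubst (lift y) (of_idx e' n g) = msubst (\<lambda>i. if i \<in> {..<n} then of_idx e n (y i) else 0) g"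
    unfolding of_idx_def[of e'] msubst_msubst
    by (intro arg_cong2[where f = msubst] ext) (auto simp: lift_def idx_e[OF e'] msubst_simps)
  also have "\<dots> = msubst (\<lambda>i. of_idx e n (y i)) (restrict_vars {..<n} g)"
    by (rule msubst_of_restrict_vars[symmetric])
  also have "\<dots> = of_idx e n (msubst y g)"
    unfolding restrict_vars_homogeneous[OF assms] of_idx_def[of e] msubst_msubst ..
  finally show ?thesis .
qed

end

text \<open>Renumbering commutes with composition, so proportionality of the composite to the
  identity, tested in indexed variables, gives membership in the class of the identity.\<close>

lemma composite_lift:
  fixes e :: "nat \<Rightarrow> 'v" and e' :: "nat \<Rightarrow> 'w" and \<phi> :: "'v \<Rightarrow> 'a"
  assumes e: "bij_betw e {..<n} B" and e': "bij_betw e' {..<n} C"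
    and an: "aniso n (\<lambda>i. \<phi> (e i))" "n \<ge> 2"
    and r: "composes_to_id n (\<lambda>i. \<phi> (e i)) y G" and G: "\<And>c. homogeneous {..<n} D (G c)"
  shows "(\<lambda>z. msubst (lift e e' n y) (lift e' e n G z)) \<in> rational_id CHAR('a) B \<phi>"
proof -
  let ?i = "the_inv_into {..<n} e" and ?q = "diag_form n (\<lambda>i. \<phi> (e i))"
  have l: "lift e' e n G z = of_idx e' n (G (?i z))" "lift e e n Y z = of_idx e n (Y (?i z))" for z Y
    by (simp_all add: lift_def[OF e' e] lift_def[OF e e])
  have comp: "(\<lambda>z. msubst (lift e e' n y) (lift e' e n G z)) = lift e e n (\<lambda>c. msubst y (G c))"
  proof
    fix z
    show "msubst (lift e e' n y) (lift e' e n G z) = lift e e n (\<lambda>c. msubst y (G c)) z"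
      using msubst_lift[OF e e' G[of "?i z"], of y] by (simp only: l)
  qed
  have "represents_rational CHAR('a) B \<phi> B \<phi> (lift e e n (\<lambda>c. msubst y (G c)))"
    using r by (intro represents_lift[OF e e]) (simp add: composes_to_id_def)
  moreover have "represents_rational CHAR('a) B \<phi> B \<phi> mvar"
    unfolding represents_rational_def
  proof (intro conjI)
    show "\<exists>k. \<forall>c\<in>B. homogeneous B k (mvar c :: ('v, 'a) mpoly)"
      by (intro exI[of _ 1] ballI homogeneous_mvar)
    have "\<not> zero_on CHAR('a) B \<phi> (mvar (e 0))"
    proof
      assume "zero_on CHAR('a) B \<phi> (mvar (e 0))"
      from zero_on_to_idx[OF e this] have "?q dvd mvar 0" using an(2) by (simp add: to_idx_mvar[OF e])
      then show False using qf_not_dvd_mvar[OF an] by blast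
    qed
    then show "\<exists>c\<in>B. \<not> zero_on CHAR('a) B \<phi> (mvar c)" using e_in[OF e, of 0] an(2) by auto
    show "zero_on CHAR('a) B \<phi> (msubst mvar (form_poly CHAR('a) B \<phi>))"
      by (simp add: zero_on_def msubst_eq_ev ev_id)
  qed
  moreover have "zero_on CHAR('a) B \<phi> (mvar c * lift e e n (\<lambda>c. msubst y (G c)) c'
      - mvar c' * lift e e n (\<lambda>c. msubst y (G c)) c)" if c: "c \<in> B" "c' \<in> B" for c c'
  proof -
    have "mvar c * lift e e n (\<lambda>c. msubst y (G c)) c' - mvar c' * lift e e n (\<lambda>c. msubst y (G c)) c
      = of_idx e n (mvar (?i c) * msubst y (G (?i c')) - mvar (?i c') * msubst y (G (?i c)))"
      using c by (simp add: l of_idx_simps of_idx_mvar idx_less[OF e] e_idx[OF e])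
    also have "zero_on CHAR('a) B \<phi> \<dots>"
      using r c idx_less[OF e] by (intro zero_on_of_idx[OF e]) (auto simp: composes_to_id_def)
    finally show ?thesis .
  qed
  ultimately show ?thesis unfolding comp rational_id_def rational_rel_def by blast
qed

lemma aniso_basis:
  fixes scale :: "'a \<Rightarrow> 'v::ab_group_add \<Rightarrow> 'v"
  assumes V: "finite_dimensional_vector_space scale B" and e: "bij_betw e {..<n} B"
    and \<phi>: "quasilinear_form CHAR('a) scale \<phi>" "anisotropic \<phi>"
  shows "aniso n (\<lambda>i. \<phi> (e i))"
  unfolding aniso_def
proof (intro allI impI)
  interpret finite_dimensional_vector_space scale B by (rule V)
  fix c i assume 0: "(\<Sum>i<n. \<phi> (e i) * c i ^ CHAR('a)) = 0" and i: "i < n"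
  have add: "\<phi> (v + w) = \<phi> v + \<phi> w" and sc: "\<phi> (scale x v) = x ^ CHAR('a) * \<phi> v" for v w x
    using \<phi>(1) by (auto simp: quasilinear_form_def)
  have phi0: "\<phi> 0 = 0" using sc[of 0 0] p_pos by (simp add: power_0_left)
  have sum: "\<phi> (sum f A) = (\<Sum>i\<in>A. \<phi> (f i))" for f :: "nat \<Rightarrow> 'v" and A
    by (induction A rule: infinite_finite_induct) (auto simp: phi0 add)
  have "\<phi> (\<Sum>i<n. scale (c i) (e i)) = 0" using 0 by (simp add: sum sc mult.commute)
  then have "(\<Sum>i<n. scale (c i) (e i)) = 0" using \<phi>(2) by (auto simp: isotropic_def)
  moreover have "(\<Sum>i<n. scale (c i) (e i)) = (\<Sum>v\<in>B. scale (c (the_inv_into {..<n} e v)) v)"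
    by (simp add: sum_over_B[OF e] idx_e[OF e])
  ultimately have "(\<Sum>v\<in>B. scale (c (the_inv_into {..<n} e v)) v) = 0" by simp
  from independentD[OF independent_Basis finite_Basis subset_refl this e_in[OF e i]]
  have "c (the_inv_into {..<n} e (e i)) = 0" .
  then show "c i = 0" by (simp add: idx_e[OF e i])
qed

end

theorem theorem7p7:
  fixes scaleV :: "'a::field \<Rightarrow> 'v::ab_group_add \<Rightarrow> 'v"
    and scaleW :: "'a \<Rightarrow> 'w::ab_group_add \<Rightarrow> 'w"
    and B :: "'v set" and C :: "'w set"
    and \<phi> :: "'v \<Rightarrow> 'a" and \<psi> :: "'w \<Rightarrow> 'a"
    and p d :: nat
  assumes p: "p = 2 \<or> p = 3"
    and char: "CHAR('a) = p"
    and nonperfect: "\<not> surj (\<lambda>x::'a. x ^ p)"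
    and V: "finite_dimensional_vector_space scaleV B"
    and W: "finite_dimensional_vector_space scaleW C"
    and dimV: "vector_space.dim scaleV UNIV = d + 2"
    and dimW: "vector_space.dim scaleW UNIV = d + 2"
    and \<phi>: "quasilinear_form p scaleV \<phi>" "anisotropic \<phi>"
    and \<psi>: "quasilinear_form p scaleW \<psi>" "anisotropic \<psi>"
    and XY: "rational_morphisms p B \<phi> C \<psi> \<noteq> {}"
    and YX: "rational_morphisms p C \<psi> B \<phi> \<noteq> {}"
  shows "birational p B \<phi> C \<psi>"
proof -
  have prime: "prime CHAR('a)" using p char by auto
  interpret prime_char_field "TYPE('a)" by standard (rule prime)
  note [simp] = char[symmetric]
  interpret V: finite_dimensional_vector_space scaleV B by (rule V)
  interpret W: finite_dimensional_vector_space scaleW C by (rule W)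
  define n where "n = d + 2"
  have n: "n \<ge> 2" by (simp add: n_def)
  have "card B = n" "card C = n" using dimV dimW V.dim_UNIV W.dim_UNIV by (simp_all add: n_def V.dimension_def W.dimension_def)
  then obtain e e' where e: "bij_betw e {..<n} B" and e': "bij_betw e' {..<n} C"
    using ex_bij_betw_nat_finite[OF V.finite_Basis] ex_bij_betw_nat_finite[OF W.finite_Basis]
    by (auto simp: lessThan_atLeast0)
  let ?a = "\<lambda>i. \<phi> (e i)" and ?b = "\<lambda>i. \<psi> (e' i)"
  have a: "aniso n ?a" using aniso_basis[OF V e] \<phi> by simp
  have b: "aniso n ?b" using aniso_basis[OF W e'] \<psi> by simp
  \<comment> \<open>A field with only the elements 0 and 1 satisfies x^p = x and would be perfect.
    The element t supplies the second scalar needed to make the image point regular.\<close>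
  have t: "\<exists>t::'a. t \<noteq> 0 \<and> t \<noteq> 1"
  proof (rule ccontr)
    assume "\<not> ?thesis"
    then have "x ^ p = x" for x :: 'a using p by (metis power_one zero_power pos2 zero_less_numeral)
    then show False using nonperfect by (simp add: surj_def)
  qed
  obtain f where f: "represents_rational CHAR('a) B \<phi> C \<psi> f"
    using XY by (auto simp: rational_morphisms_def quotient_def)
  obtain g where g: "represents_rational CHAR('a) C \<psi> B \<phi> g"
    using YX by (auto simp: rational_morphisms_def quotient_def)
  obtain f' where f': "rational_map n ?a ?b f'" using rational_map_if_represents[OF e e' f] by blast
  obtain g' where g': "rational_map n ?b ?a g'" using rational_map_if_represents[OF e' e g] by blast
  obtain y G where y: "rational_map n ?a ?b y" and G: "rational_map n ?b ?a G" and r: "composes_to_id n ?a y G" "composes_to_id n ?b G y"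
    using birational_nat[OF a b n t f' g'] by blast
  obtain K D where hom: "\<And>c. homogeneous {..<n} K (y c)" "\<And>c. homogeneous {..<n} D (G c)"
    using y G by (auto simp: rational_map_def)
  let ?y = "lift e e' n y" and ?G = "lift e' e n G"
  let ?\<alpha> = "rational_rel p B \<phi> C \<psi> `` {?y}" and ?\<beta> = "rational_rel p C \<psi> B \<phi> `` {?G}"
  have ry: "represents_rational p B \<phi> C \<psi> ?y" using represents_lift[OF e e' y] by simp
  have rG: "represents_rational p C \<psi> B \<phi> ?G" using represents_lift[OF e' e G] by simp
  have "?y \<in> ?\<alpha>" "?G \<in> ?\<beta>"
    using ry rG by (simp_all add: rational_rel_def zero_on_def mult.commute)
  moreover have "?\<alpha> \<in> rational_morphisms p B \<phi> C \<psi>" "?\<beta> \<in> rational_morphisms p C \<psi> B \<phi>"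
    using ry rG by (auto simp: rational_morphisms_def intro: quotientI)
  moreover have "(\<lambda>z. msubst ?y (?G z)) \<in> rational_id p B \<phi>"
    using composite_lift[OF e e' a n r(1) hom(2)] by simp
  moreover have "(\<lambda>z. msubst ?G (?y z)) \<in> rational_id p C \<psi>"
    using composite_lift[OF e' e b n r(2) hom(1)] by simp
  ultimately show ?thesis unfolding birational_def rational_composite_def by blast
qed

end
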